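(* Let $\mathbb X\subseteq\mathbb R^p$ be closed and convex with $r\,\mathbb B^p\subseteq\mathbb X\subseteq R\,\mathbb B^p$ for constants $r,R>0$. For $i\in[n]$, $t\in\mathbb N_+$ let $f_{i,t}:\mathbb X\to\mathbb R$ (possibly nonconvex) and $g_{i,t}:\mathbb X\to\mathbb R^{m_i}$ (convex componentwise) be differentiable, and suppose there are constants $G_1,G_2,L$ such that for all $i,t$ and all $x,y\in\mathbb X$: $\|\nabla f_{i,t}(x)\|\le G_1$, $\|\nabla g_{i,t}(x)\|\le G_2$, $\|\nabla f_{i,t}(x)-\nabla f_{i,t}(y)\|\le L\|x-y\|$. Suppose the directed graphs $\mathcal G_t=([n],\mathcal E_t)$ with mixing matrices $W_t$ satisfy, for all $t\in\mathbb N_+$: (i) for some constant $w\in(0,1)$, $[W_t]_{ij}\ge w$ if $(j,i)\in\mathcal E_t$ or $i=j$, and $[W_t]_{ij}=0$ otherwise; (ii) $W_t$ is doubly stochastic; (iii) for some integer $B>0$ (independent of $t$) the graph $([n],\cup_{l=0}^{B-1}\mathcal E_{t+l})$ is strongly connected. Suppose the compressor $\mathcal C:\mathbb Y\to\mathbb Y$, $\mathbb Y\subseteq\mathbb R^p$, satisfies $\mathbf E_{\mathcal C}[\|\mathcal C(x)-x\|^2]\le C$ for all $x\in\mathbb Y$, with a constant $C\ge0$. Let $\{x_{i,t}\}$ be generated by the compressed two-point bandit algorithm described in the context with $$\alpha_t=\frac{\alpha_0}{t^{\theta_1}},\quad \gamma_t=\frac{\gamma_0}{\alpha_t},\quad \xi_t=\alpha_t,\quad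 \delta_t=r\alpha_t,\quad s_t=\frac{s_0}{t^{\theta_2}},$$ where $\alpha_0>0$ (with $\alpha_0<1$, so that $\xi_t\in(0,1)$ as the algorithm requires), $\theta_1\in(0,1)$, $\gamma_0\in\big(0,\,1/(4(p^2+1)G_2^2)\big]$, $s_0>0$ and $\theta_2\ge1$ are constants. Then, for any $T\in\mathbb N_+$, $$\mathbf E[\mathrm{Net\text{-}Reg}(T)]=\mathcal O\big(T^{\max\{1-\theta_1,\theta_1\}}\big),\qquad \mathbf E[\mathrm{Net\text{-}CCV}(T)]=\mathcal O\big(T^{1-\theta_1/2}\big).$$ Moreover, if in addition (Slater's condition) there exist $x_s\in\mathbb X$ and $\varsigma_s>0$ with $g_t(x_s)\le-\varsigma_s\mathbf 1_m$ for all $t\in\mathbb N_+$, then $$\mathbf E[\mathrm{Net\text{-}CCV}(T)]=\mathcal O\big(T^{1-\theta_1}\big).$$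
   Context: Notation: $\mathbb N_+$ is the set of positive integers, $[n]=\{1,\dots,n\}$. $\|\cdot\|$ is the Euclidean norm for vectors and the spectral norm for matrices; $\mathbb B^p,\mathbb S^p$ are the Euclidean unit ball and sphere in $\mathbb R^p$; inequalities between vectors are componentwise; $[x]_+$ is the componentwise positive part; $\mathcal P_{\mathbb K}$ is Euclidean projection onto $\mathbb K$; $\mathbf 0,\mathbf 1$ are the all-zero and all-one vectors. $\nabla g_{i,t}(x)\in\mathbb R^{p\times m_i}$. $\mathbf E_{\mathcal C}$ is expectation over the internal randomness of the (possibly stochastic) compressor; fresh randomness is used at each call. $\mathbf E$ is total expectation over all randomness (perturbations and compressor). $p_T=\mathcal O(q_T)$ means there is a constant $a>0$, independent of $T$, with $p_T\le a q_T$ for all $T$. Problem: $n$ agents; $f_t(x)=\frac1n\sum_{j=1}^nf_{j,t}(x)$; $g_t(x)=\mathrm{col}(g_{1,t}(x),\dots,g_{n,t}(x))\in\mathbb R^m$, $m=\sum_im_i$; $\mathcal X_T=\{x\in\mathbb X: g_t(x)\le\mathbf 0_m\ \forall t\in[T]\}$, assumed nonempty for all $T\in\mathbb N_+$. Performance measures: $$\mathrm{Net\text{-}Reg}(T)=\frac1n\sum_{i=1}^n\Big(\sum_{t=1}^T\langle\nabla f_t(x_{i,t}),x_{i,t}\rangle-\inf_{x\in\mathcal X_T}\Big\langle\sum_{t=1}^T\nabla f_t(x_{i,t}),x\Big\rangle\Big),\quad \mathrm{Net\text{-}CCV}(T)=\frac1n\sum_{i=1}^n\sum_{t=1}^T\|[g_t(x_{i,t})]_+\|.$$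 Graph: $(j,i)\in\mathcal E_t$ means agent $i$ receives information from agent $j$; $\mathcal N_i^{\rm in}(\mathcal G_t)=\{j:(j,i)\in\mathcal E_t\}$; $\mathcal N_i^{\rm in}(\mathcal G_0)=\mathcal N_i^{\rm in}(\mathcal G_1)$. Algorithm (compressed, two-point bandit). Parameters: $\alpha_t>0$ (nonincreasing), $\gamma_t>0$ (nondecreasing), $\xi_t\in(0,1)$ (nonincreasing), $\delta_t\in(0,r\xi_t]$ (nonincreasing), $s_t>0$ (decreasing). Initialization: $\hat z_{j,0}^i=\hat z_{j,0}=\mathbf 0_p$, $z_{i,1}\in(1-\xi_1)\mathbb X$. For $t=1,2,\dots$ and each $i\in[n]$: (a) $\hat z_{j,t}=\hat z_{j,t-1}+s_t\mathcal C\big((z_{j,t}-\hat z_{j,t-1})/s_t\big)$ for $j\in[n]$; agent $i$ stores $\hat z^i_{j,t}=\hat z^i_{j,t-1}+s_t\mathcal C\big((z_{j,t}-\hat z_{j,t-1})/s_t\big)$ (same compressed message) if $j\in(\mathcal N_i^{\rm in}(\mathcal G_t)\cap\mathcal N_i^{\rm in}(\mathcal G_{t-1}))\cup\{i\}$, and $\hat z^i_{j,t}=\hat z_{j,t}$ if $j\in\mathcal N_i^{\rm in}(\mathcal G_t)\setminus\mathcal N_i^{\rm in}(\mathcal G_{t-1})$ (so $\hat z^i_{j,t}=\hat z_{j,t}$ for all $j\in\mathcal N_i^{\rm in}(\mathcal G_t)\cup\{i\}$); (b) $x_{i,t}=\sum_{j=1}^n[W_t]_{ij}\hat z^i_{j,t}$;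 (c) draw $u_{i,t}$ uniformly from $\mathbb S^p$, independently over $i$ and $t$, and observe $f_{i,t},g_{i,t}$ at $x_{i,t}$ and at $x_{i,t}+\delta_tu_{i,t}$; form $\hat\nabla_2f_{i,t}(x_{i,t})=\frac p{\delta_t}\big(f_{i,t}(x_{i,t}+\delta_tu_{i,t})-f_{i,t}(x_{i,t})\big)u_{i,t}\in\mathbb R^p$ and $\hat\nabla_2g_{i,t}(x_{i,t})=\frac p{\delta_t}u_{i,t}\big(g_{i,t}(x_{i,t}+\delta_tu_{i,t})-g_{i,t}(x_{i,t})\big)^T\in\mathbb R^{p\times m_i}$; (d) $v_{i,t+1}=\gamma_t[g_{i,t}(x_{i,t})]_+$, $b_{i,t+1}=\hat\nabla_2f_{i,t}(x_{i,t})+\hat\nabla_2g_{i,t}(x_{i,t})v_{i,t+1}$, $z_{i,t+1}=\mathcal P_{(1-\xi_{t+1})\mathbb X}(x_{i,t}-\alpha_tb_{i,t+1})$. Standing convention: $x_{i,t}\in(1-\xi_t)\mathbb X$, so the query points $x_{i,t}+\delta_tu_{i,t}$ lie in $\mathbb X$, and all arguments of $\mathcal C$ lie in $\mathbb Y$. *)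

theory Defs
  imports "HOL-Probability.Probability"
begin

text \<open>
  Agents are the elements of a finite type \<open>'n\<close>, and points of the decision space are vectors in
  \<open>real ^ 'p\<close>. Constraint functions of agent \<open>i\<close> take values in a space whose dimension \<open>m i\<close>
  depends on \<open>i\<close>; such vectors are functions on \<open>nat\<close> of which only the entries \<open>k < m i\<close> matter,
  with Euclidean norm \<^term>\<open>L2_set v {..<m i}\<close>. Rounds are numbered from 1.
\<close>


section \<open>Gradients and the spectral norm\<close>

text \<open>
  The functions live on a convex set \<open>X\<close> with nonempty interior, so differentiability at a boundary
  point of \<open>X\<close> is meant relative to \<open>X\<close>; by \<open>gradient_eqI\<close> below the gradient is unique there too.
\<close>

definition gradient :: "(real ^ 'p) set \<Rightarrow> (real ^ 'p \<Rightarrow> real) \<Rightarrow> real ^ 'p \<Rightarrow> real ^ 'p" where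
  "gradient X h x = (\<chi> k. frechet_derivative h (at x within X) (axis k 1))"

lemma gradient_has_derivative:
  assumes "h differentiable (at x within X)"
  shows "(h has_derivative (\<lambda>v. gradient X h x \<bullet> v)) (at x within X)"
proof -
  let ?D = "frechet_derivative h (at x within X)"
  have der: "(h has_derivative ?D) (at x within X)"
    using assms frechet_derivative_works by blast
  then have lin: "linear ?D"
    using has_derivative_linear by blast
  have "?D v = gradient X h x \<bullet> v" for v
  proof -
    have "?D v = ?D (\<Sum>k\<in>UNIV. v $ k *\<^sub>R axis k 1)"
      using basis_expansion[of v] by (simp add: scalar_mult_eq_scaleR)
    also have "\<dots> = (\<Sum>k\<in>UNIV. v $ k * ?D (axis k 1))"
      using lin by (simp add: linear_sum linear_scale)
    finally show ?thesis
      by (simp add: gradient_def inner_vec_def mult.commute)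
  qed
  then show ?thesis
    using der by (metis (no_types, lifting) ext)
qed

lemma gradient_eqI:
  assumes "convex X" "interior X \<noteq> {}" "x \<in> X"
    and D: "(h has_derivative (\<lambda>v. D \<bullet> v)) (at x within X)"
  shows "gradient X h x = D"
proof -
  let ?D = "gradient X h x"
  have D': "(h has_derivative (\<lambda>v. ?D \<bullet> v)) (at x within X)"
    using D differentiableI gradient_has_derivative by blast
  have dir: "?D \<bullet> (y - x) = D \<bullet> (y - x)" if "y \<in> X" for y
  proof -
    let ?\<phi> = "\<lambda>a::real. x + a *\<^sub>R (y - x)"
    have sub: "?\<phi> ` {0..1} \<subseteq> X"
    proof (clarify)
      fix a :: real assume "a \<in> {0..1}"
      then have "(1 - a) *\<^sub>R x + a *\<^sub>R y \<in> X"
        using assms that by (intro convexD) auto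
      then show "x + a *\<^sub>R (y - x) \<in> X"
        by (simp add: algebra_simps)
    qed
    have chain: "((\<lambda>a. h (?\<phi> a)) has_vector_derivative (E \<bullet> (y - x))) (at 0 within {0..1})"
      if E: "(h has_derivative (\<lambda>v. E \<bullet> v)) (at x within X)" for E
    proof -
      have "(?\<phi> has_derivative (\<lambda>a. a *\<^sub>R (y - x))) (at 0 within {0..1})"
        by (auto intro!: derivative_eq_intros)
      moreover have "(h has_derivative (\<lambda>v. E \<bullet> v)) (at (?\<phi> 0) within ?\<phi> ` {0..1})"
        using E sub by (auto intro: has_derivative_subset)
      ultimately have "((\<lambda>a. h (?\<phi> a)) has_derivative (\<lambda>a. E \<bullet> (a *\<^sub>R (y - x)))) (at 0 within {0..1})"
        by (rule has_derivative_in_compose)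
      then show ?thesis
        by (simp add: has_vector_derivative_def)
    qed
    show ?thesis
      using vector_derivative_unique_within_closed_interval[of 0 1 0,
          OF _ _ chain[OF D', folded box_real] chain[OF D, folded box_real]]
      by simp
  qed
  obtain y \<epsilon> where y: "\<epsilon> > 0" "ball y \<epsilon> \<subseteq> X"
    using assms(2) by (meson ex_in_conv mem_interior)
  have "(?D - D) \<bullet> v = 0" if v: "norm v < \<epsilon>" for v
  proof -
    have "y \<in> X" "y + v \<in> X"
      using y v by (auto simp: subset_iff dist_norm)
    from dir[OF this(1)] dir[OF this(2)] show ?thesis
      by (simp add: algebra_simps)
  qed
  note small = this
  have "?D - D = 0"
  proof (rule ccontr)
    assume nz: "?D - D \<noteq> 0"
    let ?v = "(\<epsilon> / (2 * norm (?D - D))) *\<^sub>R (?D - D)"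
    have "norm ?v < \<epsilon>"
      using nz y by simp
    from small[OF this] show False
      using nz y by simp
  qed
  then show ?thesis by simp
qed

text \<open>Spectral norm of the matrix with columns \<open>A 0, \<dots>, A (m - 1)\<close>.\<close>

definition spectral_norm :: "nat \<Rightarrow> (nat \<Rightarrow> real ^ 'p) \<Rightarrow> real" where
  "spectral_norm m A = (SUP v\<in>{v. L2_set v {..<m} \<le> 1}. norm (\<Sum>k<m. v k *\<^sub>R A k))"


section \<open>Performance measures\<close>

definition global_loss :: "('n::finite \<Rightarrow> nat \<Rightarrow> real ^ 'p \<Rightarrow> real) \<Rightarrow> nat \<Rightarrow> real ^ 'p \<Rightarrow> real" where
  "global_loss f t x = (\<Sum>j\<in>UNIV. f j t x) / real CARD('n)"

definition feasible_set ::
  "(real ^ 'p) set \<Rightarrow> ('n \<Rightarrow> nat) \<Rightarrow> ('n \<Rightarrow> nat \<Rightarrow> real ^ 'p \<Rightarrow> nat \<Rightarrow> real) \<Rightarrow> nat \<Rightarrow> (real ^ 'p) set"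
where
  "feasible_set X m g T = {x \<in> X. \<forall>t\<in>{1..T}. \<forall>i. \<forall>k<m i. g i t x k \<le> 0}"

definition net_reg ::
  "(real ^ 'p) set \<Rightarrow> ('n::finite \<Rightarrow> nat) \<Rightarrow> ('n \<Rightarrow> nat \<Rightarrow> real ^ 'p \<Rightarrow> real) \<Rightarrow>
   ('n \<Rightarrow> nat \<Rightarrow> real ^ 'p \<Rightarrow> nat \<Rightarrow> real) \<Rightarrow> ('n \<Rightarrow> nat \<Rightarrow> real ^ 'p) \<Rightarrow> nat \<Rightarrow> real"
where
  "net_reg X m f g x T =
     (\<Sum>i\<in>UNIV.
        (\<Sum>t=1..T. gradient X (global_loss f t) (x i t) \<bullet> x i t)
        - (INF y\<in>feasible_set X m g T. (\<Sum>t=1..T. gradient X (global_loss f t) (x i t)) \<bullet> y))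
     / real CARD('n)"

text \<open>The entries of the stacked vector \<open>col (g\<^sub>1\<^sub>,\<^sub>t, \<dots>, g\<^sub>n\<^sub>,\<^sub>t)\<close> are indexed by pairs \<open>(j, k)\<close> with \<open>k < m j\<close>.\<close>

definition net_ccv ::
  "('n::finite \<Rightarrow> nat) \<Rightarrow> ('n \<Rightarrow> nat \<Rightarrow> real ^ 'p \<Rightarrow> nat \<Rightarrow> real) \<Rightarrow>
   ('n \<Rightarrow> nat \<Rightarrow> real ^ 'p) \<Rightarrow> nat \<Rightarrow> real"
where
  "net_ccv m g x T =
     (\<Sum>i\<in>UNIV. \<Sum>t=1..T.
        L2_set (\<lambda>(j, k). max 0 (g j t (x i t) k)) (SIGMA j:UNIV. {..<m j}))
     / real CARD('n)"


section \<open>Communication graphs\<close>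

text \<open>\<open>(j, i) \<in> E t\<close> means that agent \<open>i\<close> receives information from agent \<open>j\<close> in round \<open>t\<close>.\<close>

definition in_neighbours :: "(nat \<Rightarrow> ('n \<times> 'n) set) \<Rightarrow> nat \<Rightarrow> 'n \<Rightarrow> 'n set" where
  "in_neighbours E t i = {j. (j, i) \<in> E t}"

definition strongly_connected :: "('n \<times> 'n) set \<Rightarrow> bool" where
  "strongly_connected A \<longleftrightarrow> (\<forall>i j. (i, j) \<in> A\<^sup>*)"

definition doubly_stochastic :: "real ^ 'n ^ 'n \<Rightarrow> bool" where
  "doubly_stochastic W \<longleftrightarrow>
     (\<forall>i j. 0 \<le> W $ i $ j) \<and> (\<forall>i. (\<Sum>j\<in>UNIV. W $ i $ j) = 1) \<and> (\<forall>j. (\<Sum>i\<in>UNIV. W $ i $ j) = 1)"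


section \<open>Randomness\<close>

text \<open>
  The uniform distribution on the unit sphere as the cone measure: the radial projection of a point
  drawn uniformly from the unit ball.
\<close>

definition uniform_sphere :: "(real ^ 'p) measure" where
  "uniform_sphere = distr (uniform_measure lborel (ball 0 1)) borel sgn"

lemma borel_measurable_sgn_vec [measurable]:
  "(sgn :: real ^ 'p \<Rightarrow> real ^ 'p) \<in> borel_measurable borel"
proof -
  have "(\<lambda>x :: real ^ 'p. x /\<^sub>R norm x) \<in> borel_measurable borel"
    by measurable
  then show ?thesis
    by (simp add: sgn_div_norm[abs_def])
qed

lemma sets_uniform_sphere [simp, measurable_cong]: "sets uniform_sphere = sets borel"
  by (simp add: uniform_sphere_def)

lemma prob_space_uniform_sphere: "prob_space (uniform_sphere :: (real ^ 'p) measure)"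
proof -
  have "prob_space (uniform_measure lborel (ball (0 :: real ^ 'p) 1))"
    by (rule prob_space_uniform_measure)
      (use emeasure_lborel_ball_finite[of "0 :: real ^ 'p" 1]
        content_ball_pos[of 1 "0 :: real ^ 'p"] in
        \<open>auto simp: less_top measure_def\<close>)
  then show ?thesis
    unfolding uniform_sphere_def by (rule prob_space.prob_space_distr) simp
qed

text \<open>
  A compressor on \<open>Y\<close> is a map \<open>Q y \<omega>\<close> whose internal randomness \<open>\<omega>\<close> is drawn afresh from the
  probability space \<open>K\<close> at each call.
\<close>

definition bounded_error_compressor ::
  "(real ^ 'p) set \<Rightarrow> 'c measure \<Rightarrow> (real ^ 'p \<Rightarrow> 'c \<Rightarrow> real ^ 'p) \<Rightarrow> real \<Rightarrow> bool"
where
  "bounded_error_compressor Y K Q C \<longleftrightarrow>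
     prob_space K \<and>
     (\<lambda>(y, \<omega>). Q y \<omega>) \<in> borel_measurable (restrict_space borel Y \<Otimes>\<^sub>M K) \<and>
     (\<forall>y\<in>Y. \<forall>\<omega>\<in>space K. Q y \<omega> \<in> Y) \<and>
     (\<forall>y\<in>Y. integrable K (\<lambda>\<omega>. (norm (Q y \<omega> - y))\<^sup>2) \<and> (\<integral>\<omega>. (norm (Q y \<omega> - y))\<^sup>2 \<partial>K) \<le> C)"

text \<open>
  \<open>u i t\<close> is the perturbation direction of agent \<open>i\<close> in round \<open>t\<close>, and \<open>c i t\<close> is the randomness of
  the compressor call on the data of agent \<open>i\<close> in round \<open>t\<close>. That the pair \<open>(u i t, c i t)\<close> has a
  product law, together with the independence of the pairs, makes all these variables jointly
  independent.
\<close>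

definition algorithm_randomness ::
  "'w measure \<Rightarrow> 'c measure \<Rightarrow> ('n \<Rightarrow> nat \<Rightarrow> 'w \<Rightarrow> real ^ 'p) \<Rightarrow> ('n \<Rightarrow> nat \<Rightarrow> 'w \<Rightarrow> 'c) \<Rightarrow> bool"
where
  "algorithm_randomness M K u c \<longleftrightarrow>
     prob_space M \<and>
     (\<forall>i. \<forall>t\<ge>1. \<forall>\<omega>\<in>space M. u i t \<omega> \<in> sphere 0 1) \<and>
     (\<forall>i. \<forall>t\<ge>1. distr M (borel \<Otimes>\<^sub>M K) (\<lambda>\<omega>. (u i t \<omega>, c i t \<omega>)) = uniform_sphere \<Otimes>\<^sub>M K) \<and>
     prob_space.indep_vars M (\<lambda>_. borel \<Otimes>\<^sub>M K) (\<lambda>(i, t) \<omega>. (u i t \<omega>, c i t \<omega>)) (UNIV \<times> {1..})"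


section \<open>The algorithm\<close>

definition two_point_gradient ::
  "real \<Rightarrow> (real ^ 'p \<Rightarrow> real) \<Rightarrow> real ^ 'p \<Rightarrow> real ^ 'p \<Rightarrow> real ^ 'p" where
  "two_point_gradient d h x u = (real CARD('p) / d * (h (x + d *\<^sub>R u) - h x)) *\<^sub>R u"

text \<open>
  The direction \<open>b\<close>, for a loss \<open>f\<close> and a constraint function \<open>g\<close> with \<open>m\<close> components. The estimate of
  \<open>\<nabla>g\<close> has columns \<open>two_point_gradient d (\<lambda>y. g y k) x u\<close>, and it is applied to the vector
  \<open>\<gamma> [g x]\<^sub>+\<close>.
\<close>

definition bandit_direction ::
  "real \<Rightarrow> real \<Rightarrow> (real ^ 'p \<Rightarrow> real) \<Rightarrow> nat \<Rightarrow> (real ^ 'p \<Rightarrow> nat \<Rightarrow> real) \<Rightarrow>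
   real ^ 'p \<Rightarrow> real ^ 'p \<Rightarrow> real ^ 'p"
where
  "bandit_direction \<gamma> d f m g x u =
     two_point_gradient d f x u
     + (\<Sum>k<m. (\<gamma> * max 0 (g x k)) *\<^sub>R two_point_gradient d (\<lambda>y. g y k) x u)"

text \<open>
  A sample path of the algorithm, for one realisation of the directions \<open>u\<close> and of the
  compressor randomness \<open>c\<close>. Here \<open>zh j t\<close> is the compressed estimate of \<open>z j t\<close> and
  \<open>zs i j t\<close> is the copy stored by agent \<open>i\<close>. Copies \<open>zs i j t\<close> with \<open>j \<noteq> i\<close> not an in-neighbour
  of \<open>i\<close> are left unconstrained; they have weight 0 in \<open>x i t\<close>.
\<close>

definition compressed_bandit_path ::
  "(real ^ 'p) set \<Rightarrow> (real ^ 'p \<Rightarrow> 'c \<Rightarrow> real ^ 'p) \<Rightarrow>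
   (nat \<Rightarrow> ('n::finite \<times> 'n) set) \<Rightarrow> (nat \<Rightarrow> real ^ 'n ^ 'n) \<Rightarrow>
   ('n \<Rightarrow> nat) \<Rightarrow> ('n \<Rightarrow> nat \<Rightarrow> real ^ 'p \<Rightarrow> real) \<Rightarrow> ('n \<Rightarrow> nat \<Rightarrow> real ^ 'p \<Rightarrow> nat \<Rightarrow> real) \<Rightarrow>
   (nat \<Rightarrow> real) \<Rightarrow> (nat \<Rightarrow> real) \<Rightarrow> (nat \<Rightarrow> real) \<Rightarrow> (nat \<Rightarrow> real) \<Rightarrow> (nat \<Rightarrow> real) \<Rightarrow>
   ('n \<Rightarrow> real ^ 'p) \<Rightarrow> ('n \<Rightarrow> nat \<Rightarrow> real ^ 'p) \<Rightarrow> ('n \<Rightarrow> nat \<Rightarrow> 'c) \<Rightarrow>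
   ('n \<Rightarrow> nat \<Rightarrow> real ^ 'p) \<Rightarrow> ('n \<Rightarrow> nat \<Rightarrow> real ^ 'p) \<Rightarrow> ('n \<Rightarrow> 'n \<Rightarrow> nat \<Rightarrow> real ^ 'p) \<Rightarrow>
   ('n \<Rightarrow> nat \<Rightarrow> real ^ 'p) \<Rightarrow> bool"
where
  "compressed_bandit_path X Q E W m f g \<alpha> \<gamma> \<xi> \<delta> s z1 u c z zh zs x \<longleftrightarrow>
     (\<forall>j. zh j 0 = 0) \<and> (\<forall>i j. zs i j 0 = 0) \<and> (\<forall>i. z i 1 = z1 i) \<and>
     (\<forall>t\<ge>1.
        (\<forall>j. zh j t = zh j (t - 1) + s t *\<^sub>R Q ((z j t - zh j (t - 1)) /\<^sub>R s t) (c j t)) \<and>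
        (\<forall>i. \<forall>j \<in> (in_neighbours E t i \<inter> in_neighbours E (t - 1) i) \<union> {i}.
           zs i j t = zs i j (t - 1) + s t *\<^sub>R Q ((z j t - zh j (t - 1)) /\<^sub>R s t) (c j t)) \<and>
        (\<forall>i. \<forall>j \<in> in_neighbours E t i - in_neighbours E (t - 1) i. zs i j t = zh j t) \<and>
        (\<forall>i. x i t = (\<Sum>j\<in>UNIV. W t $ i $ j *\<^sub>R zs i j t)) \<and>
        (\<forall>i. z i (t + 1) =
           closest_point ((*\<^sub>R) (1 - \<xi> (t + 1)) ` X)
             (x i t - \<alpha> t *\<^sub>R bandit_direction (\<gamma> t) (\<delta> t) (f i t) (m i) (g i t) (x i t) (u i t))))"

end

theory Submission
  imports Defs
begin

text \<open>
  Summed over the agents, the squared distance to a scaled comparator \<open>(1 - \<xi> t) *\<^sub>R y\<close> is a potential: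
  doubly stochastic mixing does not increase it, a projected step decreases it by the pairing of the
  estimated direction with \<open>x i t - (1 - \<xi> t) *\<^sub>R y\<close>, and compression adds an error of order \<open>s t\<close>.
  Up to a centred noise, the estimated direction is its mean over the random direction, and by
  convexity the constraint part of this mean contributes \<open>\<gamma> t * (viol i t)\<^sup>2\<close>. This quadratic term absorbs the
  second moment of the estimator, the consensus error (which is driven by step lengths and compression
  errors, by ergodicity of products of the mixing matrices) and the part of the noise martingale that
  grows with the violation. Dividing by \<open>\<alpha> t\<close> and summing by parts yields the regret bound, and the quadratic
  terms left over yield the violation bound by Young's inequality. At a Slater point the constraint
  part also contributes a term linear in the violation, which gives the improved rate without the
  division by \<open>\<alpha> t\<close>.
\<close>

section \<open>The uniform distribution on the sphere\<close>

text \<open>The constraint functions have bounded gradients but no Lipschitz gradients, so the mean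
  of their two-point estimates need not be close to a gradient. Only the pairing of this mean with a
  difference of two points is bounded from below, and for that convexity and the invariance of the
  sphere under reflections suffice. The weight \<open>\<gamma> t\<close> grows without bound while
  \<open>\<gamma> t * \<alpha> t = \<gamma>0\<close>. Hence the constraint part of a step has length
  of order \<open>viol i t\<close> and does not shrink with \<open>\<alpha> t\<close>, and the
  errors it causes have to be charged to the violation itself. The coefficient 1 of the quadratic
  violation term is spent in quarters: one on the second moment of a step, which is what the upper
  bound on \<open>\<gamma>0\<close> is for; one on Young's inequality for the terms linear in the
  violation, among them the consensus error; one on the noise against a comparator that depends on
  the path. The last quarter stays on the left and bounds the weighted squared violations.\<close>

definition reflect :: "real ^ 'p \<Rightarrow> real ^ 'p \<Rightarrow> real ^ 'p" where
  "reflect e u = u - (2 * (e \<bullet> u)) *\<^sub>R e"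

lemma inner_reflect: "norm e = 1 \<Longrightarrow> e \<bullet> reflect e u = - (e \<bullet> u)"
  by (simp add: reflect_def inner_diff_right flip: norm_eq_1)

lemma reflect_reflect [simp]:
  assumes "norm e = 1" shows "reflect e (reflect e u) = u"
  using inner_reflect[OF assms, of u] by (simp add: reflect_def)

lemma norm_reflect [simp]:
  assumes "norm e = 1" shows "norm (reflect e u) = norm u"
proof -
  have "reflect e u \<bullet> reflect e u = u \<bullet> u"
    using assms by (simp add: reflect_def inner_diff_left inner_diff_right inner_commute norm_eq_1)
  then show ?thesis by (simp add: norm_eq_sqrt_inner)
qed

lemma linear_reflect: "linear (reflect e)"
  unfolding reflect_def by (intro linearI) (auto simp: inner_add_right algebra_simps)

lemma borel_measurable_reflect [measurable]: "reflect e \<in> borel_measurable borel"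
  unfolding reflect_def by measurable

lemma sgn_reflect: "norm e = 1 \<Longrightarrow> sgn (reflect e u) = reflect e (sgn u)"
  by (simp add: sgn_div_norm linear_cmul[OF linear_reflect])

text \<open>
  The uniqueness argument for Haar measures, with a ball as test set: translation invariance in both
  variables and a change of the order of integration in
  \<open>\<integral>\<integral> F (reflect e x) * indicator (ball 0 1) y\<close>.
\<close>

lemma distr_lborel_reflect:
  fixes e :: "real ^ 'p::finite"
  assumes e: "norm e = 1"
  shows "distr lborel borel (reflect e) = lborel"
proof (rule measure_eqI)
  fix A assume "A \<in> sets (distr lborel borel (reflect e))"
  then have A [measurable]: "A \<in> sets borel" by simp
  let ?f = "indicator A :: real ^ 'p \<Rightarrow> ennreal" and ?h = "indicator (ball 0 1) :: real ^ 'p \<Rightarrow> ennreal"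
  let ?b = "emeasure lborel (ball (0 :: real ^ 'p) 1)"
  have [measurable]: "ball (0 :: real ^ 'p) 1 \<in> sets borel" by simp
  have shift: "(\<integral>\<^sup>+x. F (c + x) \<partial>lborel) = (\<integral>\<^sup>+x. F x \<partial>lborel)"
    if [measurable]: "F \<in> borel_measurable borel" for F :: "real ^ 'p \<Rightarrow> ennreal" and c
    by (subst lborel_distr_plus[of c, symmetric], subst nn_integral_distr) simp_all
  have add: "reflect e (a + b) = reflect e a + reflect e b" for a b
    by (rule linear_add[OF linear_reflect])
  \<comment> \<open>\<open>reflect e\<close> is an isometric involution, so the condition that
    \<open>y - reflect e x\<close> lies in the unit ball can be read as a condition on
    \<open>x\<close>: it lies in the unit ball around \<open>reflect e y\<close>.\<close>
  have h: "?h (- reflect e x + y) = indicator (ball (reflect e y) 1) x" for x y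
  proof -
    have "norm (y - reflect e x) = norm (reflect e (y - reflect e x))"
      using e by simp
    also have "\<dots> = norm (reflect e y - x)"
      using e by (simp add: linear_diff[OF linear_reflect])
    finally show ?thesis
      by (simp add: indicator_def dist_norm norm_minus_commute add.commute)
  qed
  have ball: "emeasure lborel (ball c 1) = ?b" for c :: "real ^ 'p"
    using shift[OF borel_measurable_indicator[of "ball c 1"], of c]
    by (simp add: indicator_def dist_norm flip: nn_integral_indicator)
  have "(\<integral>\<^sup>+x. ?f (reflect e x) \<partial>lborel) * ?b = (\<integral>\<^sup>+y. \<integral>\<^sup>+x. ?f (reflect e x) * ?h y \<partial>lborel \<partial>lborel)"
    by (simp add: nn_integral_multc nn_integral_cmult_indicator)
  also have "\<dots> = (\<integral>\<^sup>+y. \<integral>\<^sup>+x. ?f (reflect e (reflect e y + x)) * ?h y \<partial>lborel \<partial>lborel)"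
    by (intro nn_integral_cong shift[of "\<lambda>x. ?f (reflect e x) * ?h _", symmetric]) simp
  also have "\<dots> = (\<integral>\<^sup>+y. \<integral>\<^sup>+x. ?f (y + reflect e x) * ?h y \<partial>lborel \<partial>lborel)"
    using e by (simp add: add)
  also have "\<dots> = (\<integral>\<^sup>+x. \<integral>\<^sup>+y. ?f (y + reflect e x) * ?h y \<partial>lborel \<partial>lborel)"
    by (rule lborel_pair.Fubini') measurable
  also have "\<dots> = (\<integral>\<^sup>+x. \<integral>\<^sup>+y. ?f y * ?h (- reflect e x + y) \<partial>lborel \<partial>lborel)"
  proof (rule nn_integral_cong)
    fix x
    have "(\<integral>\<^sup>+y. ?f ((- reflect e x + y) + reflect e x) * ?h (- reflect e x + y) \<partial>lborel)
        = (\<integral>\<^sup>+y. ?f (y + reflect e x) * ?h y \<partial>lborel)"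
      by (rule shift[of "\<lambda>y. ?f (y + reflect e x) * ?h y"]) measurable
    then show "(\<integral>\<^sup>+y. ?f (y + reflect e x) * ?h y \<partial>lborel)
        = (\<integral>\<^sup>+y. ?f y * ?h (- reflect e x + y) \<partial>lborel)"
      by simp
  qed
  also have "\<dots> = (\<integral>\<^sup>+y. \<integral>\<^sup>+x. ?f y * ?h (- reflect e x + y) \<partial>lborel \<partial>lborel)"
    by (rule lborel_pair.Fubini') measurable
  also have "\<dots> = (\<integral>\<^sup>+y. ?f y * (\<integral>\<^sup>+x. indicator (ball (reflect e y) 1) x \<partial>lborel) \<partial>lborel)"
    unfolding h by (intro nn_integral_cong nn_integral_cmult borel_measurable_indicator) simp
  also have "\<dots> = (\<integral>\<^sup>+y. ?f y \<partial>lborel) * ?b"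
  proof -
    have "(\<integral>\<^sup>+x. indicator (ball c 1) x \<partial>lborel) = ?b" for c :: "real ^ 'p"
      using ball[of c] by simp
    then show ?thesis
      by (simp only: nn_integral_multc A borel_measurable_indicator sets_lborel measurable_lborel2)
  qed
  finally have "(\<integral>\<^sup>+x. ?f (reflect e x) \<partial>lborel) * ?b = (\<integral>\<^sup>+y. ?f y \<partial>lborel) * ?b" .
  moreover have "?b \<noteq> 0" "?b < \<infinity>"
    using emeasure_lborel_ball_finite[of "0 :: real ^ 'p" 1] content_ball_pos[of 1 "0 :: real ^ 'p"]
    by (auto simp: measure_def)
  ultimately have "(\<integral>\<^sup>+x. ?f (reflect e x) \<partial>lborel) = (\<integral>\<^sup>+y. ?f y \<partial>lborel)"
    by (auto simp: mult.commute[of _ ?b] ennreal_mult_cancel_left)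
  moreover have "(\<lambda>x. ?f (reflect e x)) = indicator (reflect e -` A)"
    by (auto simp: indicator_def)
  moreover have "reflect e -` A \<in> sets borel"
    using measurable_sets[OF borel_measurable_reflect A] by simp
  ultimately show "emeasure (distr lborel borel (reflect e)) A = emeasure lborel A"
    by (simp add: emeasure_distr)
qed simp

lemma emeasure_lborel_reflect_vimage:
  fixes e :: "real ^ 'p::finite"
  assumes e: "norm e = 1" and A: "A \<in> sets borel"
  shows "emeasure lborel (ball 0 1 \<inter> reflect e -` A) = emeasure lborel (ball 0 1 \<inter> A)"
proof -
  have "emeasure lborel (ball 0 1 \<inter> A) = emeasure (distr lborel borel (reflect e)) (ball 0 1 \<inter> A)"
    by (simp only: distr_lborel_reflect[OF e])
  also have "\<dots> = emeasure lborel (reflect e -` (ball 0 1 \<inter> A))"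
    using A by (simp add: emeasure_distr)
  also have "reflect e -` (ball 0 1 \<inter> A) = ball 0 1 \<inter> reflect e -` A"
    using e by (auto simp: dist_norm norm_minus_commute)
  finally show ?thesis by simp
qed

text \<open>The cone measure inherits the symmetry of the ball, because \<open>sgn\<close> commutes
  with \<open>reflect e\<close>.\<close>

lemma distr_uniform_sphere_reflect:
  assumes e: "norm e = 1"
  shows "distr uniform_sphere borel (reflect e) = uniform_sphere"
proof -
  have "distr (uniform_measure lborel (ball 0 1)) borel (reflect e)
      = uniform_measure lborel (ball 0 1)"
  proof (rule measure_eqI)
    fix A assume "A \<in> sets (distr (uniform_measure lborel (ball 0 1)) borel (reflect e))"
    then have A: "A \<in> sets borel" by simp
    moreover have "reflect e -` A \<in> sets borel"
      using measurable_sets[OF borel_measurable_reflect A] by simp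
    ultimately show "emeasure (distr (uniform_measure lborel (ball 0 1)) borel (reflect e)) A
        = emeasure (uniform_measure lborel (ball 0 1)) A"
      using emeasure_lborel_reflect_vimage[OF e A]
      by (simp add: emeasure_distr emeasure_uniform_measure)
  qed simp
  note inv = this
  have "distr uniform_sphere borel (reflect e)
      = distr (distr (uniform_measure lborel (ball 0 1)) borel (reflect e)) borel sgn"
    using e by (simp add: uniform_sphere_def distr_distr comp_def sgn_reflect)
  then show ?thesis
    by (simp only: inv uniform_sphere_def)
qed

lemma space_uniform_sphere [simp]: "space uniform_sphere = UNIV"
  by (simp add: uniform_sphere_def)

text \<open>Only the centre of the ball is sent off the sphere, since \<open>sgn 0 = 0\<close>, and
  a single point is a null set.\<close>

lemma AE_uniform_sphere: "AE u in (uniform_sphere :: (real ^ 'p::finite) measure). norm u = 1"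
proof -
  have "AE x in lborel :: (real ^ 'p) measure. x \<noteq> 0"
    by (rule AE_lborel_singleton)
  then have "AE x in uniform_measure lborel (ball (0 :: real ^ 'p) 1). x \<noteq> 0"
    by (intro AE_uniform_measureI) auto
  then have "AE x in uniform_measure lborel (ball (0 :: real ^ 'p) 1). norm (sgn x) = 1"
    by eventually_elim (simp add: norm_sgn)
  then show ?thesis
    unfolding uniform_sphere_def by (subst AE_distr_iff) auto
qed

section \<open>Moments of a uniform direction\<close>

interpretation sphere: prob_space "uniform_sphere :: (real ^ 'p::finite) measure"
  by (rule prob_space_uniform_sphere)

lemma integral_uniform_sphere_reflect:
  fixes F :: "real ^ 'p::finite \<Rightarrow> 'b::{banach, second_countable_topology}"
  assumes "norm e = 1" "F \<in> borel_measurable borel"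
  shows "(\<integral>u. F (reflect e u) \<partial>uniform_sphere) = (\<integral>u. F u \<partial>uniform_sphere)"
proof -
  have "(\<integral>u. F u \<partial>uniform_sphere) = (\<integral>u. F u \<partial>distr uniform_sphere borel (reflect e))"
    using assms by (simp add: distr_uniform_sphere_reflect)
  also have "\<dots> = (\<integral>u. F (reflect e u) \<partial>uniform_sphere)"
    using assms by (intro integral_distr) (simp_all add: measurable_cong_sets[OF sets_uniform_sphere refl])
  finally show ?thesis by simp
qed

lemma integrable_uniform_sphere_bounded:
  fixes F :: "real ^ 'p::finite \<Rightarrow> 'b::{banach, second_countable_topology}"
  assumes "F \<in> borel_measurable borel" "\<And>u. norm u = 1 \<Longrightarrow> norm (F u) \<le> B"
  shows "integrable uniform_sphere F"
  using AE_uniform_sphere assms(2)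
  by (intro sphere.integrable_const_bound[where B=B])
    (auto simp: measurable_cong_sets[OF sets_uniform_sphere refl] assms(1) elim!: eventually_mono)

lemma integrable_uniform_sphere_inner2 [simp]:
  "integrable uniform_sphere (\<lambda>u :: real ^ 'p::finite. (a \<bullet> u) * (b \<bullet> u))"
proof (rule integrable_uniform_sphere_bounded)
  fix u :: "real ^ 'p" assume "norm u = 1"
  then have "\<bar>a \<bullet> u\<bar> \<le> norm a" "\<bar>b \<bullet> u\<bar> \<le> norm b"
    using Cauchy_Schwarz_ineq2[of a u] Cauchy_Schwarz_ineq2[of b u] by auto
  then show "norm ((a \<bullet> u) * (b \<bullet> u)) \<le> norm a * norm b"
    by (simp add: abs_mult mult_mono)
qed measurable

text \<open>The reflection along \<open>a\<close> preserves the distribution and flips the sign of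
  \<open>a \<bullet> u\<close>.\<close>

lemma uniform_sphere_mean:
  fixes a :: "real ^ 'p::finite"
  shows "(\<integral>u. a \<bullet> u \<partial>uniform_sphere) = 0"
proof (cases "a = 0")
  case False
  define e where "e = sgn a"
  have e: "norm e = 1" "a = norm a *\<^sub>R e"
    using False by (auto simp: e_def norm_sgn sgn_div_norm)
  have "(\<integral>u. a \<bullet> reflect e u \<partial>uniform_sphere) = (\<integral>u. a \<bullet> u \<partial>uniform_sphere)"
    by (rule integral_uniform_sphere_reflect[OF e(1)]) measurable
  moreover have "a \<bullet> reflect e u = - (a \<bullet> u)" for u
    using inner_reflect[OF e(1), of u] by (subst (1 2) e(2)) simp
  ultimately show ?thesis by simp
qed simp

text \<open>Any two unit vectors are exchanged by a reflection, so the second moment is the same in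
  all directions; over the coordinate directions these moments add up to the mean of
  \<open>(norm u)^2\<close>, which is 1.\<close>

lemma uniform_sphere_second_moment_unit:
  fixes e :: "real ^ 'p::finite"
  assumes "norm e = 1"
  shows "(\<integral>u. (e \<bullet> u)\<^sup>2 \<partial>uniform_sphere) = 1 / real CARD('p)"
proof -
  let ?I = "\<lambda>d :: real ^ 'p. \<integral>u. (d \<bullet> u)\<^sup>2 \<partial>uniform_sphere"
  have eq: "?I d = ?I d'" if "norm d = 1" "norm d' = 1" for d d' :: "real ^ 'p"
  proof (cases "d = d'")
    case False
    \<comment> \<open>The reflection along the difference of two vectors of equal length exchanges
      them.\<close>
    define h where "h = sgn (d - d')"
    have h: "norm h = 1" using False by (simp add: h_def norm_sgn)
    have nz: "(d - d') \<bullet> (d - d') \<noteq> 0"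
      using False by simp
    have dd: "d \<bullet> d = 1" "d' \<bullet> d' = 1" using that by (auto simp: norm_eq_1)
    have "d \<bullet> reflect h u = d' \<bullet> u" for u
    proof -
      have n2: "norm (d - d') * norm (d - d') = (d - d') \<bullet> (d - d')"
        by (simp add: dot_square_norm power2_eq_square)
      have "(2 * (h \<bullet> u)) * (d \<bullet> h) = (2 * ((d - d') \<bullet> u) * (d \<bullet> (d - d'))) / ((d - d') \<bullet> (d - d'))"
        unfolding h_def sgn_div_norm n2[symmetric] inner_scaleR_left inner_scaleR_right
        by (simp add: field_simps)
      also have "\<dots> = (d - d') \<bullet> u"
        using nz dd by (simp add: field_simps inner_diff_left inner_diff_right inner_commute)
      finally show ?thesis
        by (simp add: reflect_def inner_diff_right inner_diff_left)
    qed
    then show ?thesis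
      using integral_uniform_sphere_reflect[OF h, of "\<lambda>u. (d \<bullet> u)\<^sup>2"] by simp
  qed simp
  have "(\<Sum>k\<in>UNIV. ?I (axis k 1)) = (\<integral>u. (\<Sum>k\<in>UNIV. ((axis k 1 :: real ^ 'p) \<bullet> u)\<^sup>2) \<partial>uniform_sphere)"
    using integrable_uniform_sphere_inner2
    by (subst Bochner_Integration.integral_sum) (auto simp: power2_eq_square)
  also have "\<dots> = (\<integral>u. (norm (u :: real ^ 'p))\<^sup>2 \<partial>uniform_sphere)"
    by (simp add: inner_axis' norm_vec_def L2_set_def sum_nonneg)
  also have "\<dots> = (\<integral>u. 1 \<partial>(uniform_sphere :: (real ^ 'p) measure))"
    using AE_uniform_sphere by (intro integral_cong_AE) (auto elim!: eventually_mono)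
  also have "\<dots> = 1"
    using sphere.prob_space by simp
  finally have "(\<Sum>k\<in>UNIV. ?I (axis k 1)) = 1" .
  moreover have "?I (axis k 1) = ?I e" for k
    by (rule eq) (simp_all add: assms)
  ultimately show ?thesis
    by (simp add: field_simps)
qed

text \<open>Scaling reduces the diagonal case to unit vectors; polarisation gives the mixed
  moments.\<close>

lemma uniform_sphere_second_moment:
  fixes a b :: "real ^ 'p::finite"
  shows "(\<integral>u. (a \<bullet> u) * (b \<bullet> u) \<partial>uniform_sphere) = a \<bullet> b / real CARD('p)"
proof -
  have sq: "(\<integral>u. (a \<bullet> u)\<^sup>2 \<partial>uniform_sphere) = a \<bullet> a / real CARD('p)" for a :: "real ^ 'p"
  proof (cases "a = 0")
    case False
    have "(\<integral>u. (a \<bullet> u)\<^sup>2 \<partial>uniform_sphere) = (\<integral>u. (norm a)\<^sup>2 * (sgn a \<bullet> u)\<^sup>2 \<partial>uniform_sphere)"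
    proof -
      have "(a \<bullet> u)\<^sup>2 = (norm a)\<^sup>2 * (sgn a \<bullet> u)\<^sup>2" for u
        using False by (simp add: sgn_div_norm power_mult_distrib power_inverse)
      then show ?thesis by simp
    qed
    also have "\<dots> = (norm a)\<^sup>2 * (1 / real CARD('p))"
      using False by (simp add: uniform_sphere_second_moment_unit norm_sgn)
    finally show ?thesis by (simp add: dot_square_norm)
  qed simp
  have "(\<integral>u. (a \<bullet> u) * (b \<bullet> u) \<partial>uniform_sphere)
      = (\<integral>u. (((a + b) \<bullet> u)\<^sup>2 - (a \<bullet> u)\<^sup>2 - (b \<bullet> u)\<^sup>2) / 2 \<partial>uniform_sphere)"
    by (intro Bochner_Integration.integral_cong refl)
      (simp add: inner_add_left power2_eq_square algebra_simps)
  also have "\<dots> = ((\<integral>u. ((a + b) \<bullet> u)\<^sup>2 \<partial>uniform_sphere) - (\<integral>u. (a \<bullet> u)\<^sup>2 \<partial>uniform_sphere)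
      - (\<integral>u. (b \<bullet> u)\<^sup>2 \<partial>uniform_sphere)) / 2"
  proof -
    have "integrable uniform_sphere (\<lambda>u. (d \<bullet> u)\<^sup>2)" for d :: "real ^ 'p"
      using integrable_uniform_sphere_inner2[of d d] by (simp add: power2_eq_square)
    then show ?thesis by simp
  qed
  also have "\<dots> = ((a + b) \<bullet> (a + b) - a \<bullet> a - b \<bullet> b) / real CARD('p) / 2"
    by (simp add: sq diff_divide_distrib)
  finally show ?thesis
    by (simp add: inner_add_left inner_add_right inner_commute)
qed

section \<open>Gradients and two-point estimates\<close>

lemma gradient_bound_imp_lipschitz:
  assumes "convex X" "h differentiable_on X" "\<And>y. y \<in> X \<Longrightarrow> norm (gradient X h y) \<le> G"
    and "x \<in> X" "y \<in> X"
  shows "\<bar>h x - h y\<bar> \<le> G * norm (x - y)"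
proof -
  have "norm (h x - h y) \<le> G * norm (x - y)"
  proof (rule differentiable_bound[OF \<open>convex X\<close> _ _ \<open>x \<in> X\<close> \<open>y \<in> X\<close>])
    fix z assume z: "z \<in> X"
    show "(h has_derivative (\<lambda>v. gradient X h z \<bullet> v)) (at z within X)"
      using assms(2) z by (intro gradient_has_derivative) (simp add: differentiable_on_def)
    show "onorm (\<lambda>v. gradient X h z \<bullet> v) \<le> G"
    proof (rule onorm_le)
      fix v
      have "\<bar>gradient X h z \<bullet> v\<bar> \<le> norm (gradient X h z) * norm v"
        by (rule Cauchy_Schwarz_ineq2)
      also have "\<dots> \<le> G * norm v"
        using assms(3)[OF z] by (intro mult_right_mono) auto
      finally show "norm (gradient X h z \<bullet> v) \<le> G * norm v" by simp
    qed
  qed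
  then show ?thesis by simp
qed

text \<open>The mean value inequality is applied to \<open>h\<close> minus its linear part at
  \<open>x\<close>, on the segment only, because there the gradient of the difference is at most
  \<open>L * norm (y - x)\<close>. This gives the constant \<open>L\<close> in place of the sharp
  \<open>L / 2\<close>, which is enough for the rates.\<close>

lemma lipschitz_gradient_imp_taylor:
  assumes "convex X" "h differentiable_on X" "0 \<le> L"
    and Lip: "\<And>y z. y \<in> X \<Longrightarrow> z \<in> X \<Longrightarrow> norm (gradient X h y - gradient X h z) \<le> L * norm (y - z)"
    and "x \<in> X" "y \<in> X"
  shows "\<bar>h y - h x - gradient X h x \<bullet> (y - x)\<bar> \<le> L * (norm (y - x))\<^sup>2"
proof -
  let ?\<phi> = "\<lambda>z. h z - gradient X h x \<bullet> z"
  have sub: "closed_segment x y \<subseteq> X"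
    using assms by (simp add: closed_segment_subset)
  have "norm (?\<phi> y - ?\<phi> x) \<le> (L * norm (y - x)) * norm (y - x)"
  proof (rule differentiable_bound[OF convex_closed_segment])
    fix z assume z: "z \<in> closed_segment x y"
    then have zX: "z \<in> X" using sub by auto
    have "(h has_derivative (\<lambda>v. gradient X h z \<bullet> v)) (at z within X)"
      using assms(2) zX by (intro gradient_has_derivative) (simp add: differentiable_on_def)
    then have "(h has_derivative (\<lambda>v. gradient X h z \<bullet> v)) (at z within closed_segment x y)"
      using sub by (rule has_derivative_subset)
    then show "(?\<phi> has_derivative (\<lambda>v. (gradient X h z - gradient X h x) \<bullet> v)) (at z within closed_segment x y)"
      by (auto intro!: derivative_eq_intros simp: inner_diff_left)
    show "onorm (\<lambda>v. (gradient X h z - gradient X h x) \<bullet> v) \<le> L * norm (y - x)"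
    proof (rule onorm_le)
      fix v
      have "\<bar>(gradient X h z - gradient X h x) \<bullet> v\<bar> \<le> norm (gradient X h z - gradient X h x) * norm v"
        by (rule Cauchy_Schwarz_ineq2)
      also have "\<dots> \<le> (L * norm (z - x)) * norm v"
        using Lip zX assms by (intro mult_right_mono) auto
      also have "\<dots> \<le> (L * norm (y - x)) * norm v"
        using segment_bound(1)[OF z] assms(3) by (intro mult_right_mono mult_left_mono) (auto simp: norm_minus_commute)
      finally show "norm ((gradient X h z - gradient X h x) \<bullet> v) \<le> (L * norm (y - x)) * norm v" by simp
    qed
  qed auto
  then show ?thesis
    by (simp add: inner_diff_right power2_eq_square algebra_simps)
qed

text \<open>The real supremum in \<open>spectral_norm\<close> bounds its elements only once the set
  is known to be bounded above; the sum of the column norms is such a bound.\<close>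

lemma norm_sum_le_spectral_norm:
  "norm (\<Sum>k<m. v k *\<^sub>R A k) \<le> spectral_norm m A * L2_set v {..<m}"
proof -
  let ?S = "{v. L2_set v {..<m} \<le> 1}"
  have bdd: "bdd_above ((\<lambda>v. norm (\<Sum>k<m. v k *\<^sub>R A k)) ` ?S)"
  proof (rule bdd_aboveI2)
    fix v assume "v \<in> ?S"
    then have v: "\<bar>v k\<bar> \<le> 1" if "k < m" for k
      using member_le_L2_set[of "{..<m}" k "\<lambda>k. \<bar>v k\<bar>"] that \<open>v \<in> ?S\<close>
      unfolding L2_set_def by (simp del: real_sqrt_le_1_iff)
    have "norm (\<Sum>k<m. v k *\<^sub>R A k) \<le> (\<Sum>k<m. norm (v k *\<^sub>R A k))"
      by (rule norm_sum)
    also have "\<dots> \<le> (\<Sum>k<m. norm (A k))"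
      using v by (intro sum_mono) (simp add: mult_left_le_one_le)
    finally show "norm (\<Sum>k<m. v k *\<^sub>R A k) \<le> (\<Sum>k<m. norm (A k))" .
  qed
  show ?thesis
  proof (cases "L2_set v {..<m} = 0")
    case True
    then have "\<And>k. k < m \<Longrightarrow> v k = 0"
      by (subst (asm) L2_set_eq_0_iff) auto
    then show ?thesis using True by simp
  next
    case False
    define l where "l = L2_set v {..<m}"
    have l: "0 < l"
      using False L2_set_nonneg[of v "{..<m}"] by (simp add: l_def less_le)
    have "L2_set (\<lambda>k. v k / l) {..<m} = 1"
      using l L2_set_left_distrib[of "1 / l" v "{..<m}"] by (simp add: l_def[symmetric])
    then have "norm (\<Sum>k<m. (v k / l) *\<^sub>R A k) \<le> spectral_norm m A"
      unfolding spectral_norm_def by (intro cSUP_upper[OF _ bdd]) simp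
    also have "(\<Sum>k<m. (v k / l) *\<^sub>R A k) = (\<Sum>k<m. v k *\<^sub>R A k) /\<^sub>R l"
      by (simp add: scaleR_sum_right divide_inverse mult.commute)
    finally show ?thesis
      using l by (simp add: l_def[symmetric] field_simps)
  qed
qed

lemma spectral_norm_nonneg: "0 \<le> spectral_norm m A"
proof (cases "m = 0")
  case True
  then show ?thesis by (simp add: spectral_norm_def)
next
  case False
  have "0 \<le> spectral_norm m A * L2_set (\<lambda>k. 1) {..<m}"
    using norm_sum_le_spectral_norm norm_ge_zero by (rule order_trans[rotated])
  moreover have "0 < L2_set (\<lambda>k. 1) {..<m}"
    using False by (simp add: L2_set_def)
  ultimately show ?thesis
    by (simp add: zero_le_mult_iff)
qed

section \<open>Size and mean of two-point estimates\<close>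

lemma norm_two_point_gradient_le:
  fixes x :: "real ^ 'p::finite"
  assumes "0 < d" "norm u = 1" "\<bar>h (x + d *\<^sub>R u) - h x\<bar> \<le> G * d"
  shows "norm (two_point_gradient d h x u) \<le> real CARD('p) * G"
proof -
  have "norm (two_point_gradient d h x u) = real CARD('p) / d * \<bar>h (x + d *\<^sub>R u) - h x\<bar>"
    using assms by (simp add: two_point_gradient_def abs_mult)
  also have "\<dots> \<le> real CARD('p) / d * (G * d)"
    using assms by (intro mult_left_mono) auto
  finally show ?thesis using assms by simp
qed

lemma borel_measurable_two_point_gradient [measurable]:
  fixes x :: "real ^ 'p::finite"
  assumes [measurable]: "h \<in> borel_measurable borel"
  shows "two_point_gradient d h x \<in> borel_measurable borel"
  unfolding two_point_gradient_def by measurable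

text \<open>To first order the estimate is \<open>p * (D \<bullet> u)\<close> times
  \<open>u\<close>, with \<open>p\<close> the dimension, and the second moments of \<open>u\<close>
  make its mean exactly \<open>D\<close>. The Taylor remainder of order \<open>d^2\<close> is
  divided by \<open>d\<close>, which leaves a bias of order \<open>d\<close>.\<close>

lemma two_point_gradient_mean_smooth:
  fixes x :: "real ^ 'p::finite"
  assumes h [measurable]: "h \<in> borel_measurable borel" and d: "0 < d"
    and taylor: "\<And>u. norm u = 1 \<Longrightarrow> \<bar>h (x + d *\<^sub>R u) - h x - d * (D \<bullet> u)\<bar> \<le> L * d\<^sup>2"
  shows "\<bar>(\<integral>u. two_point_gradient d h x u \<bullet> a \<partial>uniform_sphere) - D \<bullet> a\<bar> \<le> real CARD('p) * L * d * norm a"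
proof -
  let ?p = "real CARD('p)"
  let ?F = "\<lambda>u. two_point_gradient d h x u \<bullet> a - ?p * ((D \<bullet> u) * (a \<bullet> u))"
  have bd: "\<bar>?F u\<bar> \<le> ?p * L * d * norm a" if u: "norm u = 1" for u
  proof -
    have "?F u = ?p / d * ((h (x + d *\<^sub>R u) - h x - d * (D \<bullet> u)) * (a \<bullet> u))"
      using d by (simp add: two_point_gradient_def inner_commute field_simps)
    also have "\<bar>\<dots>\<bar> = ?p / d * (\<bar>h (x + d *\<^sub>R u) - h x - d * (D \<bullet> u)\<bar> * \<bar>a \<bullet> u\<bar>)"
      using d by (simp add: abs_mult)
    also have "\<dots> \<le> ?p / d * ((L * d\<^sup>2) * norm a)"
      using d taylor[OF u] Cauchy_Schwarz_ineq2[of a u] u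
      by (intro mult_left_mono mult_mono) (auto intro: order_trans[OF abs_ge_zero])
    also have "\<dots> = ?p * L * d * norm a"
      using d by (simp add: power2_eq_square)
    finally show ?thesis .
  qed
  have intF: "integrable uniform_sphere ?F"
    by (rule integrable_uniform_sphere_bounded[where B = "?p * L * d * norm a"]) (use bd in auto)
  have "(\<integral>u. two_point_gradient d h x u \<bullet> a \<partial>uniform_sphere)
      = (\<integral>u. ?F u + ?p * ((D \<bullet> u) * (a \<bullet> u)) \<partial>uniform_sphere)"
    by simp
  also have "\<dots> = (\<integral>u. ?F u \<partial>uniform_sphere) + ?p * (\<integral>u. (D \<bullet> u) * (a \<bullet> u) \<partial>uniform_sphere)"
    by (subst Bochner_Integration.integral_add[OF intF]) simp_all
  also have "\<dots> = (\<integral>u. ?F u \<partial>uniform_sphere) + D \<bullet> a"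
    by (simp add: uniform_sphere_second_moment)
  finally have "(\<integral>u. two_point_gradient d h x u \<bullet> a \<partial>uniform_sphere) - D \<bullet> a = (\<integral>u. ?F u \<partial>uniform_sphere)"
    by simp
  also have "norm \<dots> \<le> ?p * L * d * norm a"
  proof (rule order_trans[OF integral_norm_bound])
    show "(\<integral>u. norm (?F u) \<partial>uniform_sphere) \<le> ?p * L * d * norm a"
      using AE_uniform_sphere bd
      by (intro sphere.integral_le_const integrable_norm intF) (auto elim!: eventually_mono)
  qed
  finally show ?thesis by simp
qed

text \<open>
  Pairing \<open>u\<close> with its mirror image \<open>reflect e u\<close> in the hyperplane orthogonal to \<open>x - y\<close> turns the
  two-point estimate into difference quotients along \<open>x - y\<close>, which convexity bounds from below.
\<close>

lemma two_point_gradient_mean_convex: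
  fixes x y :: "real ^ 'p::finite"
  assumes h [measurable]: "h \<in> borel_measurable borel" and d: "0 < d"
    and cvx: "convex_on X h"
    and Lip: "\<And>a b. a \<in> X \<Longrightarrow> b \<in> X \<Longrightarrow> \<bar>h a - h b\<bar> \<le> G * norm (a - b)"
    and X: "x \<in> X" "y \<in> X" "\<And>u. norm u = 1 \<Longrightarrow> x + d *\<^sub>R u \<in> X" "\<And>u. norm u = 1 \<Longrightarrow> y + d *\<^sub>R u \<in> X"
  shows "h x - h y - 2 * G * d \<le> (\<integral>u. two_point_gradient d h x u \<bullet> (x - y) \<partial>uniform_sphere)"
proof (cases "x = y")
  case True
  \<comment> \<open>No sign of \<open>G\<close> is assumed; a single query at distance
    \<open>d\<close> shows that \<open>G * d\<close> is nonnegative.\<close>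
  obtain u :: "real ^ 'p" where "norm u = 1" using vector_choose_size[of 1] by auto
  then have "0 \<le> G * d"
    using Lip[OF X(3)[of u] X(1)] d by simp
  then show ?thesis using True by simp
next
  case False
  let ?p = "real CARD('p)"
  define a where "a = x - y"
  define e where "e = sgn a"
  have e: "norm e = 1" "a = norm a *\<^sub>R e" and a: "0 < norm a"
    using False by (auto simp: a_def e_def norm_sgn sgn_div_norm)
  let ?c = "h x - h y - 2 * G * d"
  have key: "2 * d * (e \<bullet> u)\<^sup>2 * ?c \<le> (h (x + d *\<^sub>R u) - h (x + d *\<^sub>R reflect e u)) * (a \<bullet> u)"
    if u: "norm u = 1" "0 \<le> e \<bullet> u" for u
  proof -
    \<comment> \<open>The points \<open>b'\<close>, \<open>b\<close> and
      \<open>x + d *\<^sub>R u\<close> lie in this order on a line of direction \<open>e\<close>,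
      with gaps \<open>norm a\<close> and \<open>t\<close>. Convexity compares the slopes of
      \<open>h\<close> over the two gaps.\<close>
    define t where "t = 2 * d * (e \<bullet> u)"
    have t: "0 \<le> t" using u d by (simp add: t_def)
    define b where "b = x + d *\<^sub>R reflect e u"
    define b' where "b' = y + d *\<^sub>R reflect e u"
    have inX: "b \<in> X" "b' \<in> X" "x + d *\<^sub>R u \<in> X"
      using X(3)[of "reflect e u"] X(4)[of "reflect e u"] X(3)[of u] u e by (auto simp: b_def b'_def)
    have xu: "x + d *\<^sub>R u = b + t *\<^sub>R e"
      by (simp add: b_def t_def reflect_def algebra_simps)
    have b': "b' = b - norm a *\<^sub>R e"
      using e(2) by (simp add: b_def b'_def a_def algebra_simps)
    let ?s = "norm a + t"
    have s: "0 < ?s" using a t by linarith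
    have sum1: "t / ?s + norm a / ?s = 1"
      using s by (simp add: add_divide_distrib[symmetric] add.commute)
    have "b = (t / ?s) *\<^sub>R b' + (norm a / ?s) *\<^sub>R (b + t *\<^sub>R e)"
    proof -
      have "(t / ?s) *\<^sub>R b' + (norm a / ?s) *\<^sub>R (b + t *\<^sub>R e) = (t / ?s + norm a / ?s) *\<^sub>R b"
        by (simp add: b' algebra_simps)
      then show ?thesis
        unfolding sum1 by simp
    qed
    moreover have "1 - norm a / ?s = t / ?s" "0 \<le> norm a / ?s" "norm a / ?s \<le> 1"
    proof -
      have "0 \<le> t / ?s" "0 \<le> norm a / ?s"
        using s t by (simp_all add: divide_nonneg_pos)
      then show "1 - norm a / ?s = t / ?s" "0 \<le> norm a / ?s" "norm a / ?s \<le> 1"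
        using sum1 by linarith+
    qed
    ultimately have "h b \<le> (t / ?s) * h b' + (norm a / ?s) * h (b + t *\<^sub>R e)"
      using convex_onD[OF cvx, of "norm a / ?s" b' "b + t *\<^sub>R e"] inX xu by simp
    then have "h b \<le> (t * h b' + norm a * h (x + d *\<^sub>R u)) / ?s"
      by (simp add: xu add_divide_distrib)
    then have "?s * h b \<le> t * h b' + norm a * h (x + d *\<^sub>R u)"
      using s by (simp only: pos_le_divide_eq mult.commute)
    then have "t * (h b - h b') \<le> norm a * (h (x + d *\<^sub>R u) - h b)"
      by (simp add: algebra_simps)
    \<comment> \<open>Both \<open>b\<close> and \<open>b'\<close> are at distance \<open>d\<close>
      from \<open>x\<close> and \<open>y\<close>, so each exchange costs
      \<open>G * d\<close>.\<close>
    moreover have "?c \<le> h b - h b'"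
    proof -
      have "norm (b - x) = d" "norm (b' - y) = d"
        using u e d by (auto simp: b_def b'_def)
      then show ?thesis
        using Lip[OF inX(1) X(1)] Lip[OF inX(2) X(2)] by simp
    qed
    ultimately have "t * ?c \<le> norm a * (h (x + d *\<^sub>R u) - h b)"
      using mult_left_mono[of ?c "h b - h b'" t] t by linarith
    then have "(e \<bullet> u) * (t * ?c) \<le> (e \<bullet> u) * (norm a * (h (x + d *\<^sub>R u) - h b))"
      using u by (intro mult_left_mono)
    moreover have "a \<bullet> u = norm a * (e \<bullet> u)"
      by (subst e(2)) simp
    ultimately show ?thesis
      by (simp add: t_def b_def power2_eq_square algebra_simps)
  qed
  \<comment> \<open>Passing from \<open>u\<close> to its mirror image changes the sign of both
    factors on the right, so the case of a negative \<open>e \<bullet> u\<close> follows from the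
    other one.\<close>
  have key': "2 * d * (e \<bullet> u)\<^sup>2 * ?c \<le> (h (x + d *\<^sub>R u) - h (x + d *\<^sub>R reflect e u)) * (a \<bullet> u)"
    if u: "norm u = 1" for u
  proof (cases "0 \<le> e \<bullet> u")
    case False
    have "a \<bullet> reflect e u = - (a \<bullet> u)"
      using inner_reflect[OF e(1), of u] by (subst (1 2) e(2)) simp
    then show ?thesis
      using key[of "reflect e u"] u e(1) False by (simp add: inner_reflect algebra_simps)
  qed (rule key[OF u])
  obtain B where B: "\<And>u. norm u = 1 \<Longrightarrow> \<bar>h (x + d *\<^sub>R u)\<bar> \<le> B"
  proof
    fix u :: "real ^ 'p" assume "norm u = 1"
    then show "\<bar>h (x + d *\<^sub>R u)\<bar> \<le> \<bar>h x\<bar> + G * d"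
      using Lip[OF X(3)[of u] X(1)] d by simp
  qed
  have le_a: "\<bar>a \<bullet> u\<bar> \<le> norm a" if "norm u = 1" for u
    using Cauchy_Schwarz_ineq2[of a u] that by simp
  let ?F = "\<lambda>u. h (x + d *\<^sub>R u) * (a \<bullet> u)"
  let ?F' = "\<lambda>u. h (x + d *\<^sub>R reflect e u) * (a \<bullet> u)"
  have B0: "0 \<le> B" if "norm u = 1" for u :: "real ^ 'p"
    using B[OF that] by linarith
  have intF: "integrable uniform_sphere ?F"
    by (rule integrable_uniform_sphere_bounded[where B = "B * norm a"])
      (use B le_a B0 in \<open>auto simp: abs_mult intro!: mult_mono\<close>)
  have intF': "integrable uniform_sphere ?F'"
    by (rule integrable_uniform_sphere_bounded[where B = "B * norm a"])
      (use B le_a B0 e in \<open>auto simp: abs_mult intro!: mult_mono\<close>)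
  \<comment> \<open>By symmetry the integral of \<open>?F\<close> is minus that of
    \<open>?F'\<close>, so twice the integral is that of the paired difference in
    \<open>key'\<close>.\<close>
  have "(\<integral>u. ?F u \<partial>uniform_sphere) = (\<integral>u. ?F (reflect e u) \<partial>uniform_sphere)"
    by (rule integral_uniform_sphere_reflect[symmetric, OF e(1)]) measurable
  also have "\<dots> = (\<integral>u. - ?F' u \<partial>uniform_sphere)"
  proof -
    have "a \<bullet> reflect e u = - (a \<bullet> u)" for u
      using inner_reflect[OF e(1), of u] by (subst (1 2) e(2)) simp
    then show ?thesis by simp
  qed
  finally have "2 * (\<integral>u. ?F u \<partial>uniform_sphere) = (\<integral>u. ?F u - ?F' u \<partial>uniform_sphere)"
    using intF intF' by simp
  also have "\<dots> \<ge> (\<integral>u. 2 * d * ?c * ((e \<bullet> u) * (e \<bullet> u)) \<partial>uniform_sphere)"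
    using AE_uniform_sphere intF intF' key'
    by (intro integral_mono_AE integrable_mult_right Bochner_Integration.integrable_diff)
      (auto elim!: eventually_mono simp: power2_eq_square algebra_simps)
  also have "(\<integral>u. 2 * d * ?c * ((e \<bullet> u) * (e \<bullet> u)) \<partial>uniform_sphere) = 2 * d * ?c / ?p"
    using e(1) by (simp add: uniform_sphere_second_moment norm_eq_1 del: integral_mult_right_zero)
  finally have "?c \<le> ?p / d * (\<integral>u. ?F u \<partial>uniform_sphere)"
    using d by (simp add: field_simps)
  \<comment> \<open>Since \<open>u\<close> has mean zero, the base value \<open>h x\<close> of the
    two-point estimate can be inserted freely.\<close>
  also have "\<dots> = (\<integral>u. ?p / d * (?F u - h x * (a \<bullet> u)) \<partial>uniform_sphere)"
  proof -
    have "integrable uniform_sphere (\<lambda>u. h x * (a \<bullet> u))"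
      by (rule integrable_uniform_sphere_bounded[where B = "\<bar>h x\<bar> * norm a"])
        (use le_a in \<open>auto simp: abs_mult intro!: mult_left_mono\<close>)
    then show ?thesis
      using intF by (simp add: uniform_sphere_mean)
  qed
  also have "\<dots> = (\<integral>u. two_point_gradient d h x u \<bullet> (x - y) \<partial>uniform_sphere)"
    by (intro Bochner_Integration.integral_cong refl)
      (simp add: two_point_gradient_def a_def[symmetric] inner_commute algebra_simps)
  finally show ?thesis .
qed

text \<open>Comparison with the integral of \<open>t powr (q - 1)\<close>, carried out as an
  induction: the mean value theorem bounds each summand by an increment of \<open>t powr q\<close>.
  The first increment is treated separately, as the derivative does not exist at 0.\<close>

lemma sum_powr_le:
  assumes "0 < q" "q < 1"
  shows "(\<Sum>t=1..T. real t powr (q - 1)) \<le> real T powr q / q"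
proof (induction T)
  case (Suc T)
  have "q * real (Suc T) powr (q - 1) \<le> real (Suc T) powr q - real T powr q"
  proof (cases "T = 0")
    case False
    have "\<exists>z>real T. z < real (Suc T) \<and>
        real (Suc T) powr q - real T powr q = (real (Suc T) - real T) * (q * z powr (q - 1))"
      using False
      by (intro MVT2) (auto intro!: derivative_eq_intros simp: powr_diff field_simps)
    then obtain z where z: "real T < z" "z < real (Suc T)"
      "real (Suc T) powr q - real T powr q = q * z powr (q - 1)" by auto
    have "real (Suc T) powr (q - 1) \<le> z powr (q - 1)"
      using z assms False by (intro powr_mono2') auto
    then show ?thesis using z assms by (simp add: mult_left_mono)
  qed (use assms in auto)
  then have "real (Suc T) powr (q - 1) \<le> (real (Suc T) powr q - real T powr q) / q"
    using assms by (simp add: field_simps)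
  then show ?case using Suc by (simp add: diff_divide_distrib)
qed simp

section \<open>Consensus under time-varying mixing\<close>

definition diam :: "('n::finite \<Rightarrow> 'a::real_normed_vector) \<Rightarrow> real" where
  "diam y = Max (range (\<lambda>(i, j). norm (y i - y j)))"

lemma norm_diff_le_diam: "norm (y i - y j) \<le> diam y"
proof -
  have "norm (y i - y j) = (\<lambda>(i, j). norm (y i - y j)) (i, j)" by simp
  then show ?thesis unfolding diam_def by (intro Max_ge) auto
qed

lemma diam_le: "diam y \<le> b" if "\<And>i j. norm (y i - y j) \<le> b"
  unfolding diam_def using that by (intro Max.boundedI) auto

lemma diam_nonneg: "0 \<le> diam y"
  using norm_diff_le_diam[of y undefined undefined] by simp

definition mix :: "real ^ 'n ^ 'n \<Rightarrow> ('n::finite \<Rightarrow> 'a::real_vector) \<Rightarrow> 'n \<Rightarrow> 'a" where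
  "mix W y i = (\<Sum>j\<in>UNIV. W $ i $ j *\<^sub>R y j)"

text \<open>Entries of the matrix product with factors \<open>W (t + k)\<close> down to
  \<open>W (t + 1)\<close>. The state of round \<open>t\<close> has already been mixed by
  \<open>W t\<close>, so the factors start one round later.\<close>

fun mix_product :: "(nat \<Rightarrow> real ^ 'n ^ 'n) \<Rightarrow> nat \<Rightarrow> nat \<Rightarrow> 'n \<Rightarrow> ('n::finite) \<Rightarrow> real" where
  "mix_product W t 0 i j = (if i = j then 1 else 0)"
| "mix_product W t (Suc k) i j = (\<Sum>l\<in>UNIV. W (Suc (t + k)) $ i $ l * mix_product W t k l j)"

context
  fixes W :: "nat \<Rightarrow> real ^ 'n::finite ^ 'n"
  assumes W: "\<And>t. 1 \<le> t \<Longrightarrow> doubly_stochastic (W t)"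
begin

lemma W_nonneg: "1 \<le> t \<Longrightarrow> 0 \<le> W t $ i $ j"
  and W_row: "1 \<le> t \<Longrightarrow> (\<Sum>j\<in>UNIV. W t $ i $ j) = 1"
  and W_col: "1 \<le> t \<Longrightarrow> (\<Sum>i\<in>UNIV. W t $ i $ j) = 1"
  using W by (auto simp: doubly_stochastic_def)

lemma mix_product_nonneg: "0 \<le> mix_product W t k i j"
  by (induction k arbitrary: i) (auto intro!: sum_nonneg mult_nonneg_nonneg W_nonneg)

lemma mix_product_row: "(\<Sum>j\<in>UNIV. mix_product W t k i j) = 1"
proof (induction k arbitrary: i)
  case (Suc k)
  have "(\<Sum>j\<in>UNIV. mix_product W t (Suc k) i j)
      = (\<Sum>l\<in>UNIV. W (Suc (t + k)) $ i $ l * (\<Sum>j\<in>UNIV. mix_product W t k l j))"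
    by (simp add: sum_distrib_left) (rule sum.swap)
  then show ?case by (simp add: Suc W_row)
qed simp

lemma sum_norm_mix_le:
  assumes "1 \<le> t" shows "(\<Sum>i\<in>UNIV. norm (mix (W t) y i)) \<le> (\<Sum>j\<in>UNIV. norm (y j))"
proof -
  have "(\<Sum>i\<in>UNIV. norm (mix (W t) y i)) \<le> (\<Sum>i\<in>UNIV. \<Sum>j\<in>UNIV. W t $ i $ j * norm (y j))"
    using W_nonneg assms unfolding mix_def by (intro sum_mono order_trans[OF norm_sum]) simp
  also have "\<dots> = (\<Sum>j\<in>UNIV. (\<Sum>i\<in>UNIV. W t $ i $ j) * norm (y j))"
    by (subst sum.swap) (simp add: sum_distrib_right)
  finally show ?thesis using assms by (simp add: W_col)
qed

text \<open>Jensen's inequality for the square under the row weights, obtained from Cauchy-Schwarz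
  by splitting each weight into two square roots; summed over \<open>i\<close>, the weights
  disappear by the column sums.\<close>

lemma sum_norm_mix_diff_power2_le:
  fixes y :: "'n \<Rightarrow> 'a::real_inner"
  assumes "1 \<le> t" shows "(\<Sum>i\<in>UNIV. (norm (mix (W t) y i - c))\<^sup>2) \<le> (\<Sum>j\<in>UNIV. (norm (y j - c))\<^sup>2)"
proof -
  have "(norm (mix (W t) y i - c))\<^sup>2 \<le> (\<Sum>j\<in>UNIV. W t $ i $ j * (norm (y j - c))\<^sup>2)" for i
  proof -
    have "mix (W t) y i - c = (\<Sum>j\<in>UNIV. W t $ i $ j *\<^sub>R (y j - c))"
      using W_row[OF assms, of i]
      by (simp add: mix_def scaleR_diff_right sum_subtractf flip: scaleR_sum_left)
    then have "norm (mix (W t) y i - c) \<le> (\<Sum>j\<in>UNIV. W t $ i $ j * norm (y j - c))"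
      using W_nonneg[OF assms] by (auto intro!: order_trans[OF norm_sum])
    then have "(norm (mix (W t) y i - c))\<^sup>2 \<le> (\<Sum>j\<in>UNIV. W t $ i $ j * norm (y j - c))\<^sup>2"
      by (intro power_mono) auto
    also have "\<dots> = (\<Sum>j\<in>UNIV. sqrt (W t $ i $ j) * (sqrt (W t $ i $ j) * norm (y j - c)))\<^sup>2"
      using W_nonneg[OF assms] by (simp add: mult.assoc[symmetric])
    also have "\<dots> \<le> (\<Sum>j\<in>UNIV. (sqrt (W t $ i $ j))\<^sup>2) * (\<Sum>j\<in>UNIV. (sqrt (W t $ i $ j) * norm (y j - c))\<^sup>2)"
      by (rule Cauchy_Schwarz_ineq_sum)
    also have "\<dots> = (\<Sum>j\<in>UNIV. W t $ i $ j * (norm (y j - c))\<^sup>2)"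
      using W_nonneg[OF assms] W_row[OF assms] by (simp add: power_mult_distrib)
    finally show ?thesis .
  qed
  then have "(\<Sum>i\<in>UNIV. (norm (mix (W t) y i - c))\<^sup>2) \<le> (\<Sum>i\<in>UNIV. \<Sum>j\<in>UNIV. W t $ i $ j * (norm (y j - c))\<^sup>2)"
    by (rule sum_mono)
  also have "\<dots> = (\<Sum>j\<in>UNIV. (\<Sum>i\<in>UNIV. W t $ i $ j) * (norm (y j - c))\<^sup>2)"
    by (subst sum.swap) (simp add: sum_distrib_right)
  finally show ?thesis using assms by (simp add: W_col)
qed

text \<open>Doeblin's argument: the mass \<open>\<eta>\<close> common to all entries cancels in the
  difference of two rows, and only the remaining mass \<open>1 - real CARD('n) * \<eta>\<close> can
  see the diameter.\<close>

lemma diam_contraction: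
  fixes P :: "'n \<Rightarrow> 'n \<Rightarrow> real"
  assumes \<eta>: "\<And>i j. \<eta> \<le> P i j" and row: "\<And>i. (\<Sum>j\<in>UNIV. P i j) = (1::real)"
  shows "diam (\<lambda>i. \<Sum>j\<in>UNIV. P i j *\<^sub>R (y j :: 'a::real_normed_vector)) \<le> (1 - real CARD('n) * \<eta>) * diam y"
proof (rule diam_le)
  fix i i'
  define q where "q i j = P i j - \<eta>" for i j
  have q: "0 \<le> q i j" for i j using \<eta> by (simp add: q_def)
  have qs: "(\<Sum>j\<in>UNIV. q i j) = 1 - real CARD('n) * \<eta>" for i
    using row by (simp add: q_def sum_subtractf)
  let ?\<kappa> = "1 - real CARD('n) * \<eta>"
  have \<kappa>: "0 \<le> ?\<kappa>"
    unfolding qs[of i, symmetric] by (intro sum_nonneg q)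
  have diff: "(\<Sum>j\<in>UNIV. P i j *\<^sub>R y j) - (\<Sum>j\<in>UNIV. P i' j *\<^sub>R y j)
      = (\<Sum>j\<in>UNIV. q i j *\<^sub>R y j) - (\<Sum>j\<in>UNIV. q i' j *\<^sub>R y j)"
    by (simp add: q_def scaleR_diff_left sum_subtractf)
  show "norm ((\<Sum>j\<in>UNIV. P i j *\<^sub>R y j) - (\<Sum>j\<in>UNIV. P i' j *\<^sub>R y j)) \<le> ?\<kappa> * diam y"
  \<comment> \<open>The coupling below is scaled by \<open>?\<kappa>\<close> and has to be divided
    by it; for \<open>?\<kappa> = 0\<close> all rows coincide.\<close>
  proof (cases "?\<kappa> = 0")
    case True
    then have "q i j = 0" for i j
      using qs[of i] q sum_nonneg_eq_0_iff[of UNIV "q i"] by auto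
    then show ?thesis
      unfolding diff using \<kappa> diam_nonneg[of y] by simp
  next
    case False
    then have \<kappa>': "0 < ?\<kappa>" using \<kappa> by linarith
    \<comment> \<open>The product of the two remaining rows couples them: the difference of two
      averages becomes an average of differences \<open>y j - y j'\<close>, of total mass
      \<open>?\<kappa> * ?\<kappa>\<close>.\<close>
    have scaled: "?\<kappa> *\<^sub>R ((\<Sum>j\<in>UNIV. q i j *\<^sub>R y j) - (\<Sum>j\<in>UNIV. q i' j *\<^sub>R y j))
        = (\<Sum>j\<in>UNIV. \<Sum>j'\<in>UNIV. (q i j * q i' j') *\<^sub>R (y j - y j'))"
    proof -
      have "(\<Sum>j\<in>UNIV. \<Sum>j'\<in>UNIV. (q i j * q i' j') *\<^sub>R y j) = (\<Sum>j\<in>UNIV. (\<Sum>j'\<in>UNIV. q i' j') *\<^sub>R q i j *\<^sub>R y j)"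
        by (simp add: mult.commute flip: scaleR_sum_left sum_distrib_left sum_distrib_right)
      moreover have "(\<Sum>j\<in>UNIV. \<Sum>j'\<in>UNIV. (q i j * q i' j') *\<^sub>R y j') = (\<Sum>j'\<in>UNIV. (\<Sum>j\<in>UNIV. q i j) *\<^sub>R q i' j' *\<^sub>R y j')"
        by (subst sum.swap) (simp flip: scaleR_sum_left sum_distrib_left sum_distrib_right)
      ultimately show ?thesis
        by (simp add: scaleR_diff_right sum_subtractf qs scaleR_sum_right)
    qed
    have "?\<kappa> * norm ((\<Sum>j\<in>UNIV. q i j *\<^sub>R y j) - (\<Sum>j\<in>UNIV. q i' j *\<^sub>R y j))
        = norm (\<Sum>j\<in>UNIV. \<Sum>j'\<in>UNIV. (q i j * q i' j') *\<^sub>R (y j - y j'))"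
      using arg_cong[OF scaled, of norm] by (simp only: norm_scaleR abs_of_nonneg[OF \<kappa>])
    also have "\<dots> \<le> (\<Sum>j\<in>UNIV. \<Sum>j'\<in>UNIV. (q i j * q i' j') * diam y)"
    proof (rule order_trans[OF norm_sum], rule sum_mono, rule order_trans[OF norm_sum], rule sum_mono)
      fix j j'
      have "(q i j * q i' j') * norm (y j - y j') \<le> (q i j * q i' j') * diam y"
        using q by (intro mult_left_mono norm_diff_le_diam mult_nonneg_nonneg)
      then show "norm ((q i j * q i' j') *\<^sub>R (y j - y j')) \<le> (q i j * q i' j') * diam y"
        using q by simp
    qed
    also have "\<dots> = (?\<kappa> * ?\<kappa>) * diam y"
      by (simp only: sum_distrib_right[symmetric] sum_distrib_left[symmetric] qs)
    finally show ?thesis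
      unfolding diff using \<kappa>' by (simp only: mult.assoc mult_le_cancel_left_pos)
  qed
qed

text \<open>The deviation from the unperturbed product starts at zero and follows the same recursion
  as \<open>y\<close>. Since columns sum to 1, mixing does not increase the sum of the norms, so the
  perturbations merely accumulate.\<close>

lemma perturbed_mix:
  fixes y :: "nat \<Rightarrow> 'n \<Rightarrow> 'a::real_normed_vector"
  assumes step: "\<And>k i. t \<le> k \<Longrightarrow> y (Suc k) i = mix (W (Suc k)) (\<lambda>j. y k j + q k j) i"
  shows "(\<Sum>i\<in>UNIV. norm (y (t + k) i - (\<Sum>j\<in>UNIV. mix_product W t k i j *\<^sub>R y t j)))
      \<le> (\<Sum>s\<in>{t..<t + k}. \<Sum>j\<in>UNIV. norm (q s j))"
proof (induction k)
  case 0
  have "(\<Sum>j\<in>UNIV. (if i = j then 1 else 0) *\<^sub>R y t j) = y t i" for i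
    by (subst sum.cong[OF refl, of _ _ "\<lambda>j. if i = j then y t j else 0"]) auto
  then show ?case by simp
next
  case (Suc k)
  let ?r = "\<lambda>k i. y (t + k) i - (\<Sum>j\<in>UNIV. mix_product W t k i j *\<^sub>R y t j)"
  have "?r (Suc k) i = mix (W (Suc (t + k))) (\<lambda>j. ?r k j + q (t + k) j) i" for i
  proof -
    have "(\<Sum>j\<in>UNIV. mix_product W t (Suc k) i j *\<^sub>R y t j)
        = (\<Sum>l\<in>UNIV. W (Suc (t + k)) $ i $ l *\<^sub>R (\<Sum>j\<in>UNIV. mix_product W t k l j *\<^sub>R y t j))"
      by (simp add: scaleR_sum_left scaleR_sum_right) (rule sum.swap)
    then show ?thesis
      using step[of "t + k" i]
      by (simp add: mix_def scaleR_diff_right scaleR_add_right sum_subtractf sum.distrib del: mix_product.simps)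
  qed
  then have "(\<Sum>i\<in>UNIV. norm (?r (Suc k) i)) \<le> (\<Sum>j\<in>UNIV. norm (?r k j + q (t + k) j))"
    by (simp add: sum_norm_mix_le del: mix_product.simps)
  also have "\<dots> \<le> (\<Sum>j\<in>UNIV. norm (?r k j)) + (\<Sum>j\<in>UNIV. norm (q (t + k) j))"
    unfolding sum.distrib[symmetric] by (intro sum_mono norm_triangle_ineq)
  finally show ?case using Suc by simp
qed

lemma diam_perturbed_mix:
  fixes y :: "nat \<Rightarrow> 'n \<Rightarrow> 'a::real_normed_vector"
  assumes step: "\<And>k i. t \<le> k \<Longrightarrow> y (Suc k) i = mix (W (Suc k)) (\<lambda>j. y k j + q k j) i"
    and \<eta>: "\<And>i j. \<eta> \<le> mix_product W t \<tau> i j"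
  shows "diam (y (t + \<tau>)) \<le> (1 - real CARD('n) * \<eta>) * diam (y t)
      + 2 * (\<Sum>s\<in>{t..<t + \<tau>}. \<Sum>j\<in>UNIV. norm (q s j))"
proof (rule diam_le)
  fix i i'
  let ?v = "\<lambda>i. \<Sum>j\<in>UNIV. mix_product W t \<tau> i j *\<^sub>R y t j"
  let ?S = "\<Sum>s\<in>{t..<t + \<tau>}. \<Sum>j\<in>UNIV. norm (q s j)"
  have r: "norm (y (t + \<tau>) i - ?v i) \<le> ?S" for i
    using perturbed_mix[where y=y and q=q and t=t and k=\<tau>, OF step]
      member_le_sum[of i UNIV "\<lambda>i. norm (y (t + \<tau>) i - ?v i)"] by simp
  have "norm (?v i - ?v i') \<le> (1 - real CARD('n) * \<eta>) * diam (y t)"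
    using diam_contraction[where P="mix_product W t \<tau>" and y="y t", OF \<eta> mix_product_row]
      norm_diff_le_diam[of ?v i i'] by linarith
  moreover have "norm (y (t + \<tau>) i - y (t + \<tau>) i')
      \<le> norm (y (t + \<tau>) i - ?v i) + norm (?v i - ?v i') + norm (y (t + \<tau>) i' - ?v i')"
    using norm_triangle_ineq[of "y (t + \<tau>) i - ?v i" "?v i - ?v i'"]
      norm_triangle_ineq4[of "y (t + \<tau>) i - ?v i'" "y (t + \<tau>) i' - ?v i'"] by simp
  ultimately show "norm (y (t + \<tau>) i - y (t + \<tau>) i') \<le> (1 - real CARD('n) * \<eta>) * diam (y t) + 2 * ?S"
    using r[of i] r[of i'] by linarith
qed

section \<open>Positive products under joint strong connectivity\<close>

context
  fixes w :: real and E :: "nat \<Rightarrow> ('n \<times> 'n) set" and B :: nat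
  assumes w: "0 < w" "w < 1"
    and weights: "\<And>t i j. 1 \<le> t \<Longrightarrow> (j, i) \<in> E t \<or> i = j \<Longrightarrow> w \<le> W t $ i $ j"
    and B: "0 < B" "\<And>t. 1 \<le> t \<Longrightarrow> strongly_connected (\<Union>l\<in>{0..B - 1}. E (t + l))"
begin

lemma mix_product_step:
  assumes "w ^ k \<le> mix_product W t k l j" "(l, i) \<in> E (Suc (t + k)) \<or> i = l"
  shows "w ^ Suc k \<le> mix_product W t (Suc k) i j"
proof -
  have "w * w ^ k \<le> W (Suc (t + k)) $ i $ l * mix_product W t k l j"
    using assms w by (intro mult_mono weights) (auto intro: order_trans[OF less_imp_le[OF w(1)] weights])
  also have "\<dots> \<le> mix_product W t (Suc k) i j"
    unfolding mix_product.simps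
    by (intro member_le_sum) (auto intro!: mult_nonneg_nonneg W_nonneg mix_product_nonneg)
  finally show ?thesis by simp
qed

text \<open>The agents on which agent \<open>j\<close> has influence after \<open>k\<close> rounds.
  The threshold is tied to the number of factors: each further factor contributes a weight of at
  least \<open>w\<close>, so self-weights keep an agent in the set.\<close>

definition reached :: "nat \<Rightarrow> 'n \<Rightarrow> nat \<Rightarrow> 'n set" where
  "reached t j k = {i. w ^ k \<le> mix_product W t k i j}"

lemma reached_mono: "k \<le> k' \<Longrightarrow> reached t j k \<subseteq> reached t j k'"
  by (induction k' rule: dec_induct) (auto simp: reached_def intro: mix_product_step simp del: mix_product.simps power_Suc)

text \<open>As long as the set is not everything, strong connectivity of the union over a window of
  \<open>B\<close> rounds gives an edge that leaves it, so each window adds at least one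
  agent.\<close>

lemma card_reached: "min CARD('n) (Suc b) \<le> card (reached t j (b * B))"
proof (induction b)
  case 0
  have "j \<in> reached t j 0" by (simp add: reached_def)
  then have "0 < card (reached t j 0)" by (auto simp: card_gt_0_iff)
  then show ?case by simp
next
  case (Suc b)
  show ?case
  proof (cases "reached t j (b * B) = UNIV")
    case True
    then have "reached t j (Suc b * B) = UNIV"
      using reached_mono[of "b * B" "Suc b * B" t j] by auto
    then show ?thesis by simp
  next
    case False
    \<comment> \<open>The window starts one round later than the set, because the next factor to be
      multiplied belongs to round \<open>Suc (t + b * B)\<close>.\<close>
    let ?R = "reached t j (b * B)" and ?A = "\<Union>l\<in>{0..B - 1}. E (Suc (t + b * B) + l)"
    have jR: "j \<in> ?R"
      using reached_mono[of 0 "b * B" t j] by (auto simp: reached_def)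
    obtain i0 where i0: "i0 \<notin> ?R" using False by auto
    have "(j, i0) \<in> ?A\<^sup>*"
      using B(2)[of "Suc (t + b * B)"] by (auto simp: strongly_connected_def)
    then have "i0 \<in> ?R" if "?A `` ?R \<subseteq> ?R"
      using that jR by (induction rule: rtrancl_induct) auto
    then obtain a i where ai: "a \<in> ?R" "(a, i) \<in> ?A" "i \<notin> ?R"
      using i0 by blast
    then obtain l where l: "l \<le> B - 1" "(a, i) \<in> E (Suc (t + b * B) + l)" by auto
    \<comment> \<open>The edge may appear only \<open>l\<close> rounds into the window; until then
      the self-weights hold its source \<open>a\<close> in the set.\<close>
    have "a \<in> reached t j (b * B + l)"
      using ai(1) reached_mono[of "b * B" "b * B + l" t j] by auto
    then have "i \<in> reached t j (Suc (b * B + l))"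
      using l(2) mix_product_step[of "b * B + l" t a j i]
      by (auto simp: reached_def add.assoc simp del: mix_product.simps power_Suc)
    moreover have "Suc (b * B + l) \<le> Suc b * B"
      using l(1) B(1) by simp
    ultimately have "i \<in> reached t j (Suc b * B)"
      using reached_mono by blast
    then have "insert i ?R \<subseteq> reached t j (Suc b * B)"
      using reached_mono[of "b * B" "Suc b * B" t j] by auto
    then have "card (insert i ?R) \<le> card (reached t j (Suc b * B))"
      by (intro card_mono) auto
    then show ?thesis using Suc ai(3) by simp
  qed
qed

lemma mix_product_lower_bound: "w ^ (CARD('n) * B) \<le> mix_product W t (CARD('n) * B) i j"
proof -
  have "CARD('n) \<le> card (reached t j (CARD('n) * B))"
    using card_reached[of "CARD('n)" t j] by simp
  then have "reached t j (CARD('n) * B) = UNIV"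
    by (metis card_mono card_subset_eq finite le_antisym subset_UNIV)
  then show ?thesis by (auto simp: reached_def)
qed

text \<open>The contraction over \<open>\<tau>\<close> rounds is summed over all starting times and
  the contracted sum is moved to the left, which replaces a convolution with geometric weights. Each
  perturbation falls into at most \<open>\<tau>\<close> windows, whence the factor
  \<open>real \<tau>\<close>.\<close>

lemma sum_diam_perturbed_mix:
  fixes y :: "nat \<Rightarrow> 'n \<Rightarrow> 'a::real_normed_vector"
  assumes step: "\<And>k i. 1 \<le> k \<Longrightarrow> y (Suc k) i = mix (W (Suc k)) (\<lambda>j. y k j + q k j) i"
    and D: "\<And>t. 1 \<le> t \<Longrightarrow> diam (y t) \<le> D"
  defines "\<tau> \<equiv> CARD('n) * B"
  shows "real CARD('n) * w ^ \<tau> * (\<Sum>t=1..T. diam (y t)) \<le> real \<tau> * D + 2 * real \<tau> * (\<Sum>t=1..T. \<Sum>j\<in>UNIV. norm (q t j))"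
proof -
  let ?Q = "\<lambda>s. \<Sum>j\<in>UNIV. norm (q s j)" and ?\<rho> = "1 - real CARD('n) * w ^ \<tau>"
  have Q: "0 \<le> ?Q s" for s by (intro sum_nonneg) simp
  have D0: "0 \<le> D" using D[of 1] diam_nonneg[of "y 1"] by simp
  \<comment> \<open>Every row of the product has sum 1 and entries of at least
    \<open>w ^ \<tau>\<close>.\<close>
  have \<rho>: "0 \<le> ?\<rho>"
  proof -
    have "(\<Sum>j\<in>(UNIV :: 'n set). w ^ \<tau>) \<le> (\<Sum>j\<in>UNIV. mix_product W 1 \<tau> i j)" for i
      unfolding \<tau>_def by (intro sum_mono mix_product_lower_bound)
    then show ?thesis by (simp add: mix_product_row)
  qed
  have contr: "diam (y (t + \<tau>)) \<le> ?\<rho> * diam (y t) + 2 * (\<Sum>s\<in>{t..<t + \<tau>}. ?Q s)" if "1 \<le> t" for t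
    using that mix_product_lower_bound
    by (intro diam_perturbed_mix step) (auto simp: \<tau>_def)
  \<comment> \<open>The first \<open>\<tau>\<close> rounds are kept in full even if
    \<open>T < \<tau>\<close>, which only enlarges the right-hand side.\<close>
  have s1: "(\<Sum>t=1..T. diam (y t)) \<le> (\<Sum>t=1..\<tau>. diam (y t)) + (\<Sum>t\<in>{1..T} \<inter> {t. t + \<tau> \<le> T}. diam (y (t + \<tau>)))"
  proof -
    have eq: "(\<Sum>t\<in>{1..T} \<inter> {t. t + \<tau> \<le> T}. diam (y (t + \<tau>))) = (\<Sum>t\<in>{1..T} \<inter> {t. \<tau> < t}. diam (y t))"
      by (rule sum.reindex_bij_witness[of _ "\<lambda>t. t - \<tau>" "\<lambda>t. t + \<tau>"]) auto
    have "(\<Sum>t=1..T. diam (y t)) \<le> (\<Sum>t\<in>{1..\<tau>} \<union> ({1..T} \<inter> {t. \<tau> < t}). diam (y t))"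
      by (rule sum_mono2) (auto simp: diam_nonneg)
    also have "\<dots> = (\<Sum>t=1..\<tau>. diam (y t)) + (\<Sum>t\<in>{1..T} \<inter> {t. \<tau> < t}. diam (y t))"
      by (rule sum.union_disjoint) auto
    finally show ?thesis unfolding eq .
  qed
  have s2: "(\<Sum>t=1..\<tau>. diam (y t)) \<le> real \<tau> * D"
    using sum_mono[of "{1..\<tau>}" "\<lambda>t. diam (y t)" "\<lambda>_. D"] D by simp
  have "(\<Sum>t\<in>{1..T} \<inter> {t. t + \<tau> \<le> T}. diam (y (t + \<tau>)))
      \<le> (\<Sum>t\<in>{1..T} \<inter> {t. t + \<tau> \<le> T}. ?\<rho> * diam (y t) + 2 * (\<Sum>s\<in>{t..<t + \<tau>}. ?Q s))"
    using contr by (intro sum_mono) auto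
  also have "\<dots> = ?\<rho> * (\<Sum>t\<in>{1..T} \<inter> {t. t + \<tau> \<le> T}. diam (y t))
      + 2 * (\<Sum>t\<in>{1..T} \<inter> {t. t + \<tau> \<le> T}. \<Sum>s\<in>{t..<t + \<tau>}. ?Q s)"
    by (simp only: sum.distrib sum_distrib_left)
  finally have s3: "(\<Sum>t\<in>{1..T} \<inter> {t. t + \<tau> \<le> T}. diam (y (t + \<tau>)))
      \<le> ?\<rho> * (\<Sum>t\<in>{1..T} \<inter> {t. t + \<tau> \<le> T}. diam (y t))
        + 2 * (\<Sum>t\<in>{1..T} \<inter> {t. t + \<tau> \<le> T}. \<Sum>s\<in>{t..<t + \<tau>}. ?Q s)" .
  have s4: "?\<rho> * (\<Sum>t\<in>{1..T} \<inter> {t. t + \<tau> \<le> T}. diam (y t)) \<le> ?\<rho> * (\<Sum>t=1..T. diam (y t))"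
    by (intro mult_left_mono \<rho> sum_mono2) (auto simp: diam_nonneg)
  have s5: "(\<Sum>t\<in>{1..T} \<inter> {t. t + \<tau> \<le> T}. \<Sum>s\<in>{t..<t + \<tau>}. ?Q s) \<le> real \<tau> * (\<Sum>t=1..T. ?Q t)"
  proof -
    have "(\<Sum>t\<in>{1..T} \<inter> {t. t + \<tau> \<le> T}. \<Sum>s\<in>{t..<t + \<tau>}. ?Q s)
        = (\<Sum>t\<in>{1..T} \<inter> {t. t + \<tau> \<le> T}. \<Sum>l<\<tau>. ?Q (t + l))"
    proof (rule sum.cong[OF refl])
      fix t
      show "(\<Sum>s\<in>{t..<t + \<tau>}. ?Q s) = (\<Sum>l<\<tau>. ?Q (t + l))"
        by (rule sum.reindex_bij_witness[of _ "\<lambda>l. t + l" "\<lambda>s. s - t"]) auto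
    qed
    also have "\<dots> = (\<Sum>l<\<tau>. \<Sum>t\<in>{1..T} \<inter> {t. t + \<tau> \<le> T}. ?Q (t + l))"
      by (rule sum.swap)
    also have "\<dots> \<le> (\<Sum>l<\<tau>. \<Sum>t=1..T. ?Q t)"
    proof (rule sum_mono)
      fix l assume l: "l \<in> {..<\<tau>}"
      have "(\<Sum>t\<in>{1..T} \<inter> {t. t + \<tau> \<le> T}. ?Q (t + l)) = (\<Sum>t\<in>(\<lambda>t. t + l) ` ({1..T} \<inter> {t. t + \<tau> \<le> T}). ?Q t)"
        by (subst sum.reindex) (auto simp: inj_on_def)
      also have "\<dots> \<le> (\<Sum>t=1..T. ?Q t)"
        using l Q by (intro sum_mono2) auto
      finally show "(\<Sum>t\<in>{1..T} \<inter> {t. t + \<tau> \<le> T}. ?Q (t + l)) \<le> (\<Sum>t=1..T. ?Q t)" .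
    qed
    finally show ?thesis by simp
  qed
  have "(\<Sum>t=1..T. diam (y t)) \<le> real \<tau> * D + ?\<rho> * (\<Sum>t=1..T. diam (y t)) + 2 * (real \<tau> * (\<Sum>t=1..T. ?Q t))"
    using s1 s2 s3 s4 s5 by linarith
  then show ?thesis
    by (simp add: algebra_simps)
qed

end

end

section \<open>Independence of the random inputs\<close>

lemma Int_stable_vimages: "Int_stable {X -` A \<inter> \<Omega> | A. A \<in> sets N}"
proof (rule Int_stableI, clarify)
  fix A B assume "A \<in> sets N" "B \<in> sets N"
  then show "\<exists>C. X -` A \<inter> \<Omega> \<inter> (X -` B \<inter> \<Omega>) = X -` C \<inter> \<Omega> \<and> C \<in> sets N"
    by (intro exI[of _ "A \<inter> B"]) auto
qed

text \<open>Independence between the pairs and a product rule inside each pair give independence of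
  all components: events are grouped by \<open>k\<close>, the groups factor by the first property
  and each group by the second.\<close>

lemma (in prob_space) indep_sets_split_pairs:
  fixes X :: "'i \<Rightarrow> 'a \<Rightarrow> 'b" and Y :: "'i \<Rightarrow> 'a \<Rightarrow> 'c"
    and N :: "'b measure" and N' :: "'c measure"
  defines "F \<equiv> \<lambda>(k, b). if b then {X k -` A \<inter> space M | A. A \<in> sets N} else {Y k -` A \<inter> space M | A. A \<in> sets N'}"
  assumes indep: "indep_vars (\<lambda>_. N \<Otimes>\<^sub>M N') (\<lambda>k \<omega>. (X k \<omega>, Y k \<omega>)) I"
    and pair: "\<And>k A B. k \<in> I \<Longrightarrow> A \<in> sets N \<Longrightarrow> B \<in> sets N' \<Longrightarrow>
      prob ((X k -` A \<inter> space M) \<inter> (Y k -` B \<inter> space M)) = prob (X k -` A \<inter> space M) * prob (Y k -` B \<inter> space M)"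
  shows "indep_sets F (I \<times> UNIV)"
proof -
  have rv: "(\<lambda>\<omega>. (X k \<omega>, Y k \<omega>)) \<in> M \<rightarrow>\<^sub>M N \<Otimes>\<^sub>M N'" if "k \<in> I" for k
    using indep that by (auto simp: indep_vars_def2)
  have X [measurable]: "X k \<in> M \<rightarrow>\<^sub>M N" and Y [measurable]: "Y k \<in> M \<rightarrow>\<^sub>M N'" if "k \<in> I" for k
    using measurable_comp[OF rv[OF that] measurable_fst] measurable_comp[OF rv[OF that] measurable_snd]
    by (auto simp: comp_def)
  have F_sub: "A \<subseteq> space M" "A \<in> events" if "A \<in> F kb" "kb \<in> I \<times> UNIV" for A kb
    using that X Y by (auto simp: F_def split: prod.splits if_splits intro: measurable_sets)
  show ?thesis
  proof (rule indep_setsI)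
    show "F kb \<subseteq> events" if "kb \<in> I \<times> UNIV" for kb
      using F_sub that by auto
  next
    fix A J assume J: "J \<noteq> {}" "J \<subseteq> I \<times> UNIV" "finite J" and A: "\<forall>j\<in>J. A j \<in> F j"
    \<comment> \<open>A group in which only one component occurs is completed by the sure event, so
      that every group is a rectangle.\<close>
    define A' where "A' k b = (if (k, b) \<in> J then A (k, b) else space M)" for k b
    define J' where "J' = fst ` J"
    have J': "J' \<noteq> {}" "J' \<subseteq> I" "finite J'" using J by (auto simp: J'_def)
    have space_F: "space M \<in> F (k, b)" if "k \<in> I" for k b
    proof -
      have "X k -` space N \<inter> space M = space M" "Y k -` space N' \<inter> space M = space M"
        using measurable_space[OF X[OF that]] measurable_space[OF Y[OF that]] by auto
      then show ?thesis
        unfolding F_def by (auto split: prod.splits)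
    qed
    have A'_F: "A' k b \<in> F (k, b)" if "k \<in> J'" for k b
      using A space_F J' that by (auto simp: A'_def)
    have A'_mult: "prob (A' k True \<inter> A' k False) = prob (A' k True) * prob (A' k False)"
      and A'_pair: "A' k True \<inter> A' k False \<in> {(\<lambda>\<omega>. (X k \<omega>, Y k \<omega>)) -` S \<inter> space M |S. S \<in> sets (N \<Otimes>\<^sub>M N')}"
      if k: "k \<in> J'" for k
    proof -
      obtain S where S: "S \<in> sets N" "A' k True = X k -` S \<inter> space M"
        using A'_F[OF k, of True] by (auto simp: F_def)
      obtain S' where S': "S' \<in> sets N'" "A' k False = Y k -` S' \<inter> space M"
        using A'_F[OF k, of False] by (auto simp: F_def)
      show "prob (A' k True \<inter> A' k False) = prob (A' k True) * prob (A' k False)"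
        using pair[of k S S'] S S' k J' by auto
      have "A' k True \<inter> A' k False = (\<lambda>\<omega>. (X k \<omega>, Y k \<omega>)) -` (S \<times> S') \<inter> space M"
        using S S' by auto
      then show "A' k True \<inter> A' k False \<in> {(\<lambda>\<omega>. (X k \<omega>, Y k \<omega>)) -` S \<inter> space M |S. S \<in> sets (N \<Otimes>\<^sub>M N')}"
        using S S' by blast
    qed
    have "(\<Inter>j\<in>J. A j) = (\<Inter>k\<in>J'. A' k True \<inter> A' k False)"
    proof (intro equalityI subsetI)
      fix \<omega> assume "\<omega> \<in> (\<Inter>j\<in>J. A j)"
      moreover then have "\<omega> \<in> space M" using J A F_sub by blast
      ultimately show "\<omega> \<in> (\<Inter>k\<in>J'. A' k True \<inter> A' k False)" by (auto simp: A'_def)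
    next
      fix \<omega> assume \<omega>: "\<omega> \<in> (\<Inter>k\<in>J'. A' k True \<inter> A' k False)"
      show "\<omega> \<in> (\<Inter>j\<in>J. A j)"
      proof
        fix j assume j: "j \<in> J"
        obtain k b where kb: "j = (k, b)" by (cases j)
        then have "\<omega> \<in> A' k b" using \<omega> j by (cases b) (force simp: J'_def)+
        then show "\<omega> \<in> A j" using j kb by (simp add: A'_def)
      qed
    qed
    also have "prob \<dots> = (\<Prod>k\<in>J'. prob (A' k True \<inter> A' k False))"
      using indep J' A'_pair unfolding indep_vars_def2 by (intro indep_setsD[where F="\<lambda>k. {(\<lambda>\<omega>. (X k \<omega>, Y k \<omega>)) -` S \<inter> space M |S. S \<in> sets (N \<Otimes>\<^sub>M N')}" and I=I]) auto
    also have "\<dots> = (\<Prod>k\<in>J'. \<Prod>b\<in>UNIV. prob (A' k b))"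
      using A'_mult by (simp add: UNIV_bool mult.commute)
    also have "\<dots> = (\<Prod>(k, b)\<in>J' \<times> UNIV. prob (A' k b))"
      by (simp add: prod.cartesian_product)
    also have "\<dots> = (\<Prod>j\<in>J. prob (A j))"
      using J' J by (intro prod.mono_neutral_cong_right) (auto simp: A'_def J'_def prob_space intro: rev_image_eqI)
    finally show "prob (\<Inter>j\<in>J. A j) = (\<Prod>j\<in>J. prob (A j))" .
  qed
qed

locale random_inputs =
  fixes M :: "'w measure" and K :: "'c measure"
    and u :: "'n \<Rightarrow> nat \<Rightarrow> 'w \<Rightarrow> real ^ 'p::finite" and c :: "'n \<Rightarrow> nat \<Rightarrow> 'w \<Rightarrow> 'c"
  assumes randomness: "algorithm_randomness M K u c"
    and prob_space_K: "prob_space K"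
begin

sublocale prob_space M
  using randomness by (simp add: algorithm_randomness_def)

sublocale K: prob_space K
  by (rule prob_space_K)

lemma u_sphere: "1 \<le> t \<Longrightarrow> \<omega> \<in> space M \<Longrightarrow> norm (u i t \<omega>) = 1"
  using randomness by (auto simp: algorithm_randomness_def)

lemma indep_pairs: "indep_vars (\<lambda>_. borel \<Otimes>\<^sub>M K) (\<lambda>k \<omega>. (u (fst k) (snd k) \<omega>, c (fst k) (snd k) \<omega>)) (UNIV \<times> {1..})"
  using randomness by (simp add: algorithm_randomness_def case_prod_unfold)

lemma distr_pair: "1 \<le> t \<Longrightarrow> distr M (borel \<Otimes>\<^sub>M K) (\<lambda>\<omega>. (u i t \<omega>, c i t \<omega>)) = uniform_sphere \<Otimes>\<^sub>M K"
  using randomness by (simp add: algorithm_randomness_def)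

lemma
  assumes "1 \<le> t"
  shows measurable_u: "u i t \<in> borel_measurable M" and measurable_c: "c i t \<in> M \<rightarrow>\<^sub>M K"
proof -
  have rv: "(\<lambda>\<omega>. (u i t \<omega>, c i t \<omega>)) \<in> M \<rightarrow>\<^sub>M borel \<Otimes>\<^sub>M K"
    using indep_pairs assms by (auto simp: indep_vars_def2)
  show "u i t \<in> borel_measurable M" "c i t \<in> M \<rightarrow>\<^sub>M K"
    using measurable_comp[OF rv measurable_fst] measurable_comp[OF rv measurable_snd]
    by (auto simp: comp_def)
qed

lemma pair_events:
  assumes t: "1 \<le> t" and A: "A \<in> sets borel" and B: "B \<in> sets K"
  shows "prob ((u i t -` A \<inter> space M) \<inter> (c i t -` B \<inter> space M)) = measure uniform_sphere A * measure K B"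
proof -
  have rv: "(\<lambda>\<omega>. (u i t \<omega>, c i t \<omega>)) \<in> M \<rightarrow>\<^sub>M borel \<Otimes>\<^sub>M K"
    using t by (intro measurable_Pair measurable_u measurable_c)
  have "prob ((u i t -` A \<inter> space M) \<inter> (c i t -` B \<inter> space M))
      = measure (distr M (borel \<Otimes>\<^sub>M K) (\<lambda>\<omega>. (u i t \<omega>, c i t \<omega>))) (A \<times> B)"
    using A B rv by (subst measure_distr) (auto intro!: arg_cong[where f=prob])
  also have "\<dots> = measure uniform_sphere A * measure K B"
    using A B unfolding distr_pair[OF t] measure_def
    by (subst K.emeasure_pair_measure_Times) (simp_all add: enn2real_mult)
  finally show ?thesis .
qed

lemma distr_u: assumes t: "1 \<le> t" shows "distr M borel (u i t) = uniform_sphere"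
proof (rule measure_eqI)
  fix A assume "A \<in> sets (distr M borel (u i t))"
  then have A: "A \<in> sets borel" by simp
  have "c i t -` space K \<inter> space M = space M"
    using measurable_space[OF measurable_c[OF t]] by auto
  then have "prob (u i t -` A \<inter> space M) = measure uniform_sphere A"
    using pair_events[OF t A sets.top, of i] by (simp add: K.prob_space Int_absorb2 Int_assoc)
  then show "emeasure (distr M borel (u i t)) A = emeasure uniform_sphere A"
    using A measurable_u[OF t] by (simp add: emeasure_distr emeasure_eq_measure sphere.emeasure_eq_measure)
qed simp

lemma distr_c: assumes t: "1 \<le> t" shows "distr M K (c i t) = K"
proof (rule measure_eqI)
  fix A assume "A \<in> sets (distr M K (c i t))"
  then have A: "A \<in> sets K" by simp
  have "u i t -` UNIV \<inter> space M \<inter> (c i t -` A \<inter> space M) = c i t -` A \<inter> space M"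
    by auto
  then have "prob (c i t -` A \<inter> space M) = measure K A"
    using pair_events[OF t _ A, of UNIV i] sphere.prob_space[where 'p='p] by simp
  then show "emeasure (distr M K (c i t)) A = emeasure K A"
    using A measurable_c[OF t] by (simp add: emeasure_distr emeasure_eq_measure K.emeasure_eq_measure)
qed simp

text \<open>
  The atomic inputs are indexed by \<open>((i, t), b)\<close>: the direction \<open>u i t\<close> for \<open>b = True\<close> and the
  compressor randomness \<open>c i t\<close> for \<open>b = False\<close>.
\<close>

definition input_events :: "('n \<times> nat) \<times> bool \<Rightarrow> 'w set set" where
  "input_events = (\<lambda>(k, b). if b then {u (fst k) (snd k) -` A \<inter> space M | A. A \<in> sets borel}
     else {c (fst k) (snd k) -` A \<inter> space M | A. A \<in> sets K})"

text \<open>Measurability with respect to \<open>inputs S\<close> records which inputs determine a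
  quantity; independence of two quantities is then a matter of disjoint index sets.\<close>

definition inputs :: "(('n \<times> nat) \<times> bool) set \<Rightarrow> 'w measure" where
  "inputs S = sigma (space M) (\<Union>k\<in>S. input_events k)"

lemma indep_input_events: "indep_sets input_events ((UNIV \<times> {1..}) \<times> UNIV)"
  unfolding input_events_def
proof (rule indep_sets_split_pairs[OF indep_pairs])
  fix k :: "'n \<times> nat" and A :: "(real ^ 'p) set" and B
  assume k: "k \<in> UNIV \<times> {1..}" and A: "A \<in> sets borel" and B: "B \<in> sets K"
  have t: "1 \<le> snd k" using k by auto
  have "prob (u (fst k) (snd k) -` A \<inter> space M) = measure uniform_sphere A"
    using distr_u[OF t, of "fst k"] measure_distr[OF measurable_u[OF t] A, of "fst k"] by simp
  moreover have "prob (c (fst k) (snd k) -` B \<inter> space M) = measure K B"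
    using distr_c[OF t, of "fst k"] measure_distr[OF measurable_c[OF t] B, of "fst k"] by simp
  ultimately show "prob ((u (fst k) (snd k) -` A \<inter> space M) \<inter> (c (fst k) (snd k) -` B \<inter> space M))
      = prob (u (fst k) (snd k) -` A \<inter> space M) * prob (c (fst k) (snd k) -` B \<inter> space M)"
    using pair_events[OF t A B] by simp
qed

lemma input_events_space: "(\<Union>k\<in>S. input_events k) \<subseteq> Pow (space M)"
  by (auto simp: input_events_def split: prod.splits if_splits)

lemma space_inputs [simp]: "space (inputs S) = space M"
  by (simp add: inputs_def input_events_space space_measure_of)

lemma sets_inputs: "sets (inputs S) = sigma_sets (space M) (\<Union>k\<in>S. input_events k)"
  by (simp add: inputs_def input_events_space)

lemma measurable_inputs_mono:
  "f \<in> inputs S \<rightarrow>\<^sub>M N \<Longrightarrow> S \<subseteq> S' \<Longrightarrow> f \<in> inputs S' \<rightarrow>\<^sub>M N"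
  by (rule measurable_mono[of N N "inputs S" "inputs S'", THEN subsetD, rotated -1])
    (auto simp: sets_inputs intro!: sigma_sets_mono')

lemma input_events_measurable:
  assumes "k \<in> (UNIV \<times> {1..}) \<times> UNIV" shows "input_events k \<subseteq> events"
  using assms measurable_u measurable_c
  by (auto simp: input_events_def intro: measurable_sets split: if_splits)

lemma measurable_inputs_imp_measurable:
  assumes f: "f \<in> inputs S \<rightarrow>\<^sub>M N" and S: "S \<subseteq> (UNIV \<times> {1..}) \<times> UNIV"
  shows "f \<in> M \<rightarrow>\<^sub>M N"
proof -
  have "(\<Union>k\<in>S. input_events k) \<subseteq> events"
    using input_events_measurable S by blast
  then have "sets (inputs S) \<subseteq> events"
    unfolding sets_inputs by (rule sets.sigma_sets_subset)
  then show ?thesis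
    using f measurable_mono[of N N "inputs S" M] by auto
qed

lemma measurable_inputs_u: "((i, t), True) \<in> S \<Longrightarrow> 1 \<le> t \<Longrightarrow> u i t \<in> borel_measurable (inputs S)"
  by (rule measurableI) (force simp: sets_inputs input_events_def intro!: sigma_sets.Basic)+

lemma measurable_inputs_c: "((i, t), False) \<in> S \<Longrightarrow> 1 \<le> t \<Longrightarrow> c i t \<in> inputs S \<rightarrow>\<^sub>M K"
  using measurable_space[OF measurable_c]
  by (intro measurableI) (force simp: sets_inputs input_events_def intro!: sigma_sets.Basic)+

text \<open>Disjoint sets of independent generators generate independent sigma-algebras, so the
  joint law agrees with the product on rectangles.\<close>

lemma distr_inputs_pair:
  assumes H: "H \<in> inputs S \<rightarrow>\<^sub>M N" and V: "V \<in> inputs S' \<rightarrow>\<^sub>M N'"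
    and S: "S \<subseteq> (UNIV \<times> {1..}) \<times> UNIV" "S' \<subseteq> (UNIV \<times> {1..}) \<times> UNIV" "S \<inter> S' = {}"
  shows "distr M (N \<Otimes>\<^sub>M N') (\<lambda>\<omega>. (H \<omega>, V \<omega>)) = distr M N H \<Otimes>\<^sub>M distr M N' V"
proof -
  let ?I = "case_bool S S'"
  have "indep_sets (\<lambda>b. sigma_sets (space M) (\<Union>k\<in>?I b. input_events k)) UNIV"
  proof (rule indep_sets_collect_sigma)
    show "indep_sets input_events (\<Union>b\<in>UNIV. ?I b)"
      using S by (intro indep_sets_mono_index[OF _ indep_input_events]) (auto split: bool.splits)
    show "disjoint_family_on ?I UNIV"
      using S(3) by (auto simp: disjoint_family_on_def split: bool.splits)
    fix b k assume "k \<in> ?I b"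
    show "Int_stable (input_events k)"
      unfolding input_events_def by (auto split: prod.splits intro: Int_stable_vimages)
  qed
  then have "indep_sets (case_bool (sets (inputs S)) (sets (inputs S'))) UNIV"
    by (rule indep_sets_mono_sets) (auto simp: sets_inputs split: bool.splits)
  then have ind: "indep_set (sets (inputs S)) (sets (inputs S'))"
    by (simp add: indep_set_def)
  have HM: "H \<in> M \<rightarrow>\<^sub>M N" and VM: "V \<in> M \<rightarrow>\<^sub>M N'"
    using H V S by (simp_all add: measurable_inputs_imp_measurable)
  interpret H: prob_space "distr M N H" by (rule prob_space_distr[OF HM])
  interpret V: prob_space "distr M N' V" by (rule prob_space_distr[OF VM])
  show ?thesis
  proof (rule pair_measure_eqI[symmetric])
    fix A B assume "A \<in> sets (distr M N H)" "B \<in> sets (distr M N' V)"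
    then have AB: "A \<in> sets N" "B \<in> sets N'" by auto
    have "(\<lambda>\<omega>. (H \<omega>, V \<omega>)) -` (A \<times> B) \<inter> space M = (H -` A \<inter> space M) \<inter> (V -` B \<inter> space M)"
      by auto
    moreover have "prob ((H -` A \<inter> space M) \<inter> (V -` B \<inter> space M)) = prob (H -` A \<inter> space M) * prob (V -` B \<inter> space M)"
      using measurable_sets[OF H AB(1)] measurable_sets[OF V AB(2)] by (intro indep_setD[OF ind]) auto
    ultimately show "emeasure (distr M N H) A * emeasure (distr M N' V) B
        = emeasure (distr M (N \<Otimes>\<^sub>M N') (\<lambda>\<omega>. (H \<omega>, V \<omega>))) (A \<times> B)"
      using HM VM AB by (simp add: emeasure_distr emeasure_eq_measure ennreal_mult)
  qed (auto intro: H.sigma_finite_measure_axioms V.sigma_finite_measure_axioms)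
qed

text \<open>The past is frozen and the fresh compressor randomness integrated out. The nonnegative
  integral is the right one here, because integrability of the compression error is a consequence of
  this identity.\<close>

lemma nn_integral_fresh_c:
  assumes H: "H \<in> inputs S \<rightarrow>\<^sub>M N" and S: "S \<subseteq> (UNIV \<times> {1..}) \<times> UNIV" "((i, t), False) \<notin> S" and t: "1 \<le> t"
    and \<psi>: "\<psi> \<in> borel_measurable (N \<Otimes>\<^sub>M K)"
  shows "(\<integral>\<^sup>+\<omega>. \<psi> (H \<omega>, c i t \<omega>) \<partial>M) = (\<integral>\<^sup>+\<omega>. \<integral>\<^sup>+k. \<psi> (H \<omega>, k) \<partial>K \<partial>M)"
proof -
  have [measurable]: "H \<in> M \<rightarrow>\<^sub>M N"
    using H S(1) by (rule measurable_inputs_imp_measurable)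
  have [measurable]: "c i t \<in> M \<rightarrow>\<^sub>M K" using t by (rule measurable_c)
  note \<psi> [measurable]
  have dist: "distr M (N \<Otimes>\<^sub>M K) (\<lambda>\<omega>. (H \<omega>, c i t \<omega>)) = distr M N H \<Otimes>\<^sub>M K"
    using distr_inputs_pair[OF H measurable_inputs_c[where S="{((i, t), False)}"]] S t by (simp add: distr_c)
  have "(\<integral>\<^sup>+\<omega>. \<psi> (H \<omega>, c i t \<omega>) \<partial>M) = (\<integral>\<^sup>+z. \<psi> z \<partial>distr M (N \<Otimes>\<^sub>M K) (\<lambda>\<omega>. (H \<omega>, c i t \<omega>)))"
    by (subst nn_integral_distr) simp_all
  also have "\<dots> = (\<integral>\<^sup>+h. \<integral>\<^sup>+k. \<psi> (h, k) \<partial>K \<partial>distr M N H)"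
    unfolding dist by (subst K.nn_integral_fst) simp_all
  also have "\<dots> = (\<integral>\<^sup>+\<omega>. \<integral>\<^sup>+k. \<psi> (H \<omega>, k) \<partial>K \<partial>M)"
    by (subst nn_integral_distr) simp_all
  finally show ?thesis .
qed

text \<open>Takes the place of conditioning on the information carried by \<open>H\<close>: the
  inner integral is the conditional mean over the fresh direction.\<close>

lemma expectation_fresh_u:
  fixes \<psi> :: "_ \<Rightarrow> real"
  assumes H: "H \<in> inputs S \<rightarrow>\<^sub>M N" and S: "S \<subseteq> (UNIV \<times> {1..}) \<times> UNIV" "((i, t), True) \<notin> S" and t: "1 \<le> t"
    and \<psi>: "\<psi> \<in> borel_measurable (N \<Otimes>\<^sub>M borel)"
    and int: "integrable M (\<lambda>\<omega>. \<psi> (H \<omega>, u i t \<omega>))"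
  shows "(\<integral>\<omega>. \<psi> (H \<omega>, u i t \<omega>) \<partial>M) = (\<integral>\<omega>. (\<integral>v. \<psi> (H \<omega>, v) \<partial>uniform_sphere) \<partial>M)"
proof -
  have [measurable]: "H \<in> M \<rightarrow>\<^sub>M N"
    using H S(1) by (rule measurable_inputs_imp_measurable)
  have [measurable]: "u i t \<in> borel_measurable M" using t by (rule measurable_u)
  note \<psi> [measurable]
  have dist: "distr M (N \<Otimes>\<^sub>M borel) (\<lambda>\<omega>. (H \<omega>, u i t \<omega>)) = distr M N H \<Otimes>\<^sub>M uniform_sphere"
    using distr_inputs_pair[OF H measurable_inputs_u[where S="{((i, t), True)}"]] S t by (simp add: distr_u)
  interpret H: prob_space "distr M N H" by (rule prob_space_distr) simp
  interpret pair_sigma_finite "distr M N H" "uniform_sphere :: (real ^ 'p) measure" ..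
  have "(\<integral>\<omega>. \<psi> (H \<omega>, u i t \<omega>) \<partial>M) = (\<integral>z. \<psi> z \<partial>distr M (N \<Otimes>\<^sub>M borel) (\<lambda>\<omega>. (H \<omega>, u i t \<omega>)))"
    by (subst integral_distr) simp_all
  also have "\<dots> = (\<integral>h. (\<integral>v. \<psi> (h, v) \<partial>uniform_sphere) \<partial>distr M N H)"
  proof -
    have "integrable (distr M N H \<Otimes>\<^sub>M uniform_sphere) \<psi>"
      using int unfolding dist[symmetric] by (subst integrable_distr_eq) simp_all
    then show ?thesis
      unfolding dist by (rule integral_fst'[symmetric])
  qed
  also have "\<dots> = (\<integral>\<omega>. (\<integral>v. \<psi> (H \<omega>, v) \<partial>uniform_sphere) \<partial>M)"
    by (subst integral_distr) simp_all
  finally show ?thesis .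
qed

end

section \<open>The search directions\<close>

locale compressed_bandit =
  fixes X Y :: "(real ^ 'p::finite) set"
    and r R G1 G2 L w C :: real
    and m :: "'n::finite \<Rightarrow> nat"
    and f :: "'n \<Rightarrow> nat \<Rightarrow> real ^ 'p \<Rightarrow> real"
    and g :: "'n \<Rightarrow> nat \<Rightarrow> real ^ 'p \<Rightarrow> nat \<Rightarrow> real"
    and E :: "nat \<Rightarrow> ('n \<times> 'n) set"
    and W :: "nat \<Rightarrow> real ^ 'n ^ 'n"
    and B :: nat
    and K :: "'c measure"
    and Q :: "real ^ 'p \<Rightarrow> 'c \<Rightarrow> real ^ 'p"
    and M :: "'w measure"
    and u :: "'n \<Rightarrow> nat \<Rightarrow> 'w \<Rightarrow> real ^ 'p"
    and c :: "'n \<Rightarrow> nat \<Rightarrow> 'w \<Rightarrow> 'c"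
    and \<alpha>0 \<gamma>0 s0 \<theta>1 \<theta>2 :: real
    and \<alpha> \<gamma> \<xi> \<delta> s :: "nat \<Rightarrow> real"
    and z1 :: "'n \<Rightarrow> real ^ 'p"
    and z zh x :: "'n \<Rightarrow> nat \<Rightarrow> 'w \<Rightarrow> real ^ 'p"
    and zs :: "'n \<Rightarrow> 'n \<Rightarrow> nat \<Rightarrow> 'w \<Rightarrow> real ^ 'p"
  assumes X: "closed X" "convex X" "0 < r" "0 < R" "cball 0 r \<subseteq> X" "X \<subseteq> cball 0 R"
    and f_diff: "\<And>i t. 1 \<le> t \<Longrightarrow> f i t differentiable_on X"
    and g_diff: "\<And>i t k. 1 \<le> t \<Longrightarrow> k < m i \<Longrightarrow> (\<lambda>y. g i t y k) differentiable_on X"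
    and g_convex: "\<And>i t k. 1 \<le> t \<Longrightarrow> k < m i \<Longrightarrow> convex_on X (\<lambda>y. g i t y k)"
    and f_grad_bound: "\<And>i t y. 1 \<le> t \<Longrightarrow> y \<in> X \<Longrightarrow> norm (gradient X (f i t) y) \<le> G1"
    and g_grad_bound: "\<And>i t y. 1 \<le> t \<Longrightarrow> y \<in> X \<Longrightarrow>
          spectral_norm (m i) (\<lambda>k. gradient X (\<lambda>y'. g i t y' k) y) \<le> G2"
    and f_grad_Lipschitz: "\<And>i t y y'. 1 \<le> t \<Longrightarrow> y \<in> X \<Longrightarrow> y' \<in> X \<Longrightarrow>
          norm (gradient X (f i t) y - gradient X (f i t) y') \<le> L * norm (y - y')"
    and feasible: "\<And>T. 1 \<le> T \<Longrightarrow> feasible_set X m g T \<noteq> {}"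
    and w: "w \<in> {0<..<1}"
    and weights: "\<And>t i j. 1 \<le> t \<Longrightarrow>
          (if (j, i) \<in> E t \<or> i = j then W t $ i $ j \<ge> w else W t $ i $ j = 0)"
    and doubly_stochastic: "\<And>t. 1 \<le> t \<Longrightarrow> doubly_stochastic (W t)"
    and connected: "0 < B" "\<And>t. 1 \<le> t \<Longrightarrow> strongly_connected (\<Union>l\<in>{0..B - 1}. E (t + l))"
    and neighbours_0: "\<And>i. in_neighbours E 0 i = in_neighbours E 1 i"
    and compressor: "0 \<le> C" "bounded_error_compressor Y K Q C"
    and randomness: "algorithm_randomness M K u c"
    and constants: "0 < \<alpha>0" "\<alpha>0 < 1" "\<theta>1 \<in> {0<..<1}"
          "\<gamma>0 \<in> {0<..1 / (4 * ((real CARD('p))\<^sup>2 + 1) * G2\<^sup>2)}" "0 < s0" "1 \<le> \<theta>2"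
    and parameters: "\<And>t. 1 \<le> t \<Longrightarrow> \<alpha> t = \<alpha>0 / real t powr \<theta>1"
          "\<And>t. 1 \<le> t \<Longrightarrow> \<gamma> t = \<gamma>0 / \<alpha> t"
          "\<And>t. 1 \<le> t \<Longrightarrow> \<xi> t = \<alpha> t"
          "\<And>t. 1 \<le> t \<Longrightarrow> \<delta> t = r * \<alpha> t"
          "\<And>t. 1 \<le> t \<Longrightarrow> s t = s0 / real t powr \<theta>2"
    and initial: "\<And>i. z1 i \<in> (*\<^sub>R) (1 - \<xi> 1) ` X"
    and path: "\<And>\<omega>. \<omega> \<in> space M \<Longrightarrow>
          compressed_bandit_path X Q E W m f g \<alpha> \<gamma> \<xi> \<delta> s z1
            (\<lambda>i t. u i t \<omega>) (\<lambda>i t. c i t \<omega>) (\<lambda>i t. z i t \<omega>) (\<lambda>i t. zh i t \<omega>)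
            (\<lambda>i j t. zs i j t \<omega>) (\<lambda>i t. x i t \<omega>)"
    and x_in: "\<And>i t \<omega>. 1 \<le> t \<Longrightarrow> \<omega> \<in> space M \<Longrightarrow> x i t \<omega> \<in> (*\<^sub>R) (1 - \<xi> t) ` X"
    and args_in: "\<And>i t \<omega>. 1 \<le> t \<Longrightarrow> \<omega> \<in> space M \<Longrightarrow>
          (z i t \<omega> - zh i (t - 1) \<omega>) /\<^sub>R s t \<in> Y"
begin

sublocale random_inputs M K u c
  by (rule random_inputs.intro[OF randomness]) (use compressor(2) in \<open>simp add: bounded_error_compressor_def\<close>)

section \<open>Parameters and the scaled decision sets\<close>

lemma alpha_pos: "1 \<le> t \<Longrightarrow> 0 < \<alpha> t"
  using constants(1) by (simp add: parameters(1))

lemma alpha_antimono: "1 \<le> t \<Longrightarrow> t \<le> t' \<Longrightarrow> \<alpha> t' \<le> \<alpha> t"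
  using constants(1,3) by (simp add: parameters(1) divide_left_mono powr_mono2)

lemma alpha_le: "1 \<le> t \<Longrightarrow> \<alpha> t \<le> \<alpha>0"
  using alpha_antimono[of 1 t] by (simp add: parameters(1))

lemma alpha_less_1: "1 \<le> t \<Longrightarrow> \<alpha> t < 1"
  using alpha_le[of t] constants(2) by simp

lemma gamma_pos: "1 \<le> t \<Longrightarrow> 0 < \<gamma> t"
  using constants(4) alpha_pos by (simp add: parameters(2))

lemma gamma_alpha: "1 \<le> t \<Longrightarrow> \<gamma> t * \<alpha> t = \<gamma>0"
  using alpha_pos[of t] by (simp add: parameters(2))

lemma delta_pos: "1 \<le> t \<Longrightarrow> 0 < \<delta> t"
  using X(3) alpha_pos by (simp add: parameters(4))

lemma zero_in_X: "0 \<in> X"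
  using subsetD[OF X(5), of 0] X(3) by simp

lemma norm_X: "y \<in> X \<Longrightarrow> norm y \<le> R"
  using subsetD[OF X(6), of y] by simp

lemma scaled_in_X: "0 \<le> a \<Longrightarrow> a \<le> 1 \<Longrightarrow> y \<in> X \<Longrightarrow> a *\<^sub>R y \<in> X"
  using convexD[OF X(2) _ zero_in_X, of y a "1 - a"] by simp

lemma dist_X: "y \<in> X \<Longrightarrow> y' \<in> X \<Longrightarrow> norm (y - y') \<le> 2 * R"
  using norm_triangle_ineq4[of y y'] norm_X[of y] norm_X[of y'] by linarith

text \<open>For \<open>G2 = 0\<close> the upper bound on \<open>\<gamma>0\<close> would be a
  division by zero, hence 0, and the interval for \<open>\<gamma>0\<close> would be empty.\<close>

lemma G2_pos: "0 < G2"
proof -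
  have "0 \<le> G2"
    using order_trans[OF spectral_norm_nonneg g_grad_bound[of 1 0]] zero_in_X by simp
  moreover have "G2 \<noteq> 0" using constants(4) by auto
  ultimately show ?thesis by simp
qed

text \<open>The second inequality is the form in which the bound on \<open>\<gamma>0\<close> is
  used: it keeps the second moment of the constraint part of a step below a quarter of the quadratic
  violation term.\<close>

lemma gamma0_pos: "0 < \<gamma>0" and gamma0_le: "(real CARD('p))\<^sup>2 * G2\<^sup>2 * \<gamma>0 \<le> 1 / 4"
proof -
  show "0 < \<gamma>0" using constants by simp
  have pos: "0 < 4 * ((real CARD('p))\<^sup>2 + 1) * G2\<^sup>2"
    using G2_pos by (simp add: add_nonneg_pos)
  have "\<gamma>0 * (4 * ((real CARD('p))\<^sup>2 + 1) * G2\<^sup>2) \<le> 1"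
    using constants(4) pos by (simp add: pos_le_divide_eq)
  moreover have "0 \<le> \<gamma>0 * (4 * G2\<^sup>2)" using \<open>0 < \<gamma>0\<close> by simp
  ultimately show "(real CARD('p))\<^sup>2 * G2\<^sup>2 * \<gamma>0 \<le> 1 / 4"
    by (simp add: algebra_simps)
qed

lemma G1_nonneg: "0 \<le> G1"
  using order_trans[OF norm_ge_zero f_grad_bound[of 1 0]] zero_in_X by simp

text \<open>The Lipschitz condition fixes the sign of \<open>L\<close> only if \<open>X\<close> has
  two distinct points; the ball of radius \<open>r\<close> supplies them.\<close>

lemma L_nonneg: "0 \<le> L"
proof -
  obtain v :: "real ^ 'p" where v: "norm v = r" using vector_choose_size[of r] X by auto
  then have "v \<in> X" using X by auto
  then have "0 \<le> L * norm (v - 0)"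
    using order_trans[OF norm_ge_zero f_grad_Lipschitz[of 1 v 0]] zero_in_X by simp
  then show ?thesis using v X by (simp add: zero_le_mult_iff)
qed

definition Xs :: "nat \<Rightarrow> (real ^ 'p) set" where
  "Xs t = (*\<^sub>R) (1 - \<xi> t) ` X"

lemma closed_Xs: "closed (Xs t)" and convex_Xs: "convex (Xs t)" and Xs_nonempty: "Xs t \<noteq> {}"
  using X zero_in_X by (auto simp: Xs_def intro: closed_scaling convex_scaling)

lemma Xs_subset: "1 \<le> t \<Longrightarrow> Xs t \<subseteq> X"
  using alpha_pos[of t] alpha_less_1[of t] by (auto simp: Xs_def parameters(3) intro!: scaled_in_X)

lemma scaled_in_Xs: "y \<in> X \<Longrightarrow> (1 - \<xi> t) *\<^sub>R y \<in> Xs t"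
  by (auto simp: Xs_def)

text \<open>Because the sets grow, iterate and comparator of round \<open>t\<close> belong to the
  set onto which the step to round \<open>Suc t\<close> projects, so the projection fixes
  them.\<close>

lemma Xs_mono: "1 \<le> t \<Longrightarrow> Xs t \<subseteq> Xs (Suc t)"
proof
  fix y assume t: "1 \<le> t" and "y \<in> Xs t"
  then obtain y' where y': "y' \<in> X" "y = (1 - \<alpha> t) *\<^sub>R y'"
    by (auto simp: Xs_def parameters(3))
  let ?a = "(1 - \<alpha> t) / (1 - \<alpha> (Suc t))"
  have "0 < 1 - \<alpha> (Suc t)" "0 \<le> 1 - \<alpha> t" "1 - \<alpha> t \<le> 1 - \<alpha> (Suc t)"
    using t alpha_less_1[of t] alpha_less_1[of "Suc t"] alpha_antimono[of t "Suc t"] by auto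
  then have "?a *\<^sub>R y' \<in> X" "y = (1 - \<xi> (Suc t)) *\<^sub>R ?a *\<^sub>R y'"
    using y' by (auto intro!: scaled_in_X simp: parameters(3))
  then show "y \<in> Xs (Suc t)"
    unfolding Xs_def by (rule image_eqI[rotated])
qed

lemma query_in_X: "1 \<le> t \<Longrightarrow> y \<in> Xs t \<Longrightarrow> norm v = 1 \<Longrightarrow> y + \<delta> t *\<^sub>R v \<in> X"
proof -
  assume t: "1 \<le> t" and y: "y \<in> Xs t" and v: "norm v = 1"
  obtain y' where y': "y' \<in> X" "y = (1 - \<alpha> t) *\<^sub>R y'"
    using y t by (auto simp: Xs_def parameters(3))
  have "r *\<^sub>R v \<in> X" using X v by auto
  then have "(1 - \<alpha> t) *\<^sub>R y' + \<alpha> t *\<^sub>R (r *\<^sub>R v) \<in> X"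
    using t alpha_pos[of t] alpha_less_1[of t] y' by (intro convexD[OF X(2)]) auto
  then show ?thesis using y' t by (simp add: parameters(4) mult.commute)
qed

section \<open>Lipschitz constants and constraint violation\<close>

lemma f_lipschitz: "1 \<le> t \<Longrightarrow> y \<in> X \<Longrightarrow> y' \<in> X \<Longrightarrow> \<bar>f i t y - f i t y'\<bar> \<le> G1 * norm (y - y')"
  using X f_diff f_grad_bound by (intro gradient_bound_imp_lipschitz[where X=X]) auto

lemma f_taylor: "1 \<le> t \<Longrightarrow> y \<in> X \<Longrightarrow> y' \<in> X \<Longrightarrow>
    \<bar>f i t y' - f i t y - gradient X (f i t) y \<bullet> (y' - y)\<bar> \<le> L * (norm (y' - y))\<^sup>2"
  using X f_diff f_grad_Lipschitz L_nonneg by (intro lipschitz_gradient_imp_taylor[where X=X]) auto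

lemma interior_X: "interior X \<noteq> {}"
proof -
  have "ball 0 r \<subseteq> X" using X(5) ball_subset_cball by blast
  then have "0 \<in> interior X" using X(3) by (auto simp: mem_interior)
  then show ?thesis by auto
qed

lemma gradient_global_loss:
  assumes "1 \<le> t" "y \<in> X"
  shows "gradient X (global_loss f t) y = (\<Sum>j\<in>UNIV. gradient X (f j t) y) /\<^sub>R real CARD('n)"
proof (rule gradient_eqI[OF X(2) interior_X assms(2)])
  have "(f j t has_derivative (\<lambda>v. gradient X (f j t) y \<bullet> v)) (at y within X)" for j
    using f_diff assms by (intro gradient_has_derivative) (auto simp: differentiable_on_def)
  then show "(global_loss f t has_derivative (\<lambda>v. ((\<Sum>j\<in>UNIV. gradient X (f j t) y) /\<^sub>R real CARD('n)) \<bullet> v)) (at y within X)"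
    unfolding global_loss_def
    by (auto intro!: derivative_eq_intros simp: inner_sum_left divide_inverse sum_distrib_left mult.commute)
qed

text \<open>The gradient of a linear combination of components is the Jacobian applied to the weight
  vector, which is exactly what the spectral norm controls.\<close>

lemma weighted_g_lipschitz:
  assumes "1 \<le> t" "y \<in> X" "y' \<in> X"
  shows "\<bar>(\<Sum>k<m i. v k * g i t y k) - (\<Sum>k<m i. v k * g i t y' k)\<bar> \<le> G2 * L2_set v {..<m i} * norm (y - y')"
proof (rule gradient_bound_imp_lipschitz[OF X(2) _ _ assms(2,3), of "\<lambda>y. \<Sum>k<m i. v k * g i t y k"])
  have der: "((\<lambda>y. \<Sum>k<m i. v k * g i t y k) has_derivative
      (\<lambda>a. (\<Sum>k<m i. v k *\<^sub>R gradient X (\<lambda>y. g i t y k) y) \<bullet> a)) (at y within X)" if "y \<in> X" for y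
  proof -
    have "((\<lambda>y. g i t y k) has_derivative (\<lambda>a. gradient X (\<lambda>y. g i t y k) y \<bullet> a)) (at y within X)" if "k < m i" for k
      using g_diff that \<open>y \<in> X\<close> assms(1) by (intro gradient_has_derivative) (auto simp: differentiable_on_def)
    then show ?thesis
      by (auto intro!: derivative_eq_intros simp: inner_sum_left)
  qed
  then show "(\<lambda>y. \<Sum>k<m i. v k * g i t y k) differentiable_on X"
    by (auto simp: differentiable_on_def intro: differentiableI)
  show "norm (gradient X (\<lambda>y. \<Sum>k<m i. v k * g i t y k) y) \<le> G2 * L2_set v {..<m i}" if y: "y \<in> X" for y
  proof -
    have "norm (\<Sum>k<m i. v k *\<^sub>R gradient X (\<lambda>y. g i t y k) y)
        \<le> spectral_norm (m i) (\<lambda>k. gradient X (\<lambda>y. g i t y k) y) * L2_set v {..<m i}"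
      by (rule norm_sum_le_spectral_norm)
    also have "\<dots> \<le> G2 * L2_set v {..<m i}"
      using g_grad_bound assms(1) y by (intro mult_right_mono) auto
    finally show ?thesis
      by (simp only: gradient_eqI[OF X(2) interior_X y der[OF y]])
  qed
qed

definition violation :: "'n \<Rightarrow> nat \<Rightarrow> real ^ 'p \<Rightarrow> real" where
  "violation i t y = L2_set (\<lambda>k. max 0 (g i t y k)) {..<m i}"

lemma violation_nonneg [simp]: "0 \<le> violation i t y"
  by (simp add: violation_def)

lemma violation_power2: "(violation i t y)\<^sup>2 = (\<Sum>k<m i. max 0 (g i t y k) * g i t y k)"
  unfolding violation_def L2_set_def
  by (simp add: sum_nonneg power2_eq_square) (intro sum.cong refl, auto simp: max_def)

text \<open>The positive parts at \<open>y\<close>, used as weights, pair with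
  \<open>g i t y\<close> to the squared violation at \<open>y\<close>, and with
  \<open>g i t y'\<close> to at most the product of the two violations. The Lipschitz bound for this
  one scalar combination is then divided by the violation at \<open>y\<close>.\<close>

lemma violation_lipschitz:
  assumes "1 \<le> t" "y \<in> X" "y' \<in> X"
  shows "violation i t y \<le> violation i t y' + G2 * norm (y - y')"
proof (cases "violation i t y = 0")
  case True
  then show ?thesis using G2_pos by (simp add: add_nonneg_nonneg)
next
  case False
  then have pos: "0 < violation i t y"
    using violation_nonneg[of i t y] by linarith
  let ?v = "\<lambda>k. max 0 (g i t y k)"
  have "(\<Sum>k<m i. ?v k * g i t y' k) \<le> (\<Sum>k<m i. \<bar>?v k\<bar> * \<bar>max 0 (g i t y' k)\<bar>)"
    by (intro sum_mono) (auto intro!: mult_left_mono)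
  also have "\<dots> \<le> violation i t y * violation i t y'"
    unfolding violation_def by (rule L2_set_mult_ineq)
  finally have "violation i t y * violation i t y
      \<le> violation i t y * violation i t y' + G2 * violation i t y * norm (y - y')"
    using weighted_g_lipschitz[OF assms, where v="?v" and i=i] violation_power2[of i t y]
    by (simp add: power2_eq_square violation_def[symmetric])
  then have "violation i t y * violation i t y \<le> violation i t y * (violation i t y' + G2 * norm (y - y'))"
    by (simp add: algebra_simps)
  then show ?thesis using pos by simp
qed

text \<open>A feasible point has no violation and is at distance at most \<open>2 * R\<close>. The
  bound is uniform in \<open>t\<close>, unlike bounds on \<open>\<gamma> t\<close> times the
  violation.\<close>

lemma violation_le:
  assumes "1 \<le> t" "y \<in> X"
  shows "violation i t y \<le> 2 * R * G2"
proof -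
  obtain y' where y': "y' \<in> feasible_set X m g t" using feasible[OF assms(1)] by auto
  then have "max 0 (g i t y' k) = 0" if "k < m i" for k
    using that assms by (auto simp: feasible_set_def)
  then have "violation i t y' = 0"
    by (simp add: violation_def L2_set_def)
  moreover have "y' \<in> X" using y' by (simp add: feasible_set_def)
  ultimately have "violation i t y \<le> G2 * norm (y - y')"
    using violation_lipschitz[OF assms, of y' i] by simp
  also have "\<dots> \<le> G2 * (2 * R)"
    using dist_X assms \<open>y' \<in> X\<close> G2_pos by (intro mult_left_mono) auto
  finally show ?thesis by (simp add: mult.commute)
qed

text \<open>
  The path evaluates \<open>f\<close> and \<open>g\<close> only on \<open>X\<close>, and they need not be measurable outside \<open>X\<close>;
  composing with the projection onto \<open>X\<close> makes them continuous everywhere.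
\<close>

definition fX :: "'n \<Rightarrow> nat \<Rightarrow> real ^ 'p \<Rightarrow> real" where
  "fX i t y = f i t (closest_point X y)"

definition gX :: "'n \<Rightarrow> nat \<Rightarrow> real ^ 'p \<Rightarrow> nat \<Rightarrow> real" where
  "gX i t y k = g i t (closest_point X y) k"

lemma fX_eq [simp]: "y \<in> X \<Longrightarrow> fX i t y = f i t y" and gX_eq [simp]: "y \<in> X \<Longrightarrow> gX i t y k = g i t y k"
  by (simp_all add: fX_def gX_def closest_point_self)

lemma continuous_compose_closest_point:
  assumes "continuous_on X h" shows "continuous_on UNIV (\<lambda>y. h (closest_point X y))"
  using X zero_in_X
  by (intro continuous_on_compose2[OF assms] continuous_on_closest_point) (auto intro: closest_point_in_set)

lemma measurable_fX: "1 \<le> t \<Longrightarrow> fX i t \<in> borel_measurable borel"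
  unfolding fX_def
  by (rule borel_measurable_continuous_onI, rule continuous_compose_closest_point)
    (intro differentiable_imp_continuous_on f_diff)

lemma measurable_gX: "1 \<le> t \<Longrightarrow> k < m i \<Longrightarrow> (\<lambda>y. gX i t y k) \<in> borel_measurable borel"
  unfolding gX_def
  by (rule borel_measurable_continuous_onI, rule continuous_compose_closest_point)
    (intro differentiable_imp_continuous_on g_diff)

section \<open>The estimated direction and its mean\<close>

definition direction :: "'n \<Rightarrow> nat \<Rightarrow> real ^ 'p \<Rightarrow> real ^ 'p \<Rightarrow> real ^ 'p" where
  "direction i t = bandit_direction (\<gamma> t) (\<delta> t) (fX i t) (m i) (gX i t)"

lemma measurable_direction:
  assumes t: "1 \<le> t" and y: "y \<in> borel_measurable N" and v: "v \<in> borel_measurable N"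
  shows "(\<lambda>\<omega>. direction i t (y \<omega>) (v \<omega>)) \<in> borel_measurable N"
proof -
  have q: "(\<lambda>\<omega>. y \<omega> + \<delta> t *\<^sub>R v \<omega>) \<in> borel_measurable N"
    using y v by simp
  have f: "(\<lambda>\<omega>. fX i t (h \<omega>)) \<in> borel_measurable N" if "h \<in> borel_measurable N" for h
    using measurable_compose[OF that measurable_fX[OF t]] .
  have g: "(\<lambda>\<omega>. gX i t (h \<omega>) k) \<in> borel_measurable N" if "h \<in> borel_measurable N" "k \<in> {..<m i}" for h k
    using measurable_compose[OF that(1) measurable_gX[OF t]] that(2) by simp
  show ?thesis
    unfolding direction_def bandit_direction_def two_point_gradient_def
    by (intro borel_measurable_add borel_measurable_scaleR borel_measurable_sum borel_measurable_times
        borel_measurable_diff borel_measurable_const borel_measurable_max f g y v q)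
qed

text \<open>The weights are frozen at \<open>y\<close> while \<open>y'\<close> varies. As a function
  of \<open>y'\<close> this is a convex scalar function on \<open>X\<close>, and by linearity its
  two-point estimate is the constraint part of the direction.\<close>

definition weighted_g :: "'n \<Rightarrow> nat \<Rightarrow> real ^ 'p \<Rightarrow> real ^ 'p \<Rightarrow> real" where
  "weighted_g i t y y' = (\<Sum>k<m i. (\<gamma> t * max 0 (gX i t y k)) * gX i t y' k)"

lemma direction_eq:
  "direction i t y v = two_point_gradient (\<delta> t) (fX i t) y v + two_point_gradient (\<delta> t) (weighted_g i t y) y v"
proof -
  have scalars: "(\<Sum>k<m i. c k * (d * (h k - h' k))) = d * ((\<Sum>k<m i. c k * h k) - (\<Sum>k<m i. c k * h' k))"
    for c h h' :: "nat \<Rightarrow> real" and d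
    by (simp add: sum_distrib_left algebra_simps flip: sum_subtractf)
  have "(\<Sum>k<m i. (\<gamma> t * max 0 (gX i t y k)) *\<^sub>R two_point_gradient (\<delta> t) (\<lambda>y. gX i t y k) y v)
      = two_point_gradient (\<delta> t) (weighted_g i t y) y v"
    unfolding two_point_gradient_def weighted_g_def scaleR_scaleR scaleR_sum_left[symmetric] scalars ..
  then show ?thesis by (simp add: direction_def bandit_direction_def)
qed

lemma measurable_weighted_g: "1 \<le> t \<Longrightarrow> weighted_g i t y \<in> borel_measurable borel"
  unfolding weighted_g_def by (intro borel_measurable_sum borel_measurable_times measurable_gX) auto

lemma weighted_g_lipschitz':
  assumes "1 \<le> t" "y \<in> X" "a \<in> X" "b \<in> X"
  shows "\<bar>weighted_g i t y a - weighted_g i t y b\<bar> \<le> (G2 * (\<gamma> t * violation i t y)) * norm (a - b)"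
proof -
  have "L2_set (\<lambda>k. \<gamma> t * max 0 (g i t y k)) {..<m i} = \<gamma> t * violation i t y"
    using gamma_pos[OF assms(1)] by (simp add: violation_def L2_set_right_distrib)
  then show ?thesis
    using weighted_g_lipschitz[OF assms(1,3,4), where i=i and v="\<lambda>k. \<gamma> t * max 0 (g i t y k)"] assms
    by (simp add: weighted_g_def)
qed

lemma norm_direction_le:
  assumes t: "1 \<le> t" and y: "y \<in> Xs t" and v: "norm v = 1"
  shows "norm (direction i t y v) \<le> real CARD('p) * G1 + real CARD('p) * G2 * \<gamma> t * violation i t y"
proof -
  have yX: "y \<in> X" using Xs_subset t y by auto
  have qX: "y + \<delta> t *\<^sub>R v \<in> X" using query_in_X t y v by simp
  have nd: "norm ((y + \<delta> t *\<^sub>R v) - y) = \<delta> t" using v delta_pos[OF t] by simp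
  have "norm (two_point_gradient (\<delta> t) (fX i t) y v) \<le> real CARD('p) * G1"
    using f_lipschitz[OF t qX yX, of i]
    unfolding nd by (intro norm_two_point_gradient_le[OF delta_pos[OF t] v]) (simp only: fX_eq yX qX)
  moreover have "norm (two_point_gradient (\<delta> t) (weighted_g i t y) y v) \<le> real CARD('p) * (G2 * (\<gamma> t * violation i t y))"
    using weighted_g_lipschitz'[OF t yX qX yX, of i]
    unfolding nd by (rule norm_two_point_gradient_le[OF delta_pos[OF t] v])
  ultimately show ?thesis
    unfolding direction_eq
    using norm_triangle_ineq[of "two_point_gradient (\<delta> t) (fX i t) y v" "two_point_gradient (\<delta> t) (weighted_g i t y) y v"]
    by (simp add: mult.assoc)
qed

definition mean_direction :: "'n \<Rightarrow> nat \<Rightarrow> real ^ 'p \<Rightarrow> real ^ 'p" where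
  "mean_direction i t y = (\<integral>v. direction i t y v \<partial>uniform_sphere)"

lemma integrable_direction:
  assumes t: "1 \<le> t" and y: "y \<in> Xs t"
  shows "integrable uniform_sphere (direction i t y)"
proof (rule integrable_uniform_sphere_bounded)
  show "direction i t y \<in> borel_measurable borel"
    by (rule measurable_direction[OF t, where y="\<lambda>_. y" and v="\<lambda>v. v"]) measurable
qed (rule norm_direction_le[OF t y])

lemma measurable_mean_direction:
  assumes t: "1 \<le> t" shows "mean_direction i t \<in> borel_measurable borel"
proof -
  have "(\<lambda>z. direction i t (fst z) (snd z)) \<in> borel_measurable (borel \<Otimes>\<^sub>M uniform_sphere)"
    unfolding measurable_cong_sets[OF sets_pair_measure_cong[OF refl sets_uniform_sphere] refl]
    by (rule measurable_direction[OF t]) measurable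
  then show ?thesis
    unfolding mean_direction_def
    by (intro sphere.borel_measurable_lebesgue_integral) (simp add: case_prod_unfold)
qed

lemma norm_mean_direction_le:
  assumes t: "1 \<le> t" and y: "y \<in> Xs t"
  shows "norm (mean_direction i t y) \<le> real CARD('p) * G1 + real CARD('p) * G2 * \<gamma> t * violation i t y"
proof -
  have "AE v in uniform_sphere. norm (direction i t y v) \<le> real CARD('p) * G1 + real CARD('p) * G2 * \<gamma> t * violation i t y"
    using AE_uniform_sphere by eventually_elim (rule norm_direction_le[OF t y])
  then have "(\<integral>v. norm (direction i t y v) \<partial>uniform_sphere) \<le> real CARD('p) * G1 + real CARD('p) * G2 * \<gamma> t * violation i t y"
    by (intro sphere.integral_le_const integrable_norm integrable_direction t y)
  then show ?thesis
    unfolding mean_direction_def by (rule order_trans[OF integral_norm_bound])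
qed

text \<open>The loss is smooth, so its part is a gradient up to a bias of order
  \<open>\<delta> t\<close>. For the constraints only a convexity gap is available; at
  \<open>y\<close> itself \<open>weighted_g\<close> equals \<open>\<gamma> t\<close> times the
  squared violation, which is where the quadratic term comes from.\<close>

lemma mean_direction_inner_ge:
  assumes t: "1 \<le> t" and y: "y \<in> Xs t" and y': "y' \<in> Xs t"
  shows "gradient X (f i t) y \<bullet> (y - y') - 2 * R * real CARD('p) * L * \<delta> t
      + \<gamma> t * (violation i t y)\<^sup>2 - weighted_g i t y y' - 2 * G2 * \<gamma> t * violation i t y * \<delta> t
    \<le> mean_direction i t y \<bullet> (y - y')"
proof -
  have yX: "y \<in> X" "y' \<in> X" using Xs_subset t y y' by auto
  note q = query_in_X[OF t y] query_in_X[OF t y']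
  note \<delta> = delta_pos[OF t]
  have int_f: "integrable uniform_sphere (two_point_gradient (\<delta> t) (fX i t) y)"
  proof (rule integrable_uniform_sphere_bounded[where B="real CARD('p) * G1"])
    fix v :: "real ^ 'p" assume v: "norm v = 1"
    then show "norm (two_point_gradient (\<delta> t) (fX i t) y v) \<le> real CARD('p) * G1"
      using f_lipschitz[OF t q(1)[OF v] yX(1), of i] yX q(1)[OF v] \<delta>
      by (intro norm_two_point_gradient_le[OF \<delta> v]) simp
  qed (rule borel_measurable_two_point_gradient[OF measurable_fX[OF t]])
  have int_g: "integrable uniform_sphere (two_point_gradient (\<delta> t) (weighted_g i t y) y)"
  proof (rule integrable_uniform_sphere_bounded[where B="real CARD('p) * (G2 * (\<gamma> t * violation i t y))"])
    fix v :: "real ^ 'p" assume v: "norm v = 1"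
    then show "norm (two_point_gradient (\<delta> t) (weighted_g i t y) y v) \<le> real CARD('p) * (G2 * (\<gamma> t * violation i t y))"
      using weighted_g_lipschitz'[OF t yX(1) q(1)[OF v] yX(1), of i] \<delta>
      by (intro norm_two_point_gradient_le[OF \<delta> v]) simp
  qed (rule borel_measurable_two_point_gradient[OF measurable_weighted_g[OF t]])
  have "\<bar>(\<integral>v. two_point_gradient (\<delta> t) (fX i t) y v \<bullet> (y - y') \<partial>uniform_sphere)
      - gradient X (f i t) y \<bullet> (y - y')\<bar> \<le> real CARD('p) * L * \<delta> t * norm (y - y')"
  proof (rule two_point_gradient_mean_smooth[OF measurable_fX[OF t] \<delta>])
    fix v :: "real ^ 'p" assume v: "norm v = 1"
    then show "\<bar>fX i t (y + \<delta> t *\<^sub>R v) - fX i t y - \<delta> t * (gradient X (f i t) y \<bullet> v)\<bar> \<le> L * (\<delta> t)\<^sup>2"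
      using f_taylor[OF t yX(1) q(1)[OF v], of i] q(1)[OF v] yX by simp
  qed
  moreover have "real CARD('p) * L * \<delta> t * norm (y - y') \<le> real CARD('p) * L * \<delta> t * (2 * R)"
    using L_nonneg \<delta> dist_X[OF yX] by (intro mult_left_mono) auto
  moreover have "weighted_g i t y y - weighted_g i t y y' - 2 * (G2 * (\<gamma> t * violation i t y)) * \<delta> t
      \<le> (\<integral>v. two_point_gradient (\<delta> t) (weighted_g i t y) y v \<bullet> (y - y') \<partial>uniform_sphere)"
  proof (rule two_point_gradient_mean_convex[OF measurable_weighted_g[OF t] \<delta> _ weighted_g_lipschitz'[OF t yX(1)] yX q])
    have "convex_on X (\<lambda>y'. \<Sum>k<m i. (\<gamma> t * max 0 (g i t y k)) * g i t y' k)"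
    proof -
      have "convex_on X (\<lambda>y'. \<Sum>k<j. (\<gamma> t * max 0 (g i t y k)) * g i t y' k)" if "j \<le> m i" for j
        using that
      proof (induction j)
        case (Suc j)
        then show ?case
          using g_convex[OF t, of j i] gamma_pos[OF t] by (simp add: convex_on_add convex_on_cmul)
      qed (use X(2) in \<open>simp add: convex_on_def\<close>)
      then show ?thesis by simp
    qed
    then show "convex_on X (weighted_g i t y)"
      using yX X(2) by (auto simp: convex_on_def weighted_g_def convexD)
  qed
  moreover have "weighted_g i t y y = \<gamma> t * (violation i t y)\<^sup>2"
    using yX by (simp add: weighted_g_def violation_power2 sum_distrib_left mult.assoc)
  moreover have "mean_direction i t y \<bullet> (y - y')
      = (\<integral>v. two_point_gradient (\<delta> t) (fX i t) y v \<bullet> (y - y') \<partial>uniform_sphere)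
        + (\<integral>v. two_point_gradient (\<delta> t) (weighted_g i t y) y v \<bullet> (y - y') \<partial>uniform_sphere)"
    unfolding mean_direction_def direction_eq
    using int_f int_g by (simp add: inner_add_left)
  ultimately show ?thesis by (simp add: algebra_simps)
qed

text \<open>The case \<open>\<sigma> = 0\<close> serves feasible comparators, a positive
  \<open>\<sigma>\<close> serves Slater points. Scaling the comparator moves it by at most
  \<open>\<alpha> t * R\<close>; in the constraint part this is multiplied by
  \<open>\<gamma> t\<close>, so an error proportional to the violation remains that does not fade
  with \<open>t\<close>. The two-point bias leaves an error of the same kind.\<close>

lemma mean_direction_inner_comparator:
  assumes t: "1 \<le> t" and y: "y \<in> Xs t" and y0: "y0 \<in> X" and \<sigma>: "0 \<le> \<sigma>" "\<And>k. k < m i \<Longrightarrow> g i t y0 k \<le> - \<sigma>"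
  shows "gradient X (f i t) y \<bullet> (y - y0) + \<gamma> t * (violation i t y)\<^sup>2 + \<sigma> * \<gamma> t * violation i t y
      - (2 * R * r * real CARD('p) * L + G1 * R) * \<alpha> t - G2 * \<gamma>0 * (2 * r + R) * violation i t y
    \<le> mean_direction i t y \<bullet> (y - (1 - \<xi> t) *\<^sub>R y0)"
proof -
  let ?y' = "(1 - \<xi> t) *\<^sub>R y0"
  have y': "?y' \<in> Xs t" "?y' \<in> X" and yX: "y \<in> X"
    using scaled_in_Xs[OF y0] Xs_subset t y by auto
  have \<alpha>: "0 \<le> \<alpha> t" using alpha_pos[OF t] by simp
  have dist: "norm (?y' - y0) \<le> \<alpha> t * R"
  proof -
    have "?y' - y0 = (- \<alpha> t) *\<^sub>R y0" using t by (simp add: parameters(3) algebra_simps)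
    then show ?thesis using norm_X[OF y0] \<alpha> by (simp add: mult_left_mono)
  qed
  have "\<bar>gradient X (f i t) y \<bullet> (?y' - y0)\<bar> \<le> G1 * (\<alpha> t * R)"
    using Cauchy_Schwarz_ineq2[of "gradient X (f i t) y" "?y' - y0"] dist f_grad_bound[OF t yX, of i] G1_nonneg
    by (meson mult_mono norm_ge_zero order_trans)
  then have 1: "gradient X (f i t) y \<bullet> (y - y0) - G1 * R * \<alpha> t \<le> gradient X (f i t) y \<bullet> (y - ?y')"
    by (simp add: inner_diff_right algebra_simps)
  have "weighted_g i t y y0 \<le> (\<Sum>k<m i. (\<gamma> t * max 0 (g i t y k)) * (- \<sigma>))"
    unfolding weighted_g_def gX_eq[OF yX] gX_eq[OF y0]
    using \<sigma>(2) gamma_pos[OF t] by (intro sum_mono mult_left_mono) auto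
  also have "\<dots> = - (\<sigma> * \<gamma> t * (\<Sum>k<m i. max 0 (g i t y k)))"
    by (simp add: sum_negf sum_distrib_left algebra_simps)
  \<comment> \<open>The sum of the positive parts dominates their Euclidean norm.\<close>
  also have "\<dots> \<le> - (\<sigma> * \<gamma> t * violation i t y)"
    unfolding violation_def using \<sigma> gamma_pos[OF t]
    by (intro le_imp_neg_le mult_left_mono L2_set_le_sum) auto
  finally have "weighted_g i t y y0 \<le> - (\<sigma> * \<gamma> t * violation i t y)" .
  moreover have "weighted_g i t y ?y' - weighted_g i t y y0 \<le> (G2 * (\<gamma> t * violation i t y)) * (\<alpha> t * R)"
  proof -
    have "weighted_g i t y ?y' - weighted_g i t y y0 \<le> (G2 * (\<gamma> t * violation i t y)) * norm (?y' - y0)"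
      using weighted_g_lipschitz'[OF t yX y'(2) y0, of i] by linarith
    also have "\<dots> \<le> (G2 * (\<gamma> t * violation i t y)) * (\<alpha> t * R)"
      using dist G2_pos gamma_pos[OF t] by (intro mult_left_mono) auto
    finally show ?thesis .
  qed
  moreover have "(G2 * (\<gamma> t * violation i t y)) * (\<alpha> t * R) = G2 * \<gamma>0 * R * violation i t y"
    by (simp add: gamma_alpha[OF t, symmetric])
  ultimately have 2: "weighted_g i t y ?y' \<le> G2 * \<gamma>0 * R * violation i t y - \<sigma> * \<gamma> t * violation i t y"
    by linarith
  have 3: "2 * G2 * \<gamma> t * violation i t y * \<delta> t = 2 * G2 * \<gamma>0 * r * violation i t y"
    using t by (simp add: gamma_alpha[OF t, symmetric] parameters(4))
  have 4: "2 * R * real CARD('p) * L * \<delta> t = 2 * R * r * real CARD('p) * L * \<alpha> t"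
    using t by (simp add: parameters(4))
  show ?thesis
    using mean_direction_inner_ge[OF t y y'(1), of i] 1 2 unfolding 3 4
    by (simp add: algebra_simps)
qed

section \<open>Sample paths\<close>

definition dir :: "'n \<Rightarrow> nat \<Rightarrow> 'w \<Rightarrow> real ^ 'p" where
  "dir i t \<omega> = direction i t (x i t \<omega>) (u i t \<omega>)"

definition noise :: "'n \<Rightarrow> nat \<Rightarrow> 'w \<Rightarrow> real ^ 'p" where
  "noise i t \<omega> = dir i t \<omega> - mean_direction i t (x i t \<omega>)"

definition viol :: "'n \<Rightarrow> nat \<Rightarrow> 'w \<Rightarrow> real" where
  "viol i t \<omega> = violation i t (x i t \<omega>)"

definition comp_err :: "'n \<Rightarrow> nat \<Rightarrow> 'w \<Rightarrow> real ^ 'p" where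
  "comp_err j t \<omega> = zh j t \<omega> - z j t \<omega>"

text \<open>Half of the most by which a squared distance can grow when a point at distance at most
  \<open>2 * R\<close> from the comparator is displaced by the compression error.\<close>

definition err_cost :: "nat \<Rightarrow> 'w \<Rightarrow> real" where
  "err_cost t \<omega> = (\<Sum>j\<in>UNIV. 2 * R * norm (comp_err j t \<omega>) + (norm (comp_err j t \<omega>))\<^sup>2 / 2)"

definition potential :: "real ^ 'p \<Rightarrow> nat \<Rightarrow> 'w \<Rightarrow> real" where
  "potential y t \<omega> = (\<Sum>j\<in>UNIV. (norm (x j t \<omega> - (1 - \<xi> t) *\<^sub>R y))\<^sup>2)"

lemma x_in_Xs: "1 \<le> t \<Longrightarrow> \<omega> \<in> space M \<Longrightarrow> x i t \<omega> \<in> Xs t"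
  unfolding Xs_def by (rule x_in)

lemma x_in_X: "1 \<le> t \<Longrightarrow> \<omega> \<in> space M \<Longrightarrow> x i t \<omega> \<in> X"
  using x_in_Xs Xs_subset by blast

lemma
  assumes "\<omega> \<in> space M"
  shows path_zh_0: "zh j 0 \<omega> = 0" and path_zs_0: "zs i j 0 \<omega> = 0" and path_z_1: "z i 1 \<omega> = z1 i"
  using path[OF assms] unfolding compressed_bandit_path_def by blast+

lemma
  assumes "\<omega> \<in> space M" "1 \<le> t"
  shows path_zh: "zh j t \<omega> = zh j (t - 1) \<omega> + s t *\<^sub>R Q ((z j t \<omega> - zh j (t - 1) \<omega>) /\<^sub>R s t) (c j t \<omega>)"
    and path_zs: "j \<in> (in_neighbours E t i \<inter> in_neighbours E (t - 1) i) \<union> {i} \<Longrightarrow>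
      zs i j t \<omega> = zs i j (t - 1) \<omega> + s t *\<^sub>R Q ((z j t \<omega> - zh j (t - 1) \<omega>) /\<^sub>R s t) (c j t \<omega>)"
    and path_zs_new: "j \<in> in_neighbours E t i - in_neighbours E (t - 1) i \<Longrightarrow> zs i j t \<omega> = zh j t \<omega>"
    and path_x_zs: "x i t \<omega> = (\<Sum>j\<in>UNIV. W t $ i $ j *\<^sub>R zs i j t \<omega>)"
    and path_z_bandit: "z i (Suc t) \<omega> = closest_point (Xs (Suc t))
      (x i t \<omega> - \<alpha> t *\<^sub>R bandit_direction (\<gamma> t) (\<delta> t) (f i t) (m i) (g i t) (x i t \<omega>) (u i t \<omega>))"
  using path[OF assms(1)] assms(2) unfolding compressed_bandit_path_def Xs_def Suc_eq_plus1 by blast+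

text \<open>An edge that was absent in the previous round is resynchronised explicitly; along any
  other edge both values were equal before and receive the same compressed message. Initially both
  are zero.\<close>

lemma stored_copy:
  assumes \<omega>: "\<omega> \<in> space M"
  shows "(j, i) \<in> E t \<or> i = j \<Longrightarrow> zs i j t \<omega> = zh j t \<omega>"
proof (induction t)
  case 0
  then show ?case by (simp add: path_zh_0[OF \<omega>] path_zs_0[OF \<omega>])
next
  case (Suc t)
  show ?case
  proof (cases "(j, i) \<in> E t \<or> i = j")
    case True
    then have "j \<in> (in_neighbours E (Suc t) i \<inter> in_neighbours E (Suc t - 1) i) \<union> {i}"
      using Suc.prems by (auto simp: in_neighbours_def)
    from path_zs[OF \<omega> _ this] path_zh[OF \<omega>, of "Suc t" j] Suc.IH[OF True]
    show ?thesis by simp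
  next
    case False
    then have "j \<in> in_neighbours E (Suc t) i - in_neighbours E (Suc t - 1) i"
      using Suc.prems by (auto simp: in_neighbours_def)
    from path_zs_new[OF \<omega> _ this] show ?thesis by simp
  qed
qed

text \<open>Copies that may be out of date belong to pairs without an edge, and these have weight
  zero.\<close>

lemma path_x:
  assumes "\<omega> \<in> space M" "1 \<le> t"
  shows "x i t \<omega> = mix (W t) (\<lambda>j. zh j t \<omega>) i"
  unfolding path_x_zs[OF assms] mix_def
proof (rule sum.cong[OF refl])
  fix j
  show "W t $ i $ j *\<^sub>R zs i j t \<omega> = W t $ i $ j *\<^sub>R zh j t \<omega>"
    using stored_copy[OF assms(1), of j i t] weights[OF assms(2), of j i] by (cases "(j, i) \<in> E t \<or> i = j") simp_all
qed

lemma path_z: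
  assumes \<omega>: "\<omega> \<in> space M" and t: "1 \<le> t"
  shows "z i (Suc t) \<omega> = closest_point (Xs (Suc t)) (x i t \<omega> - \<alpha> t *\<^sub>R dir i t \<omega>)"
proof -
  note [simp] = x_in_X[OF t \<omega>, of i] query_in_X[OF t x_in_Xs[OF t \<omega>] u_sphere[OF t \<omega>], of i i]
  show ?thesis
    unfolding path_z_bandit[OF \<omega> t] dir_def direction_def bandit_direction_def two_point_gradient_def by simp
qed

lemma z_in_Xs:
  assumes \<omega>: "\<omega> \<in> space M" and t: "1 \<le> t"
  shows "z i t \<omega> \<in> Xs t"
proof (cases "t = 1")
  case True
  have "z1 i \<in> Xs 1" unfolding Xs_def by (rule initial)
  then show ?thesis unfolding True path_z_1[OF \<omega>] .
next
  case False
  then obtain t' where t': "t = Suc t'" "1 \<le> t'" using t by (cases t) auto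
  show ?thesis
    unfolding t'(1) path_z[OF \<omega> t'(2)] by (rule closest_point_in_set[OF closed_Xs Xs_nonempty])
qed

lemma norm_dir_le:
  assumes \<omega>: "\<omega> \<in> space M" and t: "1 \<le> t"
  shows "norm (dir i t \<omega>) \<le> real CARD('p) * G1 + real CARD('p) * G2 * \<gamma> t * viol i t \<omega>"
  unfolding dir_def viol_def by (rule norm_direction_le[OF t x_in_Xs[OF t \<omega>] u_sphere[OF t \<omega>]])

lemma norm_noise_le:
  assumes \<omega>: "\<omega> \<in> space M" and t: "1 \<le> t"
  shows "norm (noise i t \<omega>) \<le> 2 * (real CARD('p) * G1 + real CARD('p) * G2 * \<gamma> t * viol i t \<omega>)"
proof -
  have "norm (noise i t \<omega>) \<le> norm (dir i t \<omega>) + norm (mean_direction i t (x i t \<omega>))"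
    unfolding noise_def by (rule norm_triangle_ineq4)
  also have "\<dots> \<le> (real CARD('p) * G1 + real CARD('p) * G2 * \<gamma> t * viol i t \<omega>) + (real CARD('p) * G1 + real CARD('p) * G2 * \<gamma> t * viol i t \<omega>)"
    using norm_mean_direction_le[OF t x_in_Xs[OF t \<omega>, of i], of i]
    by (intro add_mono norm_dir_le \<omega> t) (simp only: viol_def)
  finally show ?thesis by (simp only: mult_2)
qed

lemma viol_nonneg: "0 \<le> viol i t \<omega>"
  by (simp add: viol_def)

lemma viol_le: "\<omega> \<in> space M \<Longrightarrow> 1 \<le> t \<Longrightarrow> viol i t \<omega> \<le> 2 * R * G2"
  unfolding viol_def by (rule violation_le[OF _ x_in_X])

lemma potential_nonneg: "0 \<le> potential y t \<omega>"
  by (simp add: potential_def sum_nonneg)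

lemma potential_le:
  assumes "\<omega> \<in> space M" "1 \<le> t" "y \<in> X"
  shows "potential y t \<omega> \<le> real CARD('n) * (4 * R\<^sup>2)"
proof -
  have "(norm (x j t \<omega> - (1 - \<xi> t) *\<^sub>R y))\<^sup>2 \<le> (2 * R)\<^sup>2" for j
    using x_in_X[OF assms(2,1)] Xs_subset[OF assms(2)] scaled_in_Xs[OF assms(3)]
    by (intro power_mono dist_X) auto
  then have "potential y t \<omega> \<le> (\<Sum>j\<in>(UNIV :: 'n set). (2 * R)\<^sup>2)"
    unfolding potential_def by (intro sum_mono)
  then show ?thesis by (simp add: power_mult_distrib)
qed

section \<open>Descent of the potential\<close>

lemma projection_step:
  assumes \<omega>: "\<omega> \<in> space M" and t: "1 \<le> t" and y: "y \<in> Xs (Suc t)"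
  shows "(norm (z i (Suc t) \<omega> - y))\<^sup>2 \<le> (norm (x i t \<omega> - y))\<^sup>2 - 2 * \<alpha> t * (dir i t \<omega> \<bullet> (x i t \<omega> - y))
      + (\<alpha> t)\<^sup>2 * (norm (dir i t \<omega>))\<^sup>2"
proof -
  have "norm (closest_point (Xs (Suc t)) (x i t \<omega> - \<alpha> t *\<^sub>R dir i t \<omega>) - closest_point (Xs (Suc t)) y)
      \<le> norm ((x i t \<omega> - \<alpha> t *\<^sub>R dir i t \<omega>) - y)"
    using closest_point_lipschitz[OF convex_Xs closed_Xs Xs_nonempty] by (simp only: dist_norm)
  then have "norm (z i (Suc t) \<omega> - y) \<le> norm ((x i t \<omega> - y) - \<alpha> t *\<^sub>R dir i t \<omega>)"
    unfolding closest_point_self[OF y] path_z[OF \<omega> t, symmetric] by (simp add: algebra_simps)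
  then have "(norm (z i (Suc t) \<omega> - y))\<^sup>2 \<le> (norm ((x i t \<omega> - y) - \<alpha> t *\<^sub>R dir i t \<omega>))\<^sup>2"
    by (intro power_mono) auto
  also have "\<dots> = (norm (x i t \<omega> - y))\<^sup>2 - 2 * \<alpha> t * (dir i t \<omega> \<bullet> (x i t \<omega> - y)) + (\<alpha> t)\<^sup>2 * (norm (dir i t \<omega>))\<^sup>2"
    unfolding power2_norm_eq_inner
    by (simp add: inner_diff_left inner_diff_right inner_commute power2_eq_square algebra_simps)
  finally show ?thesis .
qed

text \<open>The loss part of a step shrinks with \<open>\<alpha> t\<close>, but in the constraint
  part \<open>\<alpha> t * \<gamma> t\<close> is the constant \<open>\<gamma>0\<close>. This is why
  the consensus error has to be charged to the violation.\<close>

lemma norm_z_minus_x_le: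
  assumes \<omega>: "\<omega> \<in> space M" and t: "1 \<le> t"
  shows "norm (z i (Suc t) \<omega> - x i t \<omega>) \<le> real CARD('p) * G1 * \<alpha> t + real CARD('p) * G2 * \<gamma>0 * viol i t \<omega>"
proof -
  have x: "x i t \<omega> \<in> Xs (Suc t)" using x_in_Xs[OF t \<omega>] Xs_mono[OF t] by auto
  have "norm (closest_point (Xs (Suc t)) (x i t \<omega> - \<alpha> t *\<^sub>R dir i t \<omega>) - closest_point (Xs (Suc t)) (x i t \<omega>))
      \<le> norm ((x i t \<omega> - \<alpha> t *\<^sub>R dir i t \<omega>) - x i t \<omega>)"
    using closest_point_lipschitz[OF convex_Xs closed_Xs Xs_nonempty] by (simp only: dist_norm)
  then have "norm (z i (Suc t) \<omega> - x i t \<omega>) \<le> \<alpha> t * norm (dir i t \<omega>)"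
    unfolding closest_point_self[OF x] path_z[OF \<omega> t, symmetric] using alpha_pos[OF t] by simp
  also have "\<dots> \<le> \<alpha> t * (real CARD('p) * G1 + real CARD('p) * G2 * \<gamma> t * viol i t \<omega>)"
    using norm_dir_le[OF \<omega> t] alpha_pos[OF t] by (intro mult_left_mono) auto
  also have "\<dots> = real CARD('p) * G1 * \<alpha> t + real CARD('p) * G2 * \<gamma>0 * viol i t \<omega>"
    unfolding gamma_alpha[OF t, symmetric] by (simp add: algebra_simps)
  finally show ?thesis .
qed

text \<open>The step is measured against the comparator of round \<open>t\<close>, the new potential
  against that of round \<open>Suc t\<close>. Factoring the difference of squares prices this shift
  at \<open>4 * R^2\<close> times the decrease of \<open>\<alpha>\<close>. Mixing comes after
  compression, so the errors are added before the squared distances are averaged.\<close>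

lemma potential_step:
  assumes \<omega>: "\<omega> \<in> space M" and t: "1 \<le> t" and y: "y \<in> X"
  shows "potential y (Suc t) \<omega> \<le> potential y t \<omega>
    - 2 * \<alpha> t * (\<Sum>j\<in>UNIV. dir j t \<omega> \<bullet> (x j t \<omega> - (1 - \<xi> t) *\<^sub>R y))
    + (\<alpha> t)\<^sup>2 * (\<Sum>j\<in>UNIV. (norm (dir j t \<omega>))\<^sup>2) + 4 * R\<^sup>2 * real CARD('n) * (\<alpha> t - \<alpha> (Suc t)) + 2 * err_cost (Suc t) \<omega>"
proof -
  let ?y = "(1 - \<xi> t) *\<^sub>R y" and ?y' = "(1 - \<xi> (Suc t)) *\<^sub>R y"
  have y_in: "?y \<in> Xs (Suc t)" "?y' \<in> Xs (Suc t)"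
    using scaled_in_Xs[OF y] Xs_mono[OF t] by auto
  have sub: "Xs (Suc t) \<subseteq> X" by (rule Xs_subset) simp
  have \<alpha>: "0 \<le> \<alpha> t - \<alpha> (Suc t)" using alpha_antimono[OF t, of "Suc t"] by simp
  have shift: "norm (?y - ?y') \<le> (\<alpha> t - \<alpha> (Suc t)) * R"
  proof -
    have "?y - ?y' = (\<alpha> (Suc t) - \<alpha> t) *\<^sub>R y"
      using t by (simp add: parameters(3) algebra_simps)
    then show ?thesis using norm_X[OF y] \<alpha> by (simp add: mult_left_mono abs_minus_commute)
  qed
  have step: "(norm (zh j (Suc t) \<omega> - ?y'))\<^sup>2 \<le> (norm (z j (Suc t) \<omega> - ?y))\<^sup>2 + 4 * R\<^sup>2 * (\<alpha> t - \<alpha> (Suc t))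
      + (4 * R * norm (comp_err j (Suc t) \<omega>) + (norm (comp_err j (Suc t) \<omega>))\<^sup>2)" for j
  proof -
    let ?a = "z j (Suc t) \<omega> - ?y'" and ?b = "z j (Suc t) \<omega> - ?y" and ?e = "comp_err j (Suc t) \<omega>"
    have zX: "z j (Suc t) \<omega> \<in> X" using z_in_Xs[OF \<omega>, of "Suc t" j] sub by auto
    have ab: "norm ?a \<le> 2 * R" "norm ?b \<le> 2 * R"
      using dist_X[OF zX] y_in sub by auto
    have "norm ?a - norm ?b \<le> norm (?a - ?b)" by (rule norm_triangle_ineq2)
    also have "?a - ?b = ?y - ?y'" by simp
    finally have diff: "norm ?a - norm ?b \<le> (\<alpha> t - \<alpha> (Suc t)) * R" using shift by linarith
    have "(norm ?a)\<^sup>2 - (norm ?b)\<^sup>2 = (norm ?a - norm ?b) * (norm ?a + norm ?b)"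
      by (simp add: power2_eq_square algebra_simps)
    also have "\<dots> \<le> ((\<alpha> t - \<alpha> (Suc t)) * R) * (4 * R)"
      using diff ab \<alpha> X(4) by (intro mult_mono) auto
    finally have a: "(norm ?a)\<^sup>2 \<le> (norm ?b)\<^sup>2 + 4 * R\<^sup>2 * (\<alpha> t - \<alpha> (Suc t))"
      by (simp add: power2_eq_square algebra_simps)
    have "norm (zh j (Suc t) \<omega> - ?y') \<le> norm ?a + norm ?e"
      using norm_triangle_ineq[of ?a ?e] by (simp add: comp_err_def)
    then have "(norm (zh j (Suc t) \<omega> - ?y'))\<^sup>2 \<le> (norm ?a + norm ?e)\<^sup>2"
      by (intro power_mono) auto
    also have "\<dots> = (norm ?a)\<^sup>2 + (2 * norm ?a * norm ?e + (norm ?e)\<^sup>2)"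
      by (simp add: power2_sum)
    also have "2 * norm ?a * norm ?e \<le> 4 * R * norm ?e"
      using ab by (intro mult_right_mono) auto
    finally show ?thesis using a by linarith
  qed
  have "potential y (Suc t) \<omega> \<le> (\<Sum>j\<in>UNIV. (norm (zh j (Suc t) \<omega> - ?y'))\<^sup>2)"
    unfolding potential_def path_x[OF \<omega> le_SucI[OF t]]
    by (rule sum_norm_mix_diff_power2_le[OF doubly_stochastic]) simp_all
  also have "\<dots> \<le> (\<Sum>j\<in>UNIV. (norm (x j t \<omega> - ?y))\<^sup>2 - 2 * \<alpha> t * (dir j t \<omega> \<bullet> (x j t \<omega> - ?y))
      + (\<alpha> t)\<^sup>2 * (norm (dir j t \<omega>))\<^sup>2 + 4 * R\<^sup>2 * (\<alpha> t - \<alpha> (Suc t))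
      + (4 * R * norm (comp_err j (Suc t) \<omega>) + (norm (comp_err j (Suc t) \<omega>))\<^sup>2))"
    by (intro sum_mono order_trans[OF step] add_right_mono projection_step[OF \<omega> t y_in(1)])
  also have "\<dots> = potential y t \<omega>
      - 2 * \<alpha> t * (\<Sum>j\<in>UNIV. dir j t \<omega> \<bullet> (x j t \<omega> - ?y))
      + (\<alpha> t)\<^sup>2 * (\<Sum>j\<in>UNIV. (norm (dir j t \<omega>))\<^sup>2) + 4 * R\<^sup>2 * real CARD('n) * (\<alpha> t - \<alpha> (Suc t)) + 2 * err_cost (Suc t) \<omega>"
  proof -
    have "2 * err_cost (Suc t) \<omega> = (\<Sum>j\<in>UNIV. 4 * R * norm (comp_err j (Suc t) \<omega>) + (norm (comp_err j (Suc t) \<omega>))\<^sup>2)"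
      unfolding err_cost_def sum_distrib_left by (intro sum.cong refl) simp
    moreover have "4 * R\<^sup>2 * real CARD('n) * (\<alpha> t - \<alpha> (Suc t)) = (\<Sum>j\<in>(UNIV :: 'n set). 4 * R\<^sup>2 * (\<alpha> t - \<alpha> (Suc t)))"
      by simp
    ultimately show ?thesis
      unfolding potential_def sum_distrib_left by (simp only: sum.distrib sum_subtractf)
  qed
  finally show ?thesis .
qed

text \<open>In the constraint part one factor \<open>\<alpha> t\<close> cancels one of the two
  factors \<open>\<gamma> t\<close>, and the bound on \<open>\<gamma>0\<close> turns what remains
  into a quarter of the quadratic term.\<close>

lemma alpha_norm_dir_power2_le:
  assumes \<omega>: "\<omega> \<in> space M" and t: "1 \<le> t"
  shows "\<alpha> t * (norm (dir i t \<omega>))\<^sup>2 / 2 \<le> (real CARD('p))\<^sup>2 * G1\<^sup>2 * \<alpha> t + \<gamma> t * (viol i t \<omega>)\<^sup>2 / 4"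
proof -
  let ?a = "real CARD('p) * G1" and ?b = "real CARD('p) * G2 * \<gamma> t * viol i t \<omega>"
  have "(norm (dir i t \<omega>))\<^sup>2 \<le> (?a + ?b)\<^sup>2"
    using norm_dir_le[OF assms] by (intro power_mono) auto
  also have "\<dots> \<le> 2 * ?a\<^sup>2 + 2 * ?b\<^sup>2"
    using sum_squares_bound[of ?a ?b] by (simp add: power2_sum)
  finally have "\<alpha> t * (norm (dir i t \<omega>))\<^sup>2 / 2 \<le> \<alpha> t * (2 * ?a\<^sup>2 + 2 * ?b\<^sup>2) / 2"
    using alpha_pos[OF t] by (intro divide_right_mono mult_left_mono) auto
  also have "\<dots> = (real CARD('p))\<^sup>2 * G1\<^sup>2 * \<alpha> t + ((real CARD('p))\<^sup>2 * G2\<^sup>2 * (\<gamma> t * \<alpha> t)) * (\<gamma> t * (viol i t \<omega>)\<^sup>2)"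
    by (simp add: power_mult_distrib power2_eq_square algebra_simps)
  also have "((real CARD('p))\<^sup>2 * G2\<^sup>2 * (\<gamma> t * \<alpha> t)) * (\<gamma> t * (viol i t \<omega>)\<^sup>2) \<le> (1 / 4) * (\<gamma> t * (viol i t \<omega>)\<^sup>2)"
    unfolding gamma_alpha[OF t] using gamma0_le gamma_pos[OF t] by (intro mult_right_mono) auto
  finally show ?thesis by simp
qed

text \<open>In \<open>c1\<close> the summands are the second moment of the loss estimate, its bias,
  and the scaling of the comparator; \<open>c2\<close> is half of the shift cost in
  \<open>potential_step\<close>, and also half of the largest potential; in \<open>c3\<close> the
  part with \<open>2 * r\<close> is the two-point bias of the constraints and the part with
  \<open>R\<close> the scaling of the comparator.\<close>

definition c1 :: real where "c1 = real CARD('n) * ((real CARD('p))\<^sup>2 * G1\<^sup>2 + 2 * R * r * real CARD('p) * L + G1 * R)"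
definition c2 :: real where "c2 = 2 * R\<^sup>2 * real CARD('n)"
definition c3 :: real where "c3 = G2 * \<gamma>0 * (2 * r + R)"

lemma c_nonneg: "0 \<le> c1" "0 \<le> c2" "0 \<le> c3"
  using X(3,4) G1_nonneg G2_pos L_nonneg gamma0_pos by (simp_all add: c1_def c2_def c3_def)

text \<open>The coefficient 3/4 is what the second moment of the step leaves of the quadratic term.
  The inequality keeps the factor \<open>\<alpha> t\<close>, since one application divides by it
  before summing and the other, at a Slater point, sums it as it stands.\<close>

lemma descent:
  assumes \<omega>: "\<omega> \<in> space M" and t: "1 \<le> t" and y: "y \<in> X" and \<sigma>: "0 \<le> \<sigma>" "\<And>i k. k < m i \<Longrightarrow> g i t y k \<le> - \<sigma>"
  shows "\<alpha> t * (\<Sum>j\<in>UNIV. gradient X (f j t) (x j t \<omega>) \<bullet> (x j t \<omega> - y) + 3 / 4 * (\<gamma> t * (viol j t \<omega>)\<^sup>2) + \<sigma> * \<gamma> t * viol j t \<omega>)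
    \<le> (potential y t \<omega> - potential y (Suc t) \<omega>) / 2 + c1 * (\<alpha> t)\<^sup>2 + c2 * (\<alpha> t - \<alpha> (Suc t)) + err_cost (Suc t) \<omega>
      + \<alpha> t * (c3 * (\<Sum>j\<in>UNIV. viol j t \<omega>)) - \<alpha> t * (\<Sum>j\<in>UNIV. noise j t \<omega> \<bullet> (x j t \<omega> - (1 - \<xi> t) *\<^sub>R y))"
proof -
  let ?y = "(1 - \<xi> t) *\<^sub>R y"
  have each: "gradient X (f j t) (x j t \<omega>) \<bullet> (x j t \<omega> - y) + 3 / 4 * (\<gamma> t * (viol j t \<omega>)\<^sup>2) + \<sigma> * \<gamma> t * viol j t \<omega>
      \<le> dir j t \<omega> \<bullet> (x j t \<omega> - ?y) - \<alpha> t * (norm (dir j t \<omega>))\<^sup>2 / 2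
        + ((real CARD('p))\<^sup>2 * G1\<^sup>2 + 2 * R * r * real CARD('p) * L + G1 * R) * \<alpha> t + c3 * viol j t \<omega> - noise j t \<omega> \<bullet> (x j t \<omega> - ?y)" for j
  proof -
    have "mean_direction j t (x j t \<omega>) \<bullet> (x j t \<omega> - ?y)
        = dir j t \<omega> \<bullet> (x j t \<omega> - ?y) - noise j t \<omega> \<bullet> (x j t \<omega> - ?y)"
      by (simp add: noise_def inner_diff_left)
    then show ?thesis
      using mean_direction_inner_comparator[OF t x_in_Xs[OF t \<omega>, of j] y \<sigma>, of j] alpha_norm_dir_power2_le[OF \<omega> t, of j]
      unfolding viol_def c3_def by (simp add: algebra_simps)
  qed
  have "(\<Sum>j\<in>UNIV. gradient X (f j t) (x j t \<omega>) \<bullet> (x j t \<omega> - y) + 3 / 4 * (\<gamma> t * (viol j t \<omega>)\<^sup>2) + \<sigma> * \<gamma> t * viol j t \<omega>)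
      \<le> (\<Sum>j\<in>UNIV. dir j t \<omega> \<bullet> (x j t \<omega> - ?y) - \<alpha> t * (norm (dir j t \<omega>))\<^sup>2 / 2
        + ((real CARD('p))\<^sup>2 * G1\<^sup>2 + 2 * R * r * real CARD('p) * L + G1 * R) * \<alpha> t + c3 * viol j t \<omega> - noise j t \<omega> \<bullet> (x j t \<omega> - ?y))"
    by (intro sum_mono each)
  also have "\<dots> = (\<Sum>j\<in>UNIV. dir j t \<omega> \<bullet> (x j t \<omega> - ?y)) - \<alpha> t / 2 * (\<Sum>j\<in>UNIV. (norm (dir j t \<omega>))\<^sup>2)
        + c1 * \<alpha> t + c3 * (\<Sum>j\<in>UNIV. viol j t \<omega>) - (\<Sum>j\<in>UNIV. noise j t \<omega> \<bullet> (x j t \<omega> - ?y))"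
    by (simp add: sum.distrib sum_subtractf sum_distrib_left c1_def)
  finally have "\<alpha> t * (\<Sum>j\<in>UNIV. gradient X (f j t) (x j t \<omega>) \<bullet> (x j t \<omega> - y) + 3 / 4 * (\<gamma> t * (viol j t \<omega>)\<^sup>2) + \<sigma> * \<gamma> t * viol j t \<omega>)
      \<le> \<alpha> t * \<dots>"
    using alpha_pos[OF t] by (intro mult_left_mono) auto
  moreover have "4 * R\<^sup>2 * real CARD('n) * (\<alpha> t - \<alpha> (Suc t)) = 2 * (c2 * (\<alpha> t - \<alpha> (Suc t)))"
    by (simp add: c2_def)
  moreover have "lhs \<le> (pot - pot') / 2 + k * a\<^sup>2 + d' + e + a * sv - a * sN"
    if "lhs \<le> a * (sd - a / 2 * sn + k * a + sv - sN)" "d = 2 * d'"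
      "pot' \<le> pot - 2 * a * sd + a\<^sup>2 * sn + d + 2 * e"
    for lhs a sd sn k sv sN d d' pot pot' e :: real
  proof -
    have "a * (sd - a / 2 * sn + k * a + sv - sN) = a * sd - a\<^sup>2 * sn / 2 + k * a\<^sup>2 + a * sv - a * sN"
      "2 * a * sd = 2 * (a * sd)"
      by (simp_all add: power2_eq_square algebra_simps)
    then show ?thesis using that by argo
  qed
  ultimately show ?thesis
    using potential_step[OF \<omega> t y] by blast
qed

section \<open>Consensus error along a path\<close>

definition c4 :: real where "c4 = real CARD('n) * w ^ (CARD('n) * B)"
definition c5 :: real where "c5 = real (CARD('n) * B)"

lemma c4_pos: "0 < c4"
  using w by (simp add: c4_def)

text \<open>A round displaces \<open>x j t\<close> to \<open>zh j (Suc t)\<close> and then mixes.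
  The displacement is a projected step plus a compression error, so \<open>consensus\<close> is the
  perturbed mixing estimate with these lengths inserted.\<close>

lemma consensus:
  assumes \<omega>: "\<omega> \<in> space M"
  shows "c4 * (\<Sum>t=1..T. diam (\<lambda>i. x i t \<omega>)) \<le> c5 * (2 * R) + 2 * c5 * (\<Sum>t=1..T. \<Sum>j\<in>UNIV.
      real CARD('p) * G1 * \<alpha> t + real CARD('p) * G2 * \<gamma>0 * viol j t \<omega> + norm (comp_err j (Suc t) \<omega>))"
proof -
  define q where "q t j = z j (Suc t) \<omega> + comp_err j (Suc t) \<omega> - x j t \<omega>" for t j
  have "c4 * (\<Sum>t=1..T. diam (\<lambda>i. x i t \<omega>)) \<le> c5 * (2 * R) + 2 * c5 * (\<Sum>t=1..T. \<Sum>j\<in>UNIV. norm (q t j))"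
    unfolding c4_def c5_def
  proof (rule sum_diam_perturbed_mix[where E=E])
    show "x i (Suc k) \<omega> = mix (W (Suc k)) (\<lambda>j. x j k \<omega> + q k j) i" for k i
      by (subst path_x[OF \<omega>]) (simp_all add: q_def comp_err_def)
    show "diam (\<lambda>i. x i t \<omega>) \<le> 2 * R" if "1 \<le> t" for t
      by (intro diam_le dist_X x_in_X[OF that \<omega>])
    show "w \<le> W t $ i $ j" if "1 \<le> t" "(j, i) \<in> E t \<or> i = j" for t i j
      using weights[OF that(1), of j i] that(2) by simp
    show "strongly_connected (\<Union>l\<in>{0..B - 1}. E (t + l))" if "1 \<le> t" for t
      by (rule connected(2)[OF that])
  qed (use w connected(1) doubly_stochastic in simp_all)
  also have "\<dots> \<le> c5 * (2 * R) + 2 * c5 * (\<Sum>t=1..T. \<Sum>j\<in>UNIV.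
      real CARD('p) * G1 * \<alpha> t + real CARD('p) * G2 * \<gamma>0 * viol j t \<omega> + norm (comp_err j (Suc t) \<omega>))"
  proof (intro add_left_mono mult_left_mono sum_mono)
    fix t j assume "t \<in> {1..T}"
    then have t: "1 \<le> t" by simp
    have "norm (q t j) \<le> norm (z j (Suc t) \<omega> - x j t \<omega>) + norm (comp_err j (Suc t) \<omega>)"
      using norm_triangle_ineq[of "z j (Suc t) \<omega> - x j t \<omega>" "comp_err j (Suc t) \<omega>"]
      by (simp add: q_def algebra_simps)
    then show "norm (q t j) \<le> real CARD('p) * G1 * \<alpha> t + real CARD('p) * G2 * \<gamma>0 * viol j t \<omega> + norm (comp_err j (Suc t) \<omega>)"
      using norm_z_minus_x_le[OF \<omega> t, of j] by linarith
  qed (simp add: c5_def)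
  finally show ?thesis .
qed

section \<open>The inputs on which the iterates depend\<close>

definition past :: "nat \<Rightarrow> (('n \<times> nat) \<times> bool) set" where
  "past t = {((i, k), b). 1 \<le> k \<and> k < t}"

text \<open>Compression in round \<open>t\<close> precedes the draw of the directions:
  \<open>x i t\<close> depends on the compressor calls of round \<open>t\<close> but not on
  \<open>u i t\<close>, which is therefore still fresh.\<close>

definition now :: "nat \<Rightarrow> (('n \<times> nat) \<times> bool) set" where
  "now t = past t \<union> {((i, k), b). k = t \<and> \<not> b}"

lemma past_subset: "past t \<subseteq> (UNIV \<times> {1..}) \<times> UNIV" and now_subset: "1 \<le> t \<Longrightarrow> now t \<subseteq> (UNIV \<times> {1..}) \<times> UNIV"
  by (auto simp: past_def now_def)

lemma past_now: "past t \<subseteq> now t" and now_past: "1 \<le> t \<Longrightarrow> t < t' \<Longrightarrow> now t \<subseteq> past t'"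
  by (auto simp: past_def now_def)

lemma measurable_now_zh:
  assumes t: "1 \<le> t"
    and z: "z i t \<in> borel_measurable (inputs (past t))" and zh: "zh i (t - 1) \<in> borel_measurable (inputs (past t))"
  shows "zh i t \<in> borel_measurable (inputs (now t))"
proof -
  have zn: "z i t \<in> borel_measurable (inputs (now t))" "zh i (t - 1) \<in> borel_measurable (inputs (now t))"
    using z zh past_now by (auto intro: measurable_inputs_mono)
  \<comment> \<open>\<open>Q\<close> is jointly measurable only over \<open>Y\<close>, so its
    argument has to be a measurable map into the restricted space.\<close>
  have Y: "(\<lambda>\<omega>. (z i t \<omega> - zh i (t - 1) \<omega>) /\<^sub>R s t) \<in> inputs (now t) \<rightarrow>\<^sub>M restrict_space borel Y"
    using zn args_in[OF t, of _ i] by (intro measurable_restrict_space2) auto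
  have c: "c i t \<in> inputs (now t) \<rightarrow>\<^sub>M K"
    using t by (intro measurable_inputs_c) (auto simp: now_def)
  have "(\<lambda>(y, k). Q y k) \<in> borel_measurable (restrict_space borel Y \<Otimes>\<^sub>M K)"
    using compressor(2) by (simp only: bounded_error_compressor_def)
  from measurable_compose[OF measurable_Pair[OF Y c] this]
  have "(\<lambda>\<omega>. zh i (t - 1) \<omega> + s t *\<^sub>R Q ((z i t \<omega> - zh i (t - 1) \<omega>) /\<^sub>R s t) (c i t \<omega>)) \<in> borel_measurable (inputs (now t))"
    using zn(2) by (intro borel_measurable_add borel_measurable_scaleR borel_measurable_const) simp_all
  then show ?thesis
    by (rule measurable_cong[THEN iffD2, rotated]) (simp only: space_inputs path_zh[OF _ t])
qed

lemma measurable_now_x: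
  assumes t: "1 \<le> t" and zh: "\<And>i. zh i t \<in> borel_measurable (inputs (now t))"
  shows "x i t \<in> borel_measurable (inputs (now t))"
proof -
  have "(\<lambda>\<omega>. \<Sum>j\<in>UNIV. W t $ i $ j *\<^sub>R zh j t \<omega>) \<in> borel_measurable (inputs (now t))"
    by (intro borel_measurable_sum borel_measurable_scaleR borel_measurable_const zh)
  then show ?thesis
    by (rule measurable_cong[THEN iffD2, rotated]) (simp only: space_inputs path_x[OF _ t] mix_def)
qed

lemma measurable_next_dir:
  assumes t: "1 \<le> t" and x: "x i t \<in> borel_measurable (inputs (now t))"
  shows "dir i t \<in> borel_measurable (inputs (past (Suc t)))"
  unfolding dir_def
  using t by (intro measurable_direction measurable_inputs_u measurable_inputs_mono[OF x now_past]) (auto simp: past_def)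

lemma measurable_next_z:
  assumes t: "1 \<le> t" and x: "x i t \<in> borel_measurable (inputs (now t))"
  shows "z i (Suc t) \<in> borel_measurable (inputs (past (Suc t)))"
proof -
  have "(\<lambda>\<omega>. x i t \<omega> - \<alpha> t *\<^sub>R dir i t \<omega>) \<in> borel_measurable (inputs (past (Suc t)))"
    by (intro borel_measurable_diff borel_measurable_scaleR borel_measurable_const measurable_next_dir
        measurable_inputs_mono[OF x now_past] t x lessI)
  moreover have "closest_point (Xs (Suc t)) \<in> borel_measurable borel"
    by (intro borel_measurable_continuous_onI continuous_on_closest_point convex_Xs closed_Xs Xs_nonempty)
  ultimately have "(\<lambda>\<omega>. closest_point (Xs (Suc t)) (x i t \<omega> - \<alpha> t *\<^sub>R dir i t \<omega>)) \<in> borel_measurable (inputs (past (Suc t)))"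
    by (rule measurable_compose)
  then show ?thesis
    by (rule measurable_cong[THEN iffD2, rotated]) (simp only: space_inputs path_z[OF _ t])
qed

text \<open>The iterates are given only by pointwise recursions on \<open>space M\<close>. This
  induction over rounds makes them random variables and at the same time shows which inputs they
  use.\<close>

lemma measurable_past:
  "1 \<le> t \<Longrightarrow> (\<forall>i. z i t \<in> borel_measurable (inputs (past t)) \<and> zh i (t - 1) \<in> borel_measurable (inputs (past t)))"
proof (induction t rule: nat_induct_at_least)
  case base
  have "z i 1 \<in> borel_measurable (inputs (past 1))" for i
    by (rule measurable_cong[THEN iffD2, OF _ borel_measurable_const[of "z1 i"]]) (simp only: space_inputs path_z_1)
  moreover have "zh i (1 - 1) \<in> borel_measurable (inputs (past 1))" for i
    by (rule measurable_cong[THEN iffD2, OF _ borel_measurable_const[of 0]]) (simp add: path_zh_0)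
  ultimately show ?case by blast
next
  case (Suc t)
  then have zh: "zh i t \<in> borel_measurable (inputs (now t))" for i
    by (intro measurable_now_zh) auto
  then have "z i (Suc t) \<in> borel_measurable (inputs (past (Suc t)))" for i
    using Suc.hyps by (intro measurable_next_z measurable_now_x) auto
  moreover have "zh i (Suc t - 1) \<in> borel_measurable (inputs (past (Suc t)))" for i
    using zh now_past[of t "Suc t"] Suc.hyps by (auto intro: measurable_inputs_mono)
  ultimately show ?case by blast
qed

lemma
  assumes t: "1 \<le> t"
  shows measurable_z_past: "z i t \<in> borel_measurable (inputs (past t))"
    and measurable_zh_past: "zh i (t - 1) \<in> borel_measurable (inputs (past t))"
    and measurable_zh: "zh i t \<in> borel_measurable (inputs (now t))"
    and measurable_x: "x i t \<in> borel_measurable (inputs (now t))"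
    and measurable_dir: "dir i t \<in> borel_measurable (inputs (past (Suc t)))"
proof -
  show z: "z i t \<in> borel_measurable (inputs (past t))" and zh: "zh i (t - 1) \<in> borel_measurable (inputs (past t))" for i
    using measurable_past[OF t] by auto
  show zh': "zh i t \<in> borel_measurable (inputs (now t))" for i
    by (intro measurable_now_zh t z zh)
  show x: "x i t \<in> borel_measurable (inputs (now t))" for i
    by (intro measurable_now_x t zh')
  show "dir i t \<in> borel_measurable (inputs (past (Suc t)))"
    by (intro measurable_next_dir t x)
qed

section \<open>Moments of the compression error and of the noise\<close>

lemma integrable_bounded:
  fixes h :: "'w \<Rightarrow> 'b::{banach, second_countable_topology}"
  assumes "h \<in> borel_measurable M" "\<And>\<omega>. \<omega> \<in> space M \<Longrightarrow> norm (h \<omega>) \<le> b"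
  shows "integrable M h"
  using assms by (intro integrable_const_bound[where B=b] AE_I2)

lemma
  assumes t: "1 \<le> t"
  shows measurable_now_imp_M: "h \<in> inputs (now t) \<rightarrow>\<^sub>M N \<Longrightarrow> h \<in> M \<rightarrow>\<^sub>M N"
    and measurable_past_imp_M: "h \<in> inputs (past t) \<rightarrow>\<^sub>M N \<Longrightarrow> h \<in> M \<rightarrow>\<^sub>M N"
  using measurable_inputs_imp_measurable[OF _ now_subset[OF t]] measurable_inputs_imp_measurable[OF _ past_subset]
  by blast+

lemma measurable_x_M: "1 \<le> t \<Longrightarrow> x i t \<in> borel_measurable M"
  by (rule measurable_now_imp_M[OF _ measurable_x])

lemma measurable_noise: assumes t: "1 \<le> t" shows "noise i t \<in> borel_measurable (inputs (past (Suc t)))"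
  unfolding noise_def
  by (intro borel_measurable_diff measurable_dir t measurable_compose[OF _ measurable_mean_direction]
      measurable_inputs_mono[OF measurable_x now_past] lessI)

lemma measurable_noise_M: assumes t: "1 \<le> t" shows "noise i t \<in> borel_measurable M"
  by (rule measurable_past_imp_M[OF _ measurable_noise[OF t]]) simp

lemma measurable_violation_X:
  assumes t: "1 \<le> t" and h: "h \<in> borel_measurable N" "\<And>\<omega>. \<omega> \<in> space N \<Longrightarrow> h \<omega> \<in> X"
  shows "(\<lambda>\<omega>. violation i t (h \<omega>)) \<in> borel_measurable N"
proof -
  have "(\<lambda>\<omega>. \<Sum>k<m i. (max 0 (gX i t (h \<omega>) k))\<^sup>2) \<in> borel_measurable N"
    using t by (intro borel_measurable_sum borel_measurable_power borel_measurable_max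
        borel_measurable_const measurable_compose[OF h(1) measurable_gX]) auto
  then have "(\<lambda>\<omega>. sqrt (\<Sum>k<m i. (max 0 (gX i t (h \<omega>) k))\<^sup>2)) \<in> borel_measurable N"
    by (rule measurable_compose) measurable
  then show ?thesis
    by (rule measurable_cong[THEN iffD2, rotated]) (simp add: violation_def L2_set_def h(2))
qed

lemma measurable_viol: "1 \<le> t \<Longrightarrow> viol i t \<in> borel_measurable M"
  unfolding viol_def by (intro measurable_violation_X measurable_x_M x_in_X)

lemma integrable_viol: "1 \<le> t \<Longrightarrow> integrable M (viol i t)"
  using viol_le viol_nonneg by (intro integrable_bounded[where b="2 * R * G2"] measurable_viol) auto

lemma integrable_viol_power2: "1 \<le> t \<Longrightarrow> integrable M (\<lambda>\<omega>. (viol i t \<omega>)\<^sup>2)"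
proof (rule integrable_bounded[where b="(2 * R * G2)\<^sup>2"])
  fix \<omega> assume "1 \<le> t" "\<omega> \<in> space M"
  then show "norm ((viol i t \<omega>)\<^sup>2) \<le> (2 * R * G2)\<^sup>2"
    using viol_le[of \<omega> t i] viol_nonneg[of i t \<omega>] by (simp add: power_mono)
qed (intro borel_measurable_power measurable_viol)

lemma measurable_comp_err: "1 \<le> t \<Longrightarrow> comp_err i t \<in> borel_measurable M"
  unfolding comp_err_def
  by (intro borel_measurable_diff measurable_now_imp_M[OF _ measurable_zh] measurable_past_imp_M[OF _ measurable_z_past])

lemma s_pos: "1 \<le> t \<Longrightarrow> 0 < s t"
  using constants(5) by (simp add: parameters(5))

text \<open>The decay \<open>1 / t\<close> is what the rates need: divided by
  \<open>\<alpha> t\<close> it still sums to order \<open>T powr \<theta>1\<close>.\<close>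

lemma s_le: assumes t: "1 \<le> t" shows "s t \<le> s0 / real t"
proof -
  have "real t powr 1 \<le> real t powr \<theta>2"
    using t constants(6) by (intro powr_mono) auto
  then show ?thesis
    using t constants(5) by (simp add: parameters(5) divide_left_mono)
qed

text \<open>The argument of the compressor is determined by the past and its randomness is fresh, so
  the bound \<open>C\<close> for fixed arguments can be averaged. Rescaling by \<open>s t\<close>
  puts the factor \<open>(s t)^2\<close> in front.\<close>

lemma comp_err_moment:
  assumes t: "1 \<le> t"
  shows "integrable M (\<lambda>\<omega>. (norm (comp_err i t \<omega>))\<^sup>2)" and "expectation (\<lambda>\<omega>. (norm (comp_err i t \<omega>))\<^sup>2) \<le> C * (s t)\<^sup>2"
proof -
  let ?H = "\<lambda>\<omega>. (z i t \<omega> - zh i (t - 1) \<omega>) /\<^sub>R s t"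
  let ?\<psi> = "\<lambda>(y, k). ennreal ((norm (Q y k - y))\<^sup>2)"
  have HY: "?H \<omega> \<in> Y" if "\<omega> \<in> space M" for \<omega>
    using args_in[OF t that] .
  have H: "?H \<in> inputs (past t) \<rightarrow>\<^sub>M restrict_space borel Y"
    using HY measurable_z_past[OF t, of i] measurable_zh_past[OF t, of i]
    by (intro measurable_restrict_space2) auto
  have Q: "(\<lambda>z. Q (fst z) (snd z)) \<in> borel_measurable (restrict_space borel Y \<Otimes>\<^sub>M K)"
    using compressor(2) unfolding bounded_error_compressor_def case_prod_unfold by blast
  have fstY: "fst \<in> borel_measurable (restrict_space borel Y \<Otimes>\<^sub>M K)"
    by (intro measurable_compose[OF measurable_fst measurable_restrict_space1] measurable_ident_sets refl)
  have \<psi>: "?\<psi> \<in> borel_measurable (restrict_space borel Y \<Otimes>\<^sub>M K)"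
    unfolding case_prod_unfold
    by (intro measurable_compose[OF _ measurable_ennreal] borel_measurable_power measurable_compose[OF _ borel_measurable_norm] borel_measurable_diff Q fstY)
  have err: "(norm (comp_err i t \<omega>))\<^sup>2 = (s t)\<^sup>2 * (norm (Q (?H \<omega>) (c i t \<omega>) - ?H \<omega>))\<^sup>2" if "\<omega> \<in> space M" for \<omega>
  proof -
    have "comp_err i t \<omega> = s t *\<^sub>R (Q (?H \<omega>) (c i t \<omega>) - ?H \<omega>)"
      using s_pos[OF t] unfolding comp_err_def path_zh[OF that t] by (simp add: scaleR_diff_right)
    then show ?thesis using s_pos[OF t] by (simp add: power_mult_distrib)
  qed
  have "(\<integral>\<^sup>+\<omega>. ?\<psi> (?H \<omega>, c i t \<omega>) \<partial>M) = (\<integral>\<^sup>+\<omega>. \<integral>\<^sup>+k. ?\<psi> (?H \<omega>, k) \<partial>K \<partial>M)"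
    by (intro nn_integral_fresh_c[OF H past_subset _ t \<psi>]) (simp add: past_def)
  also have "\<dots> \<le> (\<integral>\<^sup>+\<omega>. ennreal C \<partial>M)"
  proof (rule nn_integral_mono)
    fix \<omega> assume "\<omega> \<in> space M"
    then have "integrable K (\<lambda>k. (norm (Q (?H \<omega>) k - ?H \<omega>))\<^sup>2)" "(\<integral>k. (norm (Q (?H \<omega>) k - ?H \<omega>))\<^sup>2 \<partial>K) \<le> C"
      using compressor(2) HY unfolding bounded_error_compressor_def by blast+
    then show "(\<integral>\<^sup>+k. ?\<psi> (?H \<omega>, k) \<partial>K) \<le> ennreal C"
      by (simp only: case_prod_conv nn_integral_eq_integral zero_le_power2 AE_I2 ennreal_leI)
  qed
  also have "\<dots> = ennreal C" by (simp add: emeasure_space_1)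
  finally have inner: "(\<integral>\<^sup>+\<omega>. ?\<psi> (?H \<omega>, c i t \<omega>) \<partial>M) \<le> ennreal C" .
  have "(\<integral>\<^sup>+\<omega>. ennreal ((norm (comp_err i t \<omega>))\<^sup>2) \<partial>M) = (\<integral>\<^sup>+\<omega>. ennreal ((s t)\<^sup>2) * ?\<psi> (?H \<omega>, c i t \<omega>) \<partial>M)"
    by (intro nn_integral_cong) (simp only: err case_prod_conv ennreal_mult' zero_le_power2)
  also have "\<dots> = ennreal ((s t)\<^sup>2) * (\<integral>\<^sup>+\<omega>. ?\<psi> (?H \<omega>, c i t \<omega>) \<partial>M)"
    by (intro nn_integral_cmult measurable_compose[OF _ \<psi>] measurable_Pair measurable_c t measurable_past_imp_M[OF t H])
  also have "\<dots> \<le> ennreal ((s t)\<^sup>2) * ennreal C"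
    by (rule mult_left_mono[OF inner]) simp
  finally have bound: "(\<integral>\<^sup>+\<omega>. ennreal ((norm (comp_err i t \<omega>))\<^sup>2) \<partial>M) \<le> ennreal (C * (s t)\<^sup>2)"
    using compressor(1) by (simp add: ennreal_mult' mult.commute)
  have meas: "(\<lambda>\<omega>. (norm (comp_err i t \<omega>))\<^sup>2) \<in> borel_measurable M"
    by (intro borel_measurable_power measurable_compose[OF _ borel_measurable_norm] measurable_comp_err t)
  show int: "integrable M (\<lambda>\<omega>. (norm (comp_err i t \<omega>))\<^sup>2)"
    using bound by (intro integrableI_bounded meas) (auto simp: le_less_trans)
  show "expectation (\<lambda>\<omega>. (norm (comp_err i t \<omega>))\<^sup>2) \<le> C * (s t)\<^sup>2"
    using bound compressor(1) by (subst (asm) nn_integral_eq_integral[OF int]) auto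
qed

text \<open>Young's inequality with parameter \<open>s t\<close> bounds the norm by its square and a
  constant, which also yields integrability; both terms have mean of order
  \<open>s t\<close>.\<close>

lemma comp_err_mean:
  assumes t: "1 \<le> t"
  shows "integrable M (\<lambda>\<omega>. norm (comp_err i t \<omega>))" and "expectation (\<lambda>\<omega>. norm (comp_err i t \<omega>)) \<le> (1 + C) / 2 * s t"
proof -
  note s = s_pos[OF t]
  have le: "norm (comp_err i t \<omega>) \<le> s t / 2 + (norm (comp_err i t \<omega>))\<^sup>2 / (2 * s t)" for \<omega>
    using s zero_le_power2[of "norm (comp_err i t \<omega>) - s t"] by (simp add: power2_eq_square field_simps)
  have int2: "integrable M (\<lambda>\<omega>. s t / 2 + (norm (comp_err i t \<omega>))\<^sup>2 / (2 * s t))"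
    using comp_err_moment(1)[OF t, of i] by simp
  show int: "integrable M (\<lambda>\<omega>. norm (comp_err i t \<omega>))"
    by (rule Bochner_Integration.integrable_bound[OF int2])
      (use le measurable_comp_err[OF t] in \<open>auto intro: order_trans[OF _ abs_ge_self]\<close>)
  have "expectation (\<lambda>\<omega>. norm (comp_err i t \<omega>)) \<le> expectation (\<lambda>\<omega>. s t / 2 + (norm (comp_err i t \<omega>))\<^sup>2 / (2 * s t))"
    by (intro integral_mono int int2 le)
  also have "\<dots> = s t / 2 + expectation (\<lambda>\<omega>. (norm (comp_err i t \<omega>))\<^sup>2) / (2 * s t)"
    using comp_err_moment(1)[OF t, of i] by (simp add: prob_space)
  also have "\<dots> \<le> s t / 2 + (C * (s t)\<^sup>2) / (2 * s t)"
    using comp_err_moment(2)[OF t, of i] s by (intro add_left_mono divide_right_mono) auto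
  also have "\<dots> = (1 + C) / 2 * s t"
    using s by (simp add: power2_eq_square field_simps)
  finally show "expectation (\<lambda>\<omega>. norm (comp_err i t \<omega>)) \<le> (1 + C) / 2 * s t" .
qed

definition c6 :: real where "c6 = real CARD('n) * (R * (1 + C) + C * s0 / 2)"

lemma c6_nonneg: "0 \<le> c6"
  using X(4) compressor(1) constants(5) by (simp add: c6_def)

lemma err_cost_mean:
  assumes t: "1 \<le> t"
  shows "integrable M (err_cost t)" and "expectation (err_cost t) \<le> c6 * s t"
proof -
  show "integrable M (err_cost t)"
    unfolding err_cost_def using comp_err_moment(1)[OF t] comp_err_mean(1)[OF t] by simp
  \<comment> \<open>With \<open>s t \<le> s0\<close>, the second moment of order
    \<open>(s t)^2\<close> is at most a multiple of \<open>s t\<close>, the order of the first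
    moment.\<close>
  have "s0 / real t \<le> s0 / 1"
    using t constants(5) by (intro divide_left_mono) auto
  then have s: "s t \<le> s0" using s_le[OF t] by simp
  have "expectation (err_cost t) = (\<Sum>j\<in>UNIV. 2 * R * expectation (\<lambda>\<omega>. norm (comp_err j t \<omega>))
      + expectation (\<lambda>\<omega>. (norm (comp_err j t \<omega>))\<^sup>2) / 2)"
    unfolding err_cost_def using comp_err_moment(1)[OF t] comp_err_mean(1)[OF t] by simp
  also have "\<dots> \<le> (\<Sum>j\<in>(UNIV :: 'n set). 2 * R * ((1 + C) / 2 * s t) + C * (s t)\<^sup>2 / 2)"
    using comp_err_moment(2)[OF t] comp_err_mean(2)[OF t] X(4)
    by (intro sum_mono add_mono mult_left_mono divide_right_mono) auto
  also have "\<dots> \<le> (\<Sum>j\<in>(UNIV :: 'n set). 2 * R * ((1 + C) / 2 * s t) + C * (s0 * s t) / 2)"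
    using s s_pos[OF t] compressor(1) unfolding power2_eq_square
    by (intro sum_mono add_left_mono divide_right_mono mult_left_mono mult_right_mono) auto
  also have "\<dots> = c6 * s t"
    by (simp add: c6_def algebra_simps)
  finally show "expectation (err_cost t) \<le> c6 * s t" .
qed

section \<open>The noise as a martingale difference\<close>

lemma noise_bounded:
  assumes \<omega>: "\<omega> \<in> space M" and t: "1 \<le> t"
  shows "norm (noise i t \<omega>) \<le> 2 * (real CARD('p) * G1 + real CARD('p) * G2 * \<gamma> t * (2 * R * G2))"
proof -
  have "real CARD('p) * G2 * \<gamma> t * viol i t \<omega> \<le> real CARD('p) * G2 * \<gamma> t * (2 * R * G2)"
    using viol_le[OF \<omega> t] G2_pos gamma_pos[OF t] by (intro mult_left_mono) auto
  then have "2 * (real CARD('p) * G1 + real CARD('p) * G2 * \<gamma> t * viol i t \<omega>) \<le> 2 * (real CARD('p) * G1 + real CARD('p) * G2 * \<gamma> t * (2 * R * G2))"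
    by (rule mult_left_mono[OF add_left_mono]) simp
  then show ?thesis
    by (rule order_trans[OF norm_noise_le[OF \<omega> t]])
qed

text \<open>Both \<open>\<Phi>\<close> and \<open>x i t\<close> are determined before
  \<open>u i t\<close> is drawn. With them frozen, the mean over the direction vanishes by the
  definition of \<open>mean_direction\<close>.\<close>

lemma expectation_noise_inner:
  assumes t: "1 \<le> t" and \<Phi>: "\<Phi> \<in> borel_measurable (inputs (now t))" "\<And>\<omega>. \<omega> \<in> space M \<Longrightarrow> norm (\<Phi> \<omega>) \<le> b"
  shows "integrable M (\<lambda>\<omega>. noise i t \<omega> \<bullet> \<Phi> \<omega>)" and "expectation (\<lambda>\<omega>. noise i t \<omega> \<bullet> \<Phi> \<omega>) = 0"
proof -
  let ?H = "\<lambda>\<omega>. (\<Phi> \<omega>, x i t \<omega>)"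
  let ?\<psi> = "\<lambda>(h, v). (direction i t (snd h) v - mean_direction i t (snd h)) \<bullet> fst h"
  show int: "integrable M (\<lambda>\<omega>. noise i t \<omega> \<bullet> \<Phi> \<omega>)"
  proof (rule integrable_bounded)
    show "(\<lambda>\<omega>. noise i t \<omega> \<bullet> \<Phi> \<omega>) \<in> borel_measurable M"
      by (intro borel_measurable_inner measurable_noise_M t measurable_now_imp_M[OF t \<Phi>(1)])
    fix \<omega> assume \<omega>: "\<omega> \<in> space M"
    have "\<bar>noise i t \<omega> \<bullet> \<Phi> \<omega>\<bar> \<le> norm (noise i t \<omega>) * norm (\<Phi> \<omega>)"
      by (rule Cauchy_Schwarz_ineq2)
    also have "\<dots> \<le> (2 * (real CARD('p) * G1 + real CARD('p) * G2 * \<gamma> t * (2 * R * G2))) * b"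
      using noise_bounded[OF \<omega> t, of i] \<Phi>(2)[OF \<omega>] by (intro mult_mono') auto
    finally show "norm (noise i t \<omega> \<bullet> \<Phi> \<omega>) \<le> (2 * (real CARD('p) * G1 + real CARD('p) * G2 * \<gamma> t * (2 * R * G2))) * b"
      by simp
  qed
  have H: "?H \<in> inputs (now t) \<rightarrow>\<^sub>M borel \<Otimes>\<^sub>M borel"
    by (intro measurable_Pair \<Phi>(1) measurable_x t)
  have \<psi>: "?\<psi> \<in> borel_measurable ((borel \<Otimes>\<^sub>M borel) \<Otimes>\<^sub>M borel)"
    unfolding case_prod_unfold
    by (intro borel_measurable_inner borel_measurable_diff measurable_direction t
        measurable_compose[OF _ measurable_mean_direction[OF t]]) measurable
  have eq: "noise i t \<omega> \<bullet> \<Phi> \<omega> = ?\<psi> (?H \<omega>, u i t \<omega>)" for \<omega>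
    by (simp add: noise_def dir_def)
  have "expectation (\<lambda>\<omega>. noise i t \<omega> \<bullet> \<Phi> \<omega>) = expectation (\<lambda>\<omega>. \<integral>v. ?\<psi> (?H \<omega>, v) \<partial>uniform_sphere)"
    unfolding eq
  proof (rule expectation_fresh_u[OF H now_subset[OF t] _ t \<psi>])
    show "((i, t), True) \<notin> now t" by (simp add: now_def past_def)
    show "integrable M (\<lambda>\<omega>. ?\<psi> (?H \<omega>, u i t \<omega>))" using int unfolding eq .
  qed
  also have "\<dots> = expectation (\<lambda>\<omega>. 0)"
  proof (rule Bochner_Integration.integral_cong[OF refl])
    fix \<omega> assume "\<omega> \<in> space M"
    then have "integrable uniform_sphere (direction i t (x i t \<omega>))"
      by (intro integrable_direction t x_in_Xs)
    then show "(\<integral>v. ?\<psi> (?H \<omega>, v) \<partial>uniform_sphere) = 0"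
      using sphere.prob_space[where 'p='p] by (simp add: inner_diff_left mean_direction_def)
  qed
  finally show "expectation (\<lambda>\<omega>. noise i t \<omega> \<bullet> \<Phi> \<omega>) = 0" by simp
qed

text \<open>The weights are those of the scaled comparators, so the whole noise against any fixed or
  path-dependent \<open>y\<close> is the inner product of this one martingale with
  \<open>y\<close>.\<close>

definition noise_sum :: "'n \<Rightarrow> nat \<Rightarrow> 'w \<Rightarrow> real ^ 'p" where
  "noise_sum i T \<omega> = (\<Sum>t=1..T. (1 - \<xi> t) *\<^sub>R noise i t \<omega>)"

lemma noise_sum_measurable: "noise_sum i T \<in> borel_measurable (inputs (past (Suc T)))"
  unfolding noise_sum_def
proof (intro borel_measurable_sum borel_measurable_scaleR borel_measurable_const)
  fix t assume "t \<in> {1..T}"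
  then have "1 \<le> t" "past (Suc t) \<subseteq> past (Suc T)" by (auto simp: past_def)
  then show "noise i t \<in> borel_measurable (inputs (past (Suc T)))"
    using measurable_inputs_mono[OF measurable_noise] by blast
qed

lemma noise_sum_bounded: "\<exists>b. \<forall>\<omega>\<in>space M. norm (noise_sum i T \<omega>) \<le> b"
proof (intro exI ballI)
  fix \<omega> assume \<omega>: "\<omega> \<in> space M"
  show "norm (noise_sum i T \<omega>) \<le> (\<Sum>t=1..T. 2 * (real CARD('p) * G1 + real CARD('p) * G2 * \<gamma> t * (2 * R * G2)))"
    unfolding noise_sum_def
  proof (rule order_trans[OF norm_sum], rule sum_mono)
    fix t assume "t \<in> {1..T}"
    then have t: "1 \<le> t" by simp
    have "norm ((1 - \<xi> t) *\<^sub>R noise i t \<omega>) \<le> 1 * norm (noise i t \<omega>)"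
      using alpha_pos[OF t] alpha_less_1[OF t] unfolding norm_scaleR parameters(3)[OF t]
      by (intro mult_right_mono) auto
    then show "norm ((1 - \<xi> t) *\<^sub>R noise i t \<omega>) \<le> 2 * (real CARD('p) * G1 + real CARD('p) * G2 * \<gamma> t * (2 * R * G2))"
      using noise_bounded[OF \<omega> t, of i] by simp
  qed
qed

lemma integrable_noise_power2: assumes t: "1 \<le> t" shows "integrable M (\<lambda>\<omega>. (norm (noise i t \<omega>))\<^sup>2)"
proof (rule integrable_bounded)
  fix \<omega> assume "\<omega> \<in> space M"
  then show "norm ((norm (noise i t \<omega>))\<^sup>2) \<le> (2 * (real CARD('p) * G1 + real CARD('p) * G2 * \<gamma> t * (2 * R * G2)))\<^sup>2"
    using noise_bounded[OF _ t] by (simp add: power_mono)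
qed (rule borel_measurable_power[OF measurable_compose[OF measurable_noise_M[OF t] borel_measurable_norm]])

text \<open>Orthogonality of martingale increments: the cross term has mean zero because the sum up
  to \<open>T\<close> is known before the direction of round \<open>Suc T\<close> is drawn.\<close>

lemma noise_sum_power2:
  "integrable M (\<lambda>\<omega>. (norm (noise_sum i T \<omega>))\<^sup>2) \<and>
   expectation (\<lambda>\<omega>. (norm (noise_sum i T \<omega>))\<^sup>2) \<le> (\<Sum>t=1..T. expectation (\<lambda>\<omega>. (norm (noise i t \<omega>))\<^sup>2))"
proof (induction T)
  case 0
  then show ?case by (simp add: noise_sum_def)
next
  case (Suc T)
  let ?t = "Suc T" and ?a = "1 - \<xi> (Suc T)"
  have a: "0 \<le> ?a" "?a \<le> 1"
    using alpha_pos[of ?t] alpha_less_1[of ?t] by (simp_all add: parameters(3))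
  obtain b where b: "\<And>\<omega>. \<omega> \<in> space M \<Longrightarrow> norm (noise_sum i T \<omega>) \<le> b"
    using noise_sum_bounded[of i T] by blast
  note orth = expectation_noise_inner[OF _ measurable_inputs_mono[OF noise_sum_measurable past_now] b, of i]
  have expand: "(norm (noise_sum i ?t \<omega>))\<^sup>2
      = (norm (noise_sum i T \<omega>))\<^sup>2 + 2 * ?a * (noise i ?t \<omega> \<bullet> noise_sum i T \<omega>) + ?a\<^sup>2 * (norm (noise i ?t \<omega>))\<^sup>2" for \<omega>
  proof -
    have "noise_sum i ?t \<omega> = noise_sum i T \<omega> + ?a *\<^sub>R noise i ?t \<omega>"
      by (simp add: noise_sum_def)
    moreover have "(norm (y + k *\<^sub>R v))\<^sup>2 = (norm y)\<^sup>2 + 2 * k * (v \<bullet> y) + k\<^sup>2 * (norm v)\<^sup>2" for y v :: "real ^ 'p" and k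
      unfolding power2_norm_eq_inner
      by (simp add: inner_add_left inner_add_right inner_commute power2_eq_square algebra_simps)
    ultimately show ?thesis by (simp only:)
  qed
  have ints: "integrable M (\<lambda>\<omega>. (norm (noise_sum i T \<omega>))\<^sup>2)" "integrable M (\<lambda>\<omega>. noise i ?t \<omega> \<bullet> noise_sum i T \<omega>)"
    "integrable M (\<lambda>\<omega>. (norm (noise i ?t \<omega>))\<^sup>2)"
    using Suc orth(1) integrable_noise_power2 by auto
  have "?a\<^sup>2 * expectation (\<lambda>\<omega>. (norm (noise i ?t \<omega>))\<^sup>2) \<le> 1 * expectation (\<lambda>\<omega>. (norm (noise i ?t \<omega>))\<^sup>2)"
    using a by (intro mult_right_mono integral_nonneg_AE) (auto simp: power_le_one)
  moreover have "expectation (\<lambda>\<omega>. (norm (noise_sum i ?t \<omega>))\<^sup>2) = expectation (\<lambda>\<omega>. (norm (noise_sum i T \<omega>))\<^sup>2)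
      + 2 * ?a * expectation (\<lambda>\<omega>. noise i ?t \<omega> \<bullet> noise_sum i T \<omega>) + ?a\<^sup>2 * expectation (\<lambda>\<omega>. (norm (noise i ?t \<omega>))\<^sup>2)"
    unfolding expand using ints by simp
  moreover have "expectation (\<lambda>\<omega>. noise i ?t \<omega> \<bullet> noise_sum i T \<omega>) = 0"
    using orth(2) by simp
  ultimately have "expectation (\<lambda>\<omega>. (norm (noise_sum i ?t \<omega>))\<^sup>2) \<le> (\<Sum>t=1..?t. expectation (\<lambda>\<omega>. (norm (noise i t \<omega>))\<^sup>2))"
    using Suc by simp
  moreover have "integrable M (\<lambda>\<omega>. (norm (noise_sum i ?t \<omega>))\<^sup>2)"
    unfolding expand using ints by simp
  ultimately show ?case by blast
qed

text \<open>Of the two factors \<open>\<gamma> t\<close> one is enlarged to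
  \<open>\<gamma> T\<close>; the other stays, so that the sum over \<open>t\<close> becomes
  \<open>weighted_viol T\<close>.\<close>

lemma noise_power2_le:
  assumes \<omega>: "\<omega> \<in> space M" and t: "1 \<le> t" "t \<le> T"
  shows "(norm (noise i t \<omega>))\<^sup>2 \<le> 8 * (real CARD('p))\<^sup>2 * G1\<^sup>2 + 8 * (real CARD('p))\<^sup>2 * G2\<^sup>2 * \<gamma> T * (\<gamma> t * (viol i t \<omega>)\<^sup>2)"
proof -
  let ?a = "real CARD('p) * G1" and ?b = "real CARD('p) * G2 * \<gamma> t * viol i t \<omega>"
  have sq: "(2 * (a + b))\<^sup>2 \<le> 8 * a\<^sup>2 + 8 * b\<^sup>2" for a b :: real
    using sum_squares_bound[of a b] by (simp add: power2_sum power_mult_distrib)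
  have "(norm (noise i t \<omega>))\<^sup>2 \<le> (2 * (?a + ?b))\<^sup>2"
    using norm_noise_le[OF \<omega> t(1)] by (intro power_mono) auto
  also have "\<dots> \<le> 8 * ?a\<^sup>2 + 8 * ?b\<^sup>2"
    by (rule sq)
  also have "\<dots> = 8 * (real CARD('p))\<^sup>2 * G1\<^sup>2 + 8 * (real CARD('p))\<^sup>2 * G2\<^sup>2 * \<gamma> t * (\<gamma> t * (viol i t \<omega>)\<^sup>2)"
    by (simp add: power_mult_distrib power2_eq_square algebra_simps)
  also have "\<dots> \<le> 8 * (real CARD('p))\<^sup>2 * G1\<^sup>2 + 8 * (real CARD('p))\<^sup>2 * G2\<^sup>2 * \<gamma> T * (\<gamma> t * (viol i t \<omega>)\<^sup>2)"
  proof -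
    have "\<gamma> t \<le> \<gamma> T"
      using alpha_antimono[OF t] alpha_pos[of T] t gamma0_pos by (simp add: parameters(2) divide_left_mono)
    then show ?thesis
      using gamma_pos[OF t(1)] by (intro add_left_mono mult_right_mono mult_left_mono) auto
  qed
  finally show ?thesis .
qed

section \<open>Regret and constraint violation\<close>

definition total_viol :: "nat \<Rightarrow> 'w \<Rightarrow> real" where
  "total_viol T \<omega> = (\<Sum>t=1..T. \<Sum>j\<in>UNIV. viol j t \<omega>)"

definition weighted_viol :: "nat \<Rightarrow> 'w \<Rightarrow> real" where
  "weighted_viol T \<omega> = (\<Sum>t=1..T. \<Sum>j\<in>UNIV. \<gamma> t * (viol j t \<omega>)\<^sup>2)"

definition total_comp_err :: "nat \<Rightarrow> 'w \<Rightarrow> real" where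
  "total_comp_err T \<omega> = (\<Sum>t=1..T. \<Sum>j\<in>UNIV. norm (comp_err j (Suc t) \<omega>))"

text \<open>Each agent is charged for its own loss at its own iterate, which is what the potential
  controls. Passing to the global loss at every agent's iterate costs a multiple of the
  diameter.\<close>

definition local_reg :: "real ^ 'p \<Rightarrow> nat \<Rightarrow> 'w \<Rightarrow> real" where
  "local_reg y T \<omega> = (\<Sum>t=1..T. \<Sum>j\<in>UNIV. gradient X (f j t) (x j t \<omega>) \<bullet> (x j t \<omega> - y))"

definition noise_along_path :: "nat \<Rightarrow> 'w \<Rightarrow> real" where
  "noise_along_path T \<omega> = (\<Sum>t=1..T. \<Sum>j\<in>UNIV. noise j t \<omega> \<bullet> x j t \<omega>)"

definition sum_alpha :: "nat \<Rightarrow> real" where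
  "sum_alpha T = (\<Sum>t=1..T. \<alpha> t)"

lemma weighted_viol_nonneg: "0 \<le> weighted_viol T \<omega>"
  unfolding weighted_viol_def by (intro sum_nonneg mult_nonneg_nonneg less_imp_le[OF gamma_pos]) auto

lemma integrable_total_viol: "integrable M (total_viol T)"
  unfolding total_viol_def by (intro Bochner_Integration.integrable_sum integrable_viol) simp

lemma integrable_weighted_viol: "integrable M (weighted_viol T)"
  unfolding weighted_viol_def
  by (intro Bochner_Integration.integrable_sum integrable_mult_right integrable_viol_power2) simp

lemma integrable_total_comp_err: "integrable M (total_comp_err T)"
  unfolding total_comp_err_def by (intro Bochner_Integration.integrable_sum comp_err_mean(1)) simp

section \<open>Growth of the step-size sums\<close>

lemma theta: "0 < \<theta>1" "\<theta>1 < 1"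
  using constants(3) by simp_all

lemma sum_powr_neg_theta_le: "(\<Sum>t=1..T. real t powr (- \<theta>1)) \<le> real T powr (1 - \<theta>1) / (1 - \<theta>1)"
  using sum_powr_le[of "1 - \<theta>1" T] theta by simp

lemma sum_alpha_le: "sum_alpha T \<le> \<alpha>0 / (1 - \<theta>1) * real T powr (1 - \<theta>1)"
proof -
  have "sum_alpha T = \<alpha>0 * (\<Sum>t=1..T. real t powr (- \<theta>1))"
    unfolding sum_alpha_def sum_distrib_left
    by (intro sum.cong refl) (simp add: parameters(1) powr_minus divide_inverse)
  also have "\<dots> \<le> \<alpha>0 * (real T powr (1 - \<theta>1) / (1 - \<theta>1))"
    using sum_powr_neg_theta_le constants(1) by (intro mult_left_mono) auto
  finally show ?thesis by simp
qed

lemma inverse_alpha: "1 \<le> t \<Longrightarrow> 1 / \<alpha> t = real t powr \<theta>1 / \<alpha>0"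
  by (simp add: parameters(1))

lemma s_Suc_le: assumes t: "1 \<le> t" shows "s (Suc t) \<le> s0 / real t"
proof -
  have "s (Suc t) \<le> s0 / real (Suc t)" by (rule s_le) simp
  also have "\<dots> \<le> s0 / real t" using t constants(5) by (intro divide_left_mono) auto
  finally show ?thesis .
qed

text \<open>The crude comparison of \<open>1 / t\<close> with \<open>t powr (- \<theta>1)\<close>
  suffices, since the sum of the step sizes already has the resulting order.\<close>

lemma sum_s_le: "(\<Sum>t=1..T. s (Suc t)) \<le> s0 / (1 - \<theta>1) * real T powr (1 - \<theta>1)"
proof -
  have "(\<Sum>t=1..T. s (Suc t)) \<le> (\<Sum>t=1..T. s0 * real t powr (- \<theta>1))"
  proof (rule sum_mono)
    fix t assume "t \<in> {1..T}"
    then have t: "1 \<le> t" by simp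
    have "real t powr (-1) \<le> real t powr (- \<theta>1)"
      using t theta by (intro powr_mono) auto
    then have "s0 * (1 / real t) \<le> s0 * real t powr (- \<theta>1)"
      using t constants(5) by (intro mult_left_mono) (simp_all add: powr_minus divide_inverse)
    then show "s (Suc t) \<le> s0 * real t powr (- \<theta>1)"
      using s_Suc_le[OF t] by simp
  qed
  also have "\<dots> \<le> s0 * (real T powr (1 - \<theta>1) / (1 - \<theta>1))"
    unfolding sum_distrib_left[symmetric] using sum_powr_neg_theta_le constants(5) by (intro mult_left_mono) auto
  finally show ?thesis by simp
qed

text \<open>The index shift in \<open>s (Suc t)\<close> reflects that the error made in round
  \<open>Suc t\<close> is paid in the step of round \<open>t\<close>.\<close>

lemma sum_s_div_alpha_le: "(\<Sum>t=1..T. s (Suc t) / \<alpha> t) \<le> s0 / (\<alpha>0 * \<theta>1) * real T powr \<theta>1"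
proof -
  have "(\<Sum>t=1..T. s (Suc t) / \<alpha> t) \<le> (\<Sum>t=1..T. s0 / \<alpha>0 * real t powr (\<theta>1 - 1))"
  proof (rule sum_mono)
    fix t assume "t \<in> {1..T}"
    then have t: "1 \<le> t" by simp
    have "s (Suc t) / \<alpha> t \<le> (s0 / real t) / \<alpha> t"
      using s_Suc_le[OF t] alpha_pos[OF t] by (intro divide_right_mono) auto
    also have "\<dots> = (s0 / real t) * (real t powr \<theta>1 / \<alpha>0)"
      unfolding inverse_alpha[OF t, symmetric] by simp
    also have "\<dots> = s0 / \<alpha>0 * real t powr (\<theta>1 - 1)"
      using t by (simp add: powr_diff)
    finally show "s (Suc t) / \<alpha> t \<le> s0 / \<alpha>0 * real t powr (\<theta>1 - 1)" .
  qed
  also have "\<dots> \<le> s0 / \<alpha>0 * (real T powr \<theta>1 / \<theta>1)"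
    unfolding sum_distrib_left[symmetric] using sum_powr_le[of \<theta>1 T] theta constants(1,5)
    by (intro mult_left_mono) auto
  finally show ?thesis by simp
qed

lemma total_comp_err_mean: "expectation (total_comp_err T) \<le> real CARD('n) * ((1 + C) / 2) * (s0 / (1 - \<theta>1)) * real T powr (1 - \<theta>1)"
proof -
  have "expectation (total_comp_err T) = (\<Sum>t=1..T. \<Sum>j\<in>UNIV. expectation (\<lambda>\<omega>. norm (comp_err j (Suc t) \<omega>)))"
    unfolding total_comp_err_def
    by (simp add: Bochner_Integration.integral_sum comp_err_mean(1))
  also have "\<dots> \<le> (\<Sum>t=1..T. \<Sum>j\<in>(UNIV :: 'n set). (1 + C) / 2 * s (Suc t))"
    by (intro sum_mono comp_err_mean(2)) simp
  also have "\<dots> = real CARD('n) * ((1 + C) / 2) * (\<Sum>t=1..T. s (Suc t))"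
    by (simp add: sum_distrib_left mult.assoc)
  also have "\<dots> \<le> real CARD('n) * ((1 + C) / 2) * (s0 / (1 - \<theta>1) * real T powr (1 - \<theta>1))"
    using sum_s_le compressor(1) by (intro mult_left_mono) auto
  finally show ?thesis by simp
qed

text \<open>Summation by parts with the nondecreasing weights \<open>1 / \<alpha> t\<close>: the
  increments of the weights are multiplied by values of at most \<open>A\<close>, and they add
  up.\<close>

lemma sum_diff_div_alpha_le:
  assumes "\<And>t. 1 \<le> t \<Longrightarrow> 0 \<le> a t" "\<And>t. 1 \<le> t \<Longrightarrow> a t \<le> A" "1 \<le> T"
  shows "(\<Sum>t=1..T. (a t - a (Suc t)) / \<alpha> t) \<le> A / \<alpha> T"
proof -
  \<comment> \<open>The induction carries \<open>A - a (Suc T)\<close> instead of \<open>A\<close>: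
    this quantity is nonnegative, so raising the weight to \<open>1 / \<alpha> (Suc T)\<close> is
    allowed, and the next summand then telescopes with it.\<close>
  have "(\<Sum>t=1..T. (a t - a (Suc t)) / \<alpha> t) \<le> (A - a (Suc T)) / \<alpha> T"
    using assms(3)
  proof (induction T rule: nat_induct_at_least)
    case base
    then show ?case using assms(2)[of 1] alpha_pos[of 1] by (simp add: divide_right_mono)
  next
    case (Suc T)
    have "(A - a (Suc T)) / \<alpha> T \<le> (A - a (Suc T)) / \<alpha> (Suc T)"
      using assms(2)[of "Suc T"] alpha_antimono[of T "Suc T"] alpha_pos[of "Suc T"] Suc.hyps
      by (intro divide_left_mono) auto
    then show ?case using Suc.IH by (simp add: diff_divide_distrib)
  qed
  also have "\<dots> \<le> A / \<alpha> T"
    using assms(1)[of "Suc T"] alpha_pos[OF assms(3)] by (intro divide_right_mono) auto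
  finally show ?thesis .
qed

section \<open>Regret of the agents on their own losses\<close>

lemma noise_split:
  "(\<Sum>t=1..T. \<Sum>j\<in>UNIV. noise j t \<omega> \<bullet> (x j t \<omega> - (1 - \<xi> t) *\<^sub>R y))
    = noise_along_path T \<omega> - (\<Sum>j\<in>UNIV. noise_sum j T \<omega> \<bullet> y)"
proof -
  have "(\<Sum>j\<in>UNIV. noise_sum j T \<omega> \<bullet> y) = (\<Sum>t=1..T. \<Sum>j\<in>UNIV. noise j t \<omega> \<bullet> ((1 - \<xi> t) *\<^sub>R y))"
    unfolding noise_sum_def inner_sum_left inner_scaleR_left inner_scaleR_right by (rule sum.swap)
  then show ?thesis
    unfolding noise_along_path_def by (simp only: inner_diff_right sum_subtractf)
qed

text \<open>The part of the noise that meets \<open>y\<close> is estimated by Cauchy-Schwarz, so the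
  right-hand side is free of \<open>y\<close> and the inequality holds for all feasible comparators
  at once.\<close>

lemma regret_pathwise:
  assumes \<omega>: "\<omega> \<in> space M" and T: "1 \<le> T" and y: "y \<in> feasible_set X m g T"
  shows "local_reg y T \<omega> + 3 / 4 * weighted_viol T \<omega> \<le> (c2 + c2 * \<alpha>0) / \<alpha> T + c1 * sum_alpha T
    + (\<Sum>t=1..T. err_cost (Suc t) \<omega> / \<alpha> t) + c3 * total_viol T \<omega> - noise_along_path T \<omega>
    + (\<Sum>j\<in>UNIV. R * norm (noise_sum j T \<omega>))"
proof -
  have yg: "g i t y k \<le> - 0" if "t \<in> {1..T}" "k < m i" for i t k
    using y that by (auto simp: feasible_set_def)
  have yX: "y \<in> X" using y by (simp add: feasible_set_def)
  let ?N = "\<lambda>t. \<Sum>j\<in>UNIV. noise j t \<omega> \<bullet> (x j t \<omega> - (1 - \<xi> t) *\<^sub>R y)"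
  have "local_reg y T \<omega> + 3 / 4 * weighted_viol T \<omega>
      = (\<Sum>t=1..T. \<Sum>j\<in>UNIV. gradient X (f j t) (x j t \<omega>) \<bullet> (x j t \<omega> - y) + 3 / 4 * (\<gamma> t * (viol j t \<omega>)\<^sup>2))"
    unfolding local_reg_def weighted_viol_def sum_distrib_left sum.distrib[symmetric] ..
  also have "\<dots> \<le> (\<Sum>t=1..T. 1 / 2 * ((potential y t \<omega> - potential y (Suc t) \<omega>) / \<alpha> t) + c1 * \<alpha> t
      + c2 * ((\<alpha> t - \<alpha> (Suc t)) / \<alpha> t) + err_cost (Suc t) \<omega> / \<alpha> t + c3 * (\<Sum>j\<in>UNIV. viol j t \<omega>) - ?N t)"
  proof (rule sum_mono)
    fix t assume tT: "t \<in> {1..T}"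
    then have t: "1 \<le> t" by simp
    let ?L = "\<Sum>j\<in>UNIV. gradient X (f j t) (x j t \<omega>) \<bullet> (x j t \<omega> - y) + 3 / 4 * (\<gamma> t * (viol j t \<omega>)\<^sup>2)"
    have "\<alpha> t * ?L \<le> (potential y t \<omega> - potential y (Suc t) \<omega>) / 2 + c1 * (\<alpha> t)\<^sup>2 + c2 * (\<alpha> t - \<alpha> (Suc t))
        + err_cost (Suc t) \<omega> + \<alpha> t * (c3 * (\<Sum>j\<in>UNIV. viol j t \<omega>)) - \<alpha> t * ?N t"
      using descent[OF \<omega> t yX order_refl yg[OF tT]] by simp
    moreover have "l \<le> 1 / 2 * (dp / a) + k1 * a + k2 * (da / a) + e / a + v - N"
      if "a * l \<le> dp / 2 + k1 * a\<^sup>2 + k2 * da + e + a * v - a * N" "0 < a" for a l dp k1 k2 da e v N :: real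
    proof -
      have "l = (a * l) / a" using that(2) by simp
      also have "\<dots> \<le> (dp / 2 + k1 * a\<^sup>2 + k2 * da + e + a * v - a * N) / a"
        using that by (intro divide_right_mono) auto
      also have "\<dots> = 1 / 2 * (dp / a) + k1 * a + k2 * (da / a) + e / a + v - N"
        using that(2) by (simp add: add_divide_distrib diff_divide_distrib power2_eq_square)
      finally show ?thesis .
    qed
    ultimately show "?L \<le> 1 / 2 * ((potential y t \<omega> - potential y (Suc t) \<omega>) / \<alpha> t) + c1 * \<alpha> t
      + c2 * ((\<alpha> t - \<alpha> (Suc t)) / \<alpha> t) + err_cost (Suc t) \<omega> / \<alpha> t + c3 * (\<Sum>j\<in>UNIV. viol j t \<omega>) - ?N t"
      using alpha_pos[OF t] by blast
  qed
  also have "\<dots> = 1 / 2 * (\<Sum>t=1..T. (potential y t \<omega> - potential y (Suc t) \<omega>) / \<alpha> t) + c1 * sum_alpha T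
      + c2 * (\<Sum>t=1..T. (\<alpha> t - \<alpha> (Suc t)) / \<alpha> t) + (\<Sum>t=1..T. err_cost (Suc t) \<omega> / \<alpha> t)
      + c3 * total_viol T \<omega> - (\<Sum>t=1..T. ?N t)"
    unfolding sum_alpha_def total_viol_def by (simp only: sum.distrib sum_subtractf sum_distrib_left)
  finally have main: "local_reg y T \<omega> + 3 / 4 * weighted_viol T \<omega> \<le> \<dots>" .
  have pot: "(\<Sum>t=1..T. (potential y t \<omega> - potential y (Suc t) \<omega>) / \<alpha> t) \<le> real CARD('n) * (4 * R\<^sup>2) / \<alpha> T"
    by (intro sum_diff_div_alpha_le T potential_nonneg potential_le \<omega> yX)
  have alp: "c2 * (\<Sum>t=1..T. (\<alpha> t - \<alpha> (Suc t)) / \<alpha> t) \<le> c2 * (\<alpha>0 / \<alpha> T)"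
    by (intro mult_left_mono sum_diff_div_alpha_le T alpha_le less_imp_le[OF alpha_pos] c_nonneg)
  have "(\<Sum>j\<in>UNIV. noise_sum j T \<omega> \<bullet> y) \<le> (\<Sum>j\<in>UNIV. R * norm (noise_sum j T \<omega>))"
  proof (rule sum_mono)
    fix j
    have "noise_sum j T \<omega> \<bullet> y \<le> norm (noise_sum j T \<omega>) * norm y"
      by (rule norm_cauchy_schwarz)
    also have "\<dots> \<le> norm (noise_sum j T \<omega>) * R"
      by (intro mult_left_mono norm_X yX) simp
    finally show "noise_sum j T \<omega> \<bullet> y \<le> R * norm (noise_sum j T \<omega>)" by (simp add: mult.commute)
  qed
  moreover have "1 / 2 * (real CARD('n) * (4 * R\<^sup>2) / \<alpha> T) + c2 * (\<alpha>0 / \<alpha> T) = (c2 + c2 * \<alpha>0) / \<alpha> T"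
    by (simp add: c2_def add_divide_distrib)
  moreover have "1 / 2 * (\<Sum>t=1..T. (potential y t \<omega> - potential y (Suc t) \<omega>) / \<alpha> t) \<le> 1 / 2 * (real CARD('n) * (4 * R\<^sup>2) / \<alpha> T)"
    using pot by (rule mult_left_mono) simp
  moreover note main[unfolded noise_split] alp
  moreover have "P \<le> k + c + e + v - N + rs"
    if "P \<le> a1 + c + a2 + e + v - (N - s)" "a1 \<le> b1" "a2 \<le> b2" "b1 + b2 = k" "s \<le> rs"
    for P a1 c a2 e v N s b1 b2 k rs :: real
    using that by linarith
  ultimately show ?thesis by blast
qed

lemma noise_along_path_mean: "integrable M (noise_along_path T)" "expectation (noise_along_path T) = 0"
proof -
  have *: "integrable M (\<lambda>\<omega>. noise j t \<omega> \<bullet> x j t \<omega>)" "expectation (\<lambda>\<omega>. noise j t \<omega> \<bullet> x j t \<omega>) = 0"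
    if "t \<in> {1..T}" for t j
  proof -
    have t: "1 \<le> t" using that by simp
    show "integrable M (\<lambda>\<omega>. noise j t \<omega> \<bullet> x j t \<omega>)" "expectation (\<lambda>\<omega>. noise j t \<omega> \<bullet> x j t \<omega>) = 0"
      by (rule expectation_noise_inner[OF t measurable_x[OF t] norm_X[OF x_in_X[OF t]]], assumption)+
  qed
  show "integrable M (noise_along_path T)"
    unfolding noise_along_path_def by (intro Bochner_Integration.integrable_sum *(1))
  show "expectation (noise_along_path T) = 0"
    unfolding noise_along_path_def
    by (subst Bochner_Integration.integral_sum, intro Bochner_Integration.integrable_sum *(1), assumption)
      (simp add: Bochner_Integration.integral_sum *)
qed

lemma sum_noise_sum_power2_le:
  "(\<Sum>j\<in>UNIV. expectation (\<lambda>\<omega>. (norm (noise_sum j T \<omega>))\<^sup>2))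
    \<le> 8 * (real CARD('p))\<^sup>2 * G1\<^sup>2 * (real CARD('n) * real T) + 8 * (real CARD('p))\<^sup>2 * G2\<^sup>2 * \<gamma> T * expectation (weighted_viol T)"
proof -
  let ?k1 = "8 * (real CARD('p))\<^sup>2 * G1\<^sup>2" and ?k2 = "8 * (real CARD('p))\<^sup>2 * G2\<^sup>2 * \<gamma> T"
  have "(\<Sum>j\<in>UNIV. expectation (\<lambda>\<omega>. (norm (noise_sum j T \<omega>))\<^sup>2))
      \<le> (\<Sum>j\<in>UNIV. \<Sum>t=1..T. expectation (\<lambda>\<omega>. (norm (noise j t \<omega>))\<^sup>2))"
    using noise_sum_power2 by (intro sum_mono) blast
  also have "\<dots> \<le> (\<Sum>j\<in>UNIV. \<Sum>t=1..T. ?k1 + ?k2 * expectation (\<lambda>\<omega>. \<gamma> t * (viol j t \<omega>)\<^sup>2))"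
  proof (intro sum_mono)
    fix j t assume "t \<in> {1..T}"
    then have t: "1 \<le> t" "t \<le> T" by auto
    have int: "integrable M (\<lambda>\<omega>. \<gamma> t * (viol j t \<omega>)\<^sup>2)"
      by (intro integrable_mult_right integrable_viol_power2 t)
    have "expectation (\<lambda>\<omega>. (norm (noise j t \<omega>))\<^sup>2) \<le> expectation (\<lambda>\<omega>. ?k1 + ?k2 * (\<gamma> t * (viol j t \<omega>)\<^sup>2))"
      by (intro integral_mono integrable_noise_power2 t noise_power2_le Bochner_Integration.integrable_add
          integrable_const integrable_mult_right[OF int])
    also have "\<dots> = ?k1 + ?k2 * expectation (\<lambda>\<omega>. \<gamma> t * (viol j t \<omega>)\<^sup>2)"
      by (subst Bochner_Integration.integral_add[OF integrable_const integrable_mult_right[OF int]])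
        (simp add: prob_space)
    finally show "expectation (\<lambda>\<omega>. (norm (noise j t \<omega>))\<^sup>2) \<le> ?k1 + ?k2 * expectation (\<lambda>\<omega>. \<gamma> t * (viol j t \<omega>)\<^sup>2)" .
  qed
  also have "\<dots> = ?k1 * (real CARD('n) * real T) + ?k2 * (\<Sum>t=1..T. \<Sum>j\<in>UNIV. expectation (\<lambda>\<omega>. \<gamma> t * (viol j t \<omega>)\<^sup>2))"
    by (subst (2) sum.swap) (simp add: sum.distrib sum_distrib_left del: integral_mult_right_zero)
  also have "(\<Sum>t=1..T. \<Sum>j\<in>UNIV. expectation (\<lambda>\<omega>. \<gamma> t * (viol j t \<omega>)\<^sup>2)) = expectation (weighted_viol T)"
    unfolding weighted_viol_def
    by (subst Bochner_Integration.integral_sum,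
        intro Bochner_Integration.integrable_sum integrable_mult_right integrable_viol_power2, simp,
        intro sum.cong refl Bochner_Integration.integral_sum[symmetric] integrable_mult_right integrable_viol_power2, simp)
  finally show ?thesis .
qed

text \<open>Young's inequality in each round: the reciprocal weight \<open>1 / \<gamma> t\<close> is
  \<open>\<alpha> t / \<gamma>0\<close>, so the price of absorbing a linear term is a multiple of
  \<open>sum_alpha T\<close>.\<close>

lemma mult_viol_le_weighted:
  assumes "0 < \<mu>"
  shows "k * total_viol T \<omega> \<le> \<mu> * weighted_viol T \<omega> + k\<^sup>2 * real CARD('n) / (4 * \<mu> * \<gamma>0) * sum_alpha T"
proof -
  have "k * total_viol T \<omega> = (\<Sum>t=1..T. \<Sum>j\<in>UNIV. k * viol j t \<omega>)"
    by (simp add: total_viol_def sum_distrib_left)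
  also have "\<dots> \<le> (\<Sum>t=1..T. \<Sum>j\<in>(UNIV :: 'n set). \<mu> * (\<gamma> t * (viol j t \<omega>)\<^sup>2) + k\<^sup>2 / (4 * \<mu> * \<gamma>0) * \<alpha> t)"
  proof (intro sum_mono)
    fix t j assume "t \<in> {1..T}"
    then have t: "1 \<le> t" by simp
    let ?q = "\<mu> * \<gamma> t"
    have q: "0 < ?q" using assms gamma_pos[OF t] by simp
    have "k * v \<le> a * v\<^sup>2 + k\<^sup>2 / (4 * a)" if "0 < a" for a v :: real
      using that zero_le_power2[of "2 * a * v - k"] by (simp add: power2_eq_square field_simps)
    from this[OF q, of "viol j t \<omega>"]
    have "k * viol j t \<omega> \<le> \<mu> * (\<gamma> t * (viol j t \<omega>)\<^sup>2) + k\<^sup>2 / (4 * ?q)" by (simp add: mult.assoc)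
    also have "k\<^sup>2 / (4 * ?q) = k\<^sup>2 / (4 * \<mu> * \<gamma>0) * \<alpha> t"
      using alpha_pos[OF t] by (simp add: parameters(2)[OF t])
    finally show "k * viol j t \<omega> \<le> \<mu> * (\<gamma> t * (viol j t \<omega>)\<^sup>2) + k\<^sup>2 / (4 * \<mu> * \<gamma>0) * \<alpha> t" .
  qed
  also have "\<dots> = \<mu> * weighted_viol T \<omega> + k\<^sup>2 * real CARD('n) / (4 * \<mu> * \<gamma>0) * sum_alpha T"
    unfolding weighted_viol_def sum_alpha_def by (simp add: sum.distrib sum_distrib_left sum_divide_distrib ac_simps)
  finally show ?thesis .
qed

lemma exponents:
  assumes "1 \<le> T"
  shows "real T powr (1 - \<theta>1) \<le> real T powr max (1 - \<theta>1) \<theta>1" "real T powr \<theta>1 \<le> real T powr max (1 - \<theta>1) \<theta>1"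
    "real T powr max (1 - \<theta>1) \<theta>1 \<le> real T" "1 \<le> real T powr (1 - \<theta>1)"
proof -
  show "real T powr (1 - \<theta>1) \<le> real T powr max (1 - \<theta>1) \<theta>1" "real T powr \<theta>1 \<le> real T powr max (1 - \<theta>1) \<theta>1"
    using assms by (auto intro!: powr_mono)
  have "real T powr max (1 - \<theta>1) \<theta>1 \<le> real T powr 1"
    using assms theta by (intro powr_mono) auto
  then show "real T powr max (1 - \<theta>1) \<theta>1 \<le> real T" using assms by simp
  show "1 \<le> real T powr (1 - \<theta>1)" using assms theta by (intro ge_one_powr_ge_zero) auto
qed

text \<open>
  The comparator \<open>y\<close> of the regret may depend on the whole sample path, so the noise is not centred
  against it. Its contribution is at most \<open>R * norm (noise_sum j T \<omega>)\<close>; the second moment of that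
  martingale is of order \<open>T + \<gamma> T * weighted_viol T\<close>, and the split with weight \<open>l * \<alpha> T\<close> makes its
  second part absorbable in the quadratic violation terms on the left.
\<close>

lemma regret_envelope:
  assumes k: "0 \<le> k"
  shows "\<exists>a\<ge>0. \<forall>T\<ge>1. \<exists>Z. integrable M Z \<and>
    (\<forall>\<omega>\<in>space M. \<forall>y\<in>feasible_set X m g T. local_reg y T \<omega> + k * total_viol T \<omega> + weighted_viol T \<omega> / 4 \<le> Z \<omega>) \<and>
    expectation Z \<le> a * real T powr max (1 - \<theta>1) \<theta>1"
proof -
  \<comment> \<open>Chosen so that the part of the noise variance that grows with the violation
    costs exactly a quarter of \<open>weighted_viol T\<close>.\<close>
  define l where "l = 1 / (16 * (real CARD('p))\<^sup>2 * G2\<^sup>2 * \<gamma>0)"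
  have l: "0 < l" using G2_pos gamma0_pos by (simp add: l_def)
  define A1 where "A1 = (c1 + (c3 + k)\<^sup>2 * real CARD('n) / \<gamma>0) * (\<alpha>0 / (1 - \<theta>1)) + 4 * (real CARD('p))\<^sup>2 * G1\<^sup>2 * real CARD('n) * l * \<alpha>0"
  define A2 where "A2 = (c2 + c2 * \<alpha>0 + real CARD('n) * R\<^sup>2 / (2 * l)) / \<alpha>0 + c6 * (s0 / (\<alpha>0 * \<theta>1))"
  have A: "0 \<le> A1" "0 \<le> A2"
    using c_nonneg c6_nonneg constants(1,5) theta l gamma0_pos by (auto simp: A1_def A2_def intro!: add_nonneg_nonneg mult_nonneg_nonneg divide_nonneg_nonneg)
  show ?thesis
  proof (intro exI[of _ "A1 + A2"] conjI allI impI)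
    show "0 \<le> A1 + A2" using A by simp
    fix T :: nat assume T: "1 \<le> T"
    define \<beta> where "\<beta> = l * \<alpha> T"
    have \<beta>: "0 < \<beta>" using l alpha_pos[OF T] by (simp add: \<beta>_def)
    define K where "K = (c2 + c2 * \<alpha>0) / \<alpha> T + c1 * sum_alpha T + real CARD('n) * (R\<^sup>2 / (2 * \<beta>))"
    let ?EA = "\<lambda>\<omega>. \<Sum>t=1..T. err_cost (Suc t) \<omega> / \<alpha> t"
    let ?S = "\<lambda>\<omega>. \<Sum>j\<in>UNIV. (norm (noise_sum j T \<omega>))\<^sup>2"
    \<comment> \<open>One of the three available quarters of \<open>weighted_viol T\<close> stays on
      the left; the other two appear here with coefficient 1/2. \<open>?Z\<close> does not mention
      \<open>y\<close>, so no expectation of a supremum over comparators is taken.\<close>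
    let ?Z = "\<lambda>\<omega>. K + ?EA \<omega> + (c3 + k) * total_viol T \<omega> - 1 / 2 * weighted_viol T \<omega> - noise_along_path T \<omega> + \<beta> / 2 * ?S \<omega>"
    have int_EA: "integrable M ?EA"
      by (intro Bochner_Integration.integrable_sum integrable_divide err_cost_mean(1)) simp
    have int_S: "integrable M ?S"
      using noise_sum_power2 by (intro Bochner_Integration.integrable_sum) blast
    note ints = int_EA int_S integrable_total_viol[of T] integrable_weighted_viol[of T] noise_along_path_mean(1)[of T]
    have int_Z: "integrable M ?Z"
      using ints by (intro Bochner_Integration.integrable_add Bochner_Integration.integrable_diff integrable_mult_right integrable_const)
    have "local_reg y T \<omega> + k * total_viol T \<omega> + weighted_viol T \<omega> / 4 \<le> ?Z \<omega>"
      if "\<omega> \<in> space M" "y \<in> feasible_set X m g T" for \<omega> y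
    proof -
      have "(\<Sum>j\<in>UNIV. R * norm (noise_sum j T \<omega>)) \<le> (\<Sum>j\<in>(UNIV :: 'n set). \<beta> / 2 * (norm (noise_sum j T \<omega>))\<^sup>2 + R\<^sup>2 / (2 * \<beta>))"
      proof (rule sum_mono)
        fix j
        show "R * norm (noise_sum j T \<omega>) \<le> \<beta> / 2 * (norm (noise_sum j T \<omega>))\<^sup>2 + R\<^sup>2 / (2 * \<beta>)"
          using \<beta> zero_le_power2[of "\<beta> * norm (noise_sum j T \<omega>) - R"] by (simp add: power2_eq_square field_simps)
      qed
      also have "\<dots> = \<beta> / 2 * ?S \<omega> + real CARD('n) * (R\<^sup>2 / (2 * \<beta>))"
        by (simp add: sum.distrib sum_distrib_left)
      finally show ?thesis
        using regret_pathwise[OF that(1) T that(2)] unfolding K_def distrib_right by argo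
    qed
    moreover have "expectation ?Z \<le> (A1 + A2) * real T powr max (1 - \<theta>1) \<theta>1"
    proof -
      have "expectation ?Z = K + expectation ?EA + (c3 + k) * expectation (total_viol T)
          - 1 / 2 * expectation (weighted_viol T) - expectation (noise_along_path T) + \<beta> / 2 * expectation ?S"
        using ints by (simp add: prob_space)
      also have "expectation (noise_along_path T) = 0" by (rule noise_along_path_mean(2))
      finally have eZ: "expectation ?Z = K + expectation ?EA + (c3 + k) * expectation (total_viol T)
          - 1 / 2 * expectation (weighted_viol T) + \<beta> / 2 * expectation ?S" by simp
      \<comment> \<open>Young's inequality with weight 1/4 spends the first of the two quarters on
        all linear violation terms, including the surcharge \<open>k\<close> reserved for the
        consensus error; \<open>e2\<close> spends the second one on the noise.\<close>
      have "expectation (\<lambda>\<omega>. (c3 + k) * total_viol T \<omega>)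
          \<le> expectation (\<lambda>\<omega>. 1 / 4 * weighted_viol T \<omega> + (c3 + k)\<^sup>2 * real CARD('n) / (4 * (1 / 4) * \<gamma>0) * sum_alpha T)"
        using ints by (intro integral_mono mult_viol_le_weighted Bochner_Integration.integrable_add integrable_mult_right integrable_const) simp_all
      then have e1: "(c3 + k) * expectation (total_viol T)
          \<le> 1 / 4 * expectation (weighted_viol T) + (c3 + k)\<^sup>2 * real CARD('n) / \<gamma>0 * sum_alpha T"
        using ints by (simp add: prob_space)
      have "expectation ?S \<le> 8 * (real CARD('p))\<^sup>2 * G1\<^sup>2 * (real CARD('n) * real T) + 8 * (real CARD('p))\<^sup>2 * G2\<^sup>2 * \<gamma> T * expectation (weighted_viol T)"
        using sum_noise_sum_power2_le[of T] noise_sum_power2 by (subst Bochner_Integration.integral_sum) auto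
      then have "\<beta> / 2 * expectation ?S \<le> \<beta> / 2 * (8 * (real CARD('p))\<^sup>2 * G1\<^sup>2 * (real CARD('n) * real T) + 8 * (real CARD('p))\<^sup>2 * G2\<^sup>2 * \<gamma> T * expectation (weighted_viol T))"
        using \<beta> by (intro mult_left_mono) auto
      also have "\<dots> = 4 * (real CARD('p))\<^sup>2 * G1\<^sup>2 * real CARD('n) * l * (\<alpha> T * real T) + (4 * (real CARD('p))\<^sup>2 * G2\<^sup>2 * l * (\<gamma> T * \<alpha> T)) * expectation (weighted_viol T)"
        by (simp add: \<beta>_def algebra_simps)
      also have "4 * (real CARD('p))\<^sup>2 * G2\<^sup>2 * l * (\<gamma> T * \<alpha> T) = 1 / 4"
        unfolding gamma_alpha[OF T] l_def using G2_pos gamma0_pos by simp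
      also have "\<alpha> T * real T = \<alpha>0 * real T powr (1 - \<theta>1)"
        using T by (simp add: parameters(1) powr_diff)
      finally have e2: "\<beta> / 2 * expectation ?S \<le> 4 * (real CARD('p))\<^sup>2 * G1\<^sup>2 * real CARD('n) * l * \<alpha>0 * real T powr (1 - \<theta>1) + 1 / 4 * expectation (weighted_viol T)"
        by (simp add: mult.assoc)
      have "expectation ?EA = (\<Sum>t=1..T. expectation (err_cost (Suc t)) / \<alpha> t)"
        by (simp add: err_cost_mean(1))
      also have "\<dots> \<le> (\<Sum>t=1..T. c6 * s (Suc t) / \<alpha> t)"
        by (intro sum_mono divide_right_mono err_cost_mean(2) less_imp_le[OF alpha_pos]) auto
      also have "\<dots> = c6 * (\<Sum>t=1..T. s (Suc t) / \<alpha> t)"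
        by (simp add: sum_distrib_left)
      also have "\<dots> \<le> c6 * (s0 / (\<alpha>0 * \<theta>1) * real T powr \<theta>1)"
        by (intro mult_left_mono sum_s_div_alpha_le c6_nonneg)
      finally have e3: "expectation ?EA \<le> c6 * (s0 / (\<alpha>0 * \<theta>1)) * real T powr \<theta>1" by simp
      have "(c1 + (c3 + k)\<^sup>2 * real CARD('n) / \<gamma>0) * sum_alpha T \<le> (c1 + (c3 + k)\<^sup>2 * real CARD('n) / \<gamma>0) * (\<alpha>0 / (1 - \<theta>1) * real T powr (1 - \<theta>1))"
        using c_nonneg gamma0_pos by (intro mult_left_mono sum_alpha_le) auto
      then have e4: "c1 * sum_alpha T + (c3 + k)\<^sup>2 * real CARD('n) / \<gamma>0 * sum_alpha T
          \<le> (c1 + (c3 + k)\<^sup>2 * real CARD('n) / \<gamma>0) * (\<alpha>0 / (1 - \<theta>1)) * real T powr (1 - \<theta>1)"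
        unfolding distrib_right[of c1 _ "sum_alpha T"] mult.assoc[of _ "\<alpha>0 / (1 - \<theta>1)"] .
      have e5: "(c2 + c2 * \<alpha>0) / \<alpha> T + real CARD('n) * (R\<^sup>2 / (2 * \<beta>)) = (c2 + c2 * \<alpha>0 + real CARD('n) * R\<^sup>2 / (2 * l)) / \<alpha>0 * real T powr \<theta>1"
      proof -
        have "(c2 + c2 * \<alpha>0) / \<alpha> T + real CARD('n) * (R\<^sup>2 / (2 * \<beta>)) = (c2 + c2 * \<alpha>0 + real CARD('n) * R\<^sup>2 / (2 * l)) * (1 / \<alpha> T)"
          by (simp add: \<beta>_def add_divide_distrib)
        then show ?thesis unfolding inverse_alpha[OF T] by simp
      qed
      have "expectation ?Z \<le> A1 * real T powr (1 - \<theta>1) + A2 * real T powr \<theta>1"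
        using eZ e1 e2 e3 e4 e5 unfolding K_def A1_def A2_def distrib_right by argo
      also have "\<dots> \<le> A1 * real T powr max (1 - \<theta>1) \<theta>1 + A2 * real T powr max (1 - \<theta>1) \<theta>1"
        by (intro add_mono mult_left_mono exponents T A)
      finally show ?thesis by (simp add: distrib_right)
    qed
    ultimately show "\<exists>Z. integrable M Z \<and>
      (\<forall>\<omega>\<in>space M. \<forall>y\<in>feasible_set X m g T. local_reg y T \<omega> + k * total_viol T \<omega> + weighted_viol T \<omega> / 4 \<le> Z \<omega>) \<and>
      expectation Z \<le> (A1 + A2) * real T powr max (1 - \<theta>1) \<theta>1"
      using int_Z by (intro exI[of _ ?Z]) blast
  qed
qed

section \<open>From local regret to network regret\<close>

definition total_diam :: "nat \<Rightarrow> 'w \<Rightarrow> real" where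
  "total_diam T \<omega> = (\<Sum>t=1..T. diam (\<lambda>i. x i t \<omega>))"

definition c7 :: real where "c7 = c5 * 2 / c4"

lemma c7_nonneg: "0 \<le> c7"
  using c4_pos by (simp add: c7_def c5_def)

text \<open>What the consensus bound contains besides the violation. Its mean has order
  \<open>T powr (1 - \<theta>1)\<close>, so only the violation part needs absorption.\<close>

definition consensus_rest :: "nat \<Rightarrow> 'w \<Rightarrow> real" where
  "consensus_rest T \<omega> = c7 * R + c7 * real CARD('p) * G1 * real CARD('n) * sum_alpha T + c7 * total_comp_err T \<omega>"

definition c8 :: real where
  "c8 = c7 * R + c7 * real CARD('p) * G1 * real CARD('n) * (\<alpha>0 / (1 - \<theta>1)) + c7 * (real CARD('n) * ((1 + C) / 2) * (s0 / (1 - \<theta>1)))"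

lemma c8_nonneg: "0 \<le> c8"
  using c7_nonneg X(4) G1_nonneg constants(1,5) theta compressor(1) by (simp add: c8_def)

lemma total_diam_le:
  assumes "\<omega> \<in> space M"
  shows "total_diam T \<omega> \<le> c7 * real CARD('p) * G2 * \<gamma>0 * total_viol T \<omega> + consensus_rest T \<omega>"
proof -
  have "(\<Sum>t=1..T. \<Sum>j\<in>(UNIV :: 'n set). real CARD('p) * G1 * \<alpha> t + real CARD('p) * G2 * \<gamma>0 * viol j t \<omega> + norm (comp_err j (Suc t) \<omega>))
      = real CARD('p) * G1 * real CARD('n) * sum_alpha T + real CARD('p) * G2 * \<gamma>0 * total_viol T \<omega> + total_comp_err T \<omega>"
    unfolding sum_alpha_def total_viol_def total_comp_err_def
    by (simp add: sum.distrib sum_distrib_left ac_simps)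
  then have "c4 * total_diam T \<omega> \<le> c5 * (2 * R) + 2 * c5 * (real CARD('p) * G1 * real CARD('n) * sum_alpha T + real CARD('p) * G2 * \<gamma>0 * total_viol T \<omega> + total_comp_err T \<omega>)"
    using consensus[OF assms, of T] unfolding total_diam_def by simp
  then have "total_diam T \<omega> \<le> (c5 * (2 * R) + 2 * c5 * (real CARD('p) * G1 * real CARD('n) * sum_alpha T + real CARD('p) * G2 * \<gamma>0 * total_viol T \<omega> + total_comp_err T \<omega>)) / c4"
    using c4_pos by (simp add: pos_le_divide_eq mult.commute)
  also have "\<dots> = c7 * real CARD('p) * G2 * \<gamma>0 * total_viol T \<omega> + consensus_rest T \<omega>"
    by (simp add: c7_def consensus_rest_def add_divide_distrib distrib_left ac_simps)
  finally show ?thesis .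
qed

lemma integrable_consensus_rest: "integrable M (consensus_rest T)"
  unfolding consensus_rest_def
  by (intro Bochner_Integration.integrable_add integrable_const integrable_mult_right integrable_total_comp_err)

lemma consensus_rest_mean:
  assumes T: "1 \<le> T" shows "expectation (consensus_rest T) \<le> c8 * real T powr (1 - \<theta>1)"
proof -
  let ?P = "real T powr (1 - \<theta>1)"
  have "expectation (consensus_rest T) = c7 * R + c7 * real CARD('p) * G1 * real CARD('n) * sum_alpha T + c7 * expectation (total_comp_err T)"
    unfolding consensus_rest_def using integrable_total_comp_err[of T] by (simp add: prob_space)
  also have "\<dots> \<le> c7 * R * ?P + c7 * real CARD('p) * G1 * real CARD('n) * (\<alpha>0 / (1 - \<theta>1) * ?P) + c7 * (real CARD('n) * ((1 + C) / 2) * (s0 / (1 - \<theta>1)) * ?P)"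
  proof (intro add_mono mult_left_mono sum_alpha_le total_comp_err_mean)
    have "c7 * R * 1 \<le> c7 * R * ?P"
      using exponents(4)[OF T] c7_nonneg X(4) by (intro mult_left_mono) auto
    then show "c7 * R \<le> c7 * R * ?P" by simp
  qed (use c7_nonneg G1_nonneg in simp_all)
  also have "\<dots> = c8 * ?P"
    by (simp add: c8_def distrib_right mult.assoc)
  finally show ?thesis .
qed

text \<open>Replacing the gradient at \<open>x i t\<close> by that at \<open>x j t\<close> costs
  \<open>2 * R * L\<close> times the diameter, and replacing the point in the inner product costs
  \<open>G1\<close> times the diameter.\<close>

lemma cross_regret_le:
  assumes \<omega>: "\<omega> \<in> space M" and y: "y \<in> X"
  shows "(\<Sum>t=1..T. gradient X (global_loss f t) (x i t \<omega>) \<bullet> (x i t \<omega> - y))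
    \<le> local_reg y T \<omega> / real CARD('n) + (2 * R * L + G1) * total_diam T \<omega>"
proof -
  let ?k = "2 * R * L + G1"
  have "(\<Sum>t=1..T. gradient X (global_loss f t) (x i t \<omega>) \<bullet> (x i t \<omega> - y))
      \<le> (\<Sum>t=1..T. (\<Sum>j\<in>UNIV. gradient X (f j t) (x j t \<omega>) \<bullet> (x j t \<omega> - y)) / real CARD('n) + ?k * diam (\<lambda>i. x i t \<omega>))"
  proof (rule sum_mono)
    fix t assume "t \<in> {1..T}"
    then have t: "1 \<le> t" by simp
    note xX = x_in_X[OF t \<omega>]
    have "gradient X (f j t) (x i t \<omega>) \<bullet> (x i t \<omega> - y)
        \<le> gradient X (f j t) (x j t \<omega>) \<bullet> (x j t \<omega> - y) + ?k * diam (\<lambda>i. x i t \<omega>)" for j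
    proof -
      let ?xi = "x i t \<omega>" and ?xj = "x j t \<omega>"
      let ?a = "gradient X (f j t) ?xi - gradient X (f j t) ?xj"
      note d = norm_diff_le_diam[of "\<lambda>i. x i t \<omega>" i j]
      have "?a \<bullet> (?xi - y) \<le> norm ?a * norm (?xi - y)" by (rule norm_cauchy_schwarz)
      also have "\<dots> \<le> (L * norm (?xi - ?xj)) * (2 * R)"
        using L_nonneg by (intro mult_mono f_grad_Lipschitz[OF t xX xX] dist_X xX y) auto
      also have "\<dots> \<le> (L * diam (\<lambda>i. x i t \<omega>)) * (2 * R)"
        using L_nonneg X(4) d by (intro mult_right_mono mult_left_mono) auto
      finally have 1: "?a \<bullet> (?xi - y) \<le> 2 * R * L * diam (\<lambda>i. x i t \<omega>)" by (simp add: ac_simps)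
      have "gradient X (f j t) ?xj \<bullet> (?xi - ?xj) \<le> norm (gradient X (f j t) ?xj) * norm (?xi - ?xj)"
        by (rule norm_cauchy_schwarz)
      also have "\<dots> \<le> G1 * diam (\<lambda>i. x i t \<omega>)"
        using f_grad_bound[OF t xX] d G1_nonneg by (intro mult_mono) auto
      finally have 2: "gradient X (f j t) ?xj \<bullet> (?xi - ?xj) \<le> G1 * diam (\<lambda>i. x i t \<omega>)" .
      have "gradient X (f j t) ?xi \<bullet> (?xi - y)
          = gradient X (f j t) ?xj \<bullet> (?xj - y) + ?a \<bullet> (?xi - y) + gradient X (f j t) ?xj \<bullet> (?xi - ?xj)"
        by (simp add: inner_diff_left inner_diff_right)
      then show ?thesis using 1 2 by (simp add: distrib_right)
    qed
    then have "(\<Sum>j\<in>UNIV. gradient X (f j t) (x i t \<omega>) \<bullet> (x i t \<omega> - y))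
        \<le> (\<Sum>j\<in>UNIV. gradient X (f j t) (x j t \<omega>) \<bullet> (x j t \<omega> - y) + ?k * diam (\<lambda>i. x i t \<omega>))"
      by (rule sum_mono)
    also have "\<dots> = (\<Sum>j\<in>UNIV. gradient X (f j t) (x j t \<omega>) \<bullet> (x j t \<omega> - y)) + real CARD('n) * (?k * diam (\<lambda>i. x i t \<omega>))"
      by (simp add: sum.distrib)
    finally have "(\<Sum>j\<in>UNIV. gradient X (f j t) (x i t \<omega>) \<bullet> (x i t \<omega> - y)) / real CARD('n)
        \<le> ((\<Sum>j\<in>UNIV. gradient X (f j t) (x j t \<omega>) \<bullet> (x j t \<omega> - y)) + real CARD('n) * (?k * diam (\<lambda>i. x i t \<omega>))) / real CARD('n)"
      by (rule divide_right_mono) simp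
    also have "\<dots> = (\<Sum>j\<in>UNIV. gradient X (f j t) (x j t \<omega>) \<bullet> (x j t \<omega> - y)) / real CARD('n) + ?k * diam (\<lambda>i. x i t \<omega>)"
      by (simp add: add_divide_distrib)
    also have "(\<Sum>j\<in>UNIV. gradient X (f j t) (x i t \<omega>) \<bullet> (x i t \<omega> - y)) / real CARD('n)
        = gradient X (global_loss f t) (x i t \<omega>) \<bullet> (x i t \<omega> - y)"
      unfolding gradient_global_loss[OF t xX] inner_scaleR_left inner_sum_left by (simp add: divide_inverse mult.commute)
    finally show "gradient X (global_loss f t) (x i t \<omega>) \<bullet> (x i t \<omega> - y)
        \<le> (\<Sum>j\<in>UNIV. gradient X (f j t) (x j t \<omega>) \<bullet> (x j t \<omega> - y)) / real CARD('n) + ?k * diam (\<lambda>i. x i t \<omega>)" .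
  qed
  also have "\<dots> = local_reg y T \<omega> / real CARD('n) + ?k * total_diam T \<omega>"
    unfolding local_reg_def total_diam_def by (simp only: sum.distrib sum_distrib_left sum_divide_distrib)
  finally show ?thesis .
qed

lemma feasible_subset: "feasible_set X m g T \<subseteq> X"
  by (auto simp: feasible_set_def)

lemma bdd_below_feasible: "bdd_below ((\<bullet>) v ` feasible_set X m g T)"
proof (rule bdd_belowI2)
  fix y assume "y \<in> feasible_set X m g T"
  then have "norm y \<le> R" using feasible_subset norm_X by blast
  then have "norm v * norm y \<le> norm v * R" by (intro mult_left_mono) auto
  then show "- (norm v * R) \<le> v \<bullet> y"
    using Cauchy_Schwarz_ineq2[of v y] by linarith
qed

lemma net_reg_le:
  assumes \<omega>: "\<omega> \<in> space M" and T: "1 \<le> T" and b: "\<And>y. y \<in> feasible_set X m g T \<Longrightarrow> local_reg y T \<omega> \<le> b"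
  shows "net_reg X m f g (\<lambda>i t. x i t \<omega>) T \<le> b / real CARD('n) + (2 * R * L + G1) * total_diam T \<omega>"
proof -
  let ?b = "b / real CARD('n) + (2 * R * L + G1) * total_diam T \<omega>"
  let ?G = "\<lambda>i t. gradient X (global_loss f t) (x i t \<omega>)"
  have "(\<Sum>t=1..T. ?G i t \<bullet> x i t \<omega>) - (INF y\<in>feasible_set X m g T. (\<Sum>t=1..T. ?G i t) \<bullet> y) \<le> ?b" for i
  proof -
    have "(\<Sum>t=1..T. ?G i t \<bullet> x i t \<omega>) - ?b \<le> (INF y\<in>feasible_set X m g T. (\<Sum>t=1..T. ?G i t) \<bullet> y)"
    proof (rule cINF_greatest[OF feasible[OF T]])
      fix y assume y: "y \<in> feasible_set X m g T"
      then have "(\<Sum>t=1..T. ?G i t \<bullet> (x i t \<omega> - y)) \<le> local_reg y T \<omega> / real CARD('n) + (2 * R * L + G1) * total_diam T \<omega>"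
        using feasible_subset by (intro cross_regret_le[OF \<omega>]) auto
      also have "\<dots> \<le> ?b"
        using b[OF y] by (intro add_right_mono divide_right_mono) auto
      finally show "(\<Sum>t=1..T. ?G i t \<bullet> x i t \<omega>) - ?b \<le> (\<Sum>t=1..T. ?G i t) \<bullet> y"
        by (simp add: inner_diff_right sum_subtractf inner_sum_left)
    qed
    then show ?thesis by linarith
  qed
  then have "(\<Sum>i\<in>UNIV. (\<Sum>t=1..T. ?G i t \<bullet> x i t \<omega>) - (INF y\<in>feasible_set X m g T. (\<Sum>t=1..T. ?G i t) \<bullet> y))
      \<le> (\<Sum>i\<in>(UNIV :: 'n set). ?b)"
    by (rule sum_mono)
  then have "net_reg X m f g (\<lambda>i t. x i t \<omega>) T \<le> (\<Sum>i\<in>(UNIV :: 'n set). ?b) / real CARD('n)"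
    unfolding net_reg_def by (rule divide_right_mono) simp
  then show ?thesis by simp
qed

lemma measurable_gradient_x:
  assumes t: "1 \<le> t" shows "(\<lambda>\<omega>. gradient X (global_loss f t) (x i t \<omega>)) \<in> borel_measurable M"
proof -
  have "continuous_on X (gradient X (f j t))" for j
  proof (rule lipschitz_on_continuous_on, rule lipschitz_onI)
    show "dist (gradient X (f j t) y) (gradient X (f j t) y') \<le> L * dist y y'" if "y \<in> X" "y' \<in> X" for y y'
      unfolding dist_norm by (rule f_grad_Lipschitz[OF t that])
  qed (rule L_nonneg)
  then have "(\<lambda>y. gradient X (f j t) (closest_point X y)) \<in> borel_measurable borel" for j
    by (intro borel_measurable_continuous_onI continuous_compose_closest_point)
  then have "(\<lambda>\<omega>. (\<Sum>j\<in>UNIV. gradient X (f j t) (closest_point X (x i t \<omega>))) /\<^sub>R real CARD('n)) \<in> borel_measurable M"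
    by (intro borel_measurable_scaleR borel_measurable_const borel_measurable_sum measurable_compose[OF measurable_x_M[OF t]])
  then show ?thesis
    by (rule measurable_cong[THEN iffD2, rotated])
      (simp add: gradient_global_loss[OF t x_in_X[OF t]] closest_point_self x_in_X[OF t])
qed

lemma norm_gradient_x_le:
  assumes \<omega>: "\<omega> \<in> space M" and t: "1 \<le> t" shows "norm (gradient X (global_loss f t) (x i t \<omega>)) \<le> G1"
proof -
  have "norm (\<Sum>j\<in>UNIV. gradient X (f j t) (x i t \<omega>)) \<le> (\<Sum>j\<in>(UNIV :: 'n set). G1)"
    by (rule order_trans[OF norm_sum]) (intro sum_mono f_grad_bound t x_in_X \<omega>)
  then show ?thesis
    unfolding gradient_global_loss[OF t x_in_X[OF t \<omega>]] by (simp add: field_simps)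
qed

text \<open>Integrability is claimed together with the bound because the integral of a
  non-integrable function is 0 by default. The point at issue is measurability of the infimum over
  the feasible set, which is in general an uncountable family.\<close>

lemma integrable_net_reg:
  assumes T: "1 \<le> T" shows "integrable M (\<lambda>\<omega>. net_reg X m f g (\<lambda>i t. x i t \<omega>) T)"
proof -
  let ?F = "feasible_set X m g T"
  let ?G = "\<lambda>i t \<omega>. gradient X (global_loss f t) (x i t \<omega>)"
  let ?\<iota> = "\<lambda>v. INF y\<in>?F. v \<bullet> y"
  have lower: "?\<iota> v \<le> v \<bullet> y" if "y \<in> ?F" for v y
    by (rule cINF_lower[OF bdd_below_feasible that])
  have inner_le: "v \<bullet> y \<le> R * norm v" if "y \<in> ?F" for v y
  proof -
    have "v \<bullet> y \<le> norm v * norm y" by (rule norm_cauchy_schwarz)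
    also have "\<dots> \<le> norm v * R" using that feasible_subset norm_X by (intro mult_left_mono) auto
    finally show ?thesis by (simp add: mult.commute)
  qed
  \<comment> \<open>As a function of the summed gradients the infimum is \<open>R\<close>-Lipschitz,
    since all linear functionals involved are; continuity replaces a countability argument.\<close>
  have lip: "?\<iota> v - ?\<iota> v' \<le> R * norm (v - v')" for v v'
  proof -
    have "?\<iota> v - R * norm (v - v') \<le> ?\<iota> v'"
    proof (rule cINF_greatest[OF feasible[OF T]])
      fix y assume y: "y \<in> ?F"
      show "?\<iota> v - R * norm (v - v') \<le> v' \<bullet> y"
        using lower[OF y, of v] inner_le[OF y, of "v - v'"] by (simp add: inner_diff_left)
    qed
    then show ?thesis by linarith
  qed
  have "continuous_on UNIV ?\<iota>"
  proof (rule lipschitz_on_continuous_on, rule lipschitz_onI)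
    fix v v' :: "real ^ 'p"
    show "dist (?\<iota> v) (?\<iota> v') \<le> R * dist v v'"
      using lip[of v v'] lip[of v' v] by (simp add: dist_norm norm_minus_commute abs_le_iff)
  qed (use X(4) in simp)
  then have meas_\<iota>: "?\<iota> \<in> borel_measurable borel"
    by (rule borel_measurable_continuous_onI)
  have bound_\<iota>: "\<bar>?\<iota> v\<bar> \<le> R * norm v" for v
  proof -
    obtain y where "y \<in> ?F" using feasible[OF T] by blast
    then have "?\<iota> v \<le> R * norm v" using lower inner_le order_trans by blast
    moreover have "- (R * norm v) \<le> ?\<iota> v"
    proof (rule cINF_greatest[OF feasible[OF T]])
      fix y assume "y \<in> ?F"
      from inner_le[OF this, of "- v"] show "- (R * norm v) \<le> v \<bullet> y" by simp
    qed
    ultimately show ?thesis by (simp add: abs_le_iff)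
  qed
  have int1: "integrable M (\<lambda>\<omega>. \<Sum>t=1..T. ?G i t \<omega> \<bullet> x i t \<omega>)" for i
  proof (rule Bochner_Integration.integrable_sum)
    fix t assume "t \<in> {1..T}"
    then have t: "1 \<le> t" by simp
    show "integrable M (\<lambda>\<omega>. ?G i t \<omega> \<bullet> x i t \<omega>)"
    proof (rule integrable_bounded)
      show "(\<lambda>\<omega>. ?G i t \<omega> \<bullet> x i t \<omega>) \<in> borel_measurable M"
        by (intro borel_measurable_inner measurable_gradient_x measurable_x_M t)
      fix \<omega> assume \<omega>: "\<omega> \<in> space M"
      have "\<bar>?G i t \<omega> \<bullet> x i t \<omega>\<bar> \<le> norm (?G i t \<omega>) * norm (x i t \<omega>)" by (rule Cauchy_Schwarz_ineq2)
      also have "\<dots> \<le> G1 * R"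
        using G1_nonneg by (intro mult_mono norm_gradient_x_le norm_X x_in_X \<omega> t) auto
      finally show "norm (?G i t \<omega> \<bullet> x i t \<omega>) \<le> G1 * R" by simp
    qed
  qed
  have int2: "integrable M (\<lambda>\<omega>. ?\<iota> (\<Sum>t=1..T. ?G i t \<omega>))" for i
  proof (rule integrable_bounded)
    show "(\<lambda>\<omega>. ?\<iota> (\<Sum>t=1..T. ?G i t \<omega>)) \<in> borel_measurable M"
      by (rule measurable_compose[OF _ meas_\<iota>], rule borel_measurable_sum, rule measurable_gradient_x) simp
    fix \<omega> assume \<omega>: "\<omega> \<in> space M"
    have "norm (\<Sum>t=1..T. ?G i t \<omega>) \<le> (\<Sum>t=1..T. G1)"
      by (rule order_trans[OF norm_sum], rule sum_mono, rule norm_gradient_x_le[OF \<omega>]) simp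
    then have "R * norm (\<Sum>t=1..T. ?G i t \<omega>) \<le> R * (\<Sum>t=1..T. G1)"
      using X(4) by (intro mult_left_mono) auto
    then show "norm (?\<iota> (\<Sum>t=1..T. ?G i t \<omega>)) \<le> R * (\<Sum>t=1..T. G1)"
      unfolding real_norm_def by (rule order_trans[OF bound_\<iota>])
  qed
  show ?thesis
    unfolding net_reg_def
    by (intro integrable_divide Bochner_Integration.integrable_sum Bochner_Integration.integrable_diff int1 int2)
qed

section \<open>Constraint violation of the network\<close>

definition stacked_violation :: "nat \<Rightarrow> real ^ 'p \<Rightarrow> real" where
  "stacked_violation t y = L2_set (\<lambda>(j, k). max 0 (g j t y k)) (SIGMA j:UNIV. {..<m j})"

lemma stacked_violation_eq: "stacked_violation t y = L2_set (\<lambda>j. violation j t y) UNIV"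
proof -
  have "(\<Sum>z\<in>(SIGMA j:UNIV. {..<m j}). ((\<lambda>(j, k). max 0 (g j t y k)) z)\<^sup>2)
      = (\<Sum>j\<in>UNIV. \<Sum>k<m j. (max 0 (g j t y k))\<^sup>2)"
    by (subst sum.Sigma) (auto intro!: sum.cong)
  then show ?thesis
    by (simp add: stacked_violation_def violation_def L2_set_def sum_nonneg)
qed

lemma net_ccv_eq: "net_ccv m g (\<lambda>i t. x i t \<omega>) T = (\<Sum>i\<in>UNIV. \<Sum>t=1..T. L2_set (\<lambda>j. violation j t (x i t \<omega>)) UNIV) / real CARD('n)"
  unfolding net_ccv_def stacked_violation_def[symmetric] stacked_violation_eq ..

text \<open>At the iterate of agent \<open>i\<close> the constraints of agent \<open>j\<close> are
  compared with their values at agent \<open>j\<close>'s own iterate, the only place where the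
  descent controls them.\<close>

lemma net_ccv_le:
  assumes \<omega>: "\<omega> \<in> space M"
  shows "net_ccv m g (\<lambda>i t. x i t \<omega>) T \<le> total_viol T \<omega> + real CARD('n) * G2 * total_diam T \<omega>"
proof -
  have "(\<Sum>t=1..T. L2_set (\<lambda>j. violation j t (x i t \<omega>)) UNIV) \<le> total_viol T \<omega> + real CARD('n) * G2 * total_diam T \<omega>" for i
  proof -
    have "(\<Sum>t=1..T. L2_set (\<lambda>j. violation j t (x i t \<omega>)) UNIV)
        \<le> (\<Sum>t=1..T. \<Sum>j\<in>UNIV. viol j t \<omega> + G2 * diam (\<lambda>i. x i t \<omega>))"
    proof (rule sum_mono)
      fix t assume "t \<in> {1..T}"
      then have t: "1 \<le> t" by simp
      have "L2_set (\<lambda>j. violation j t (x i t \<omega>)) UNIV \<le> (\<Sum>j\<in>UNIV. violation j t (x i t \<omega>))"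
        by (rule L2_set_le_sum) simp
      also have "\<dots> \<le> (\<Sum>j\<in>UNIV. viol j t \<omega> + G2 * diam (\<lambda>i. x i t \<omega>))"
      proof (rule sum_mono)
        fix j
        have "G2 * norm (x i t \<omega> - x j t \<omega>) \<le> G2 * diam (\<lambda>i. x i t \<omega>)"
          using G2_pos norm_diff_le_diam[of "\<lambda>i. x i t \<omega>" i j] by (intro mult_left_mono) auto
        then show "violation j t (x i t \<omega>) \<le> viol j t \<omega> + G2 * diam (\<lambda>i. x i t \<omega>)"
          using violation_lipschitz[OF t x_in_X[OF t \<omega>] x_in_X[OF t \<omega>], of j i j] unfolding viol_def by linarith
      qed
      finally show "L2_set (\<lambda>j. violation j t (x i t \<omega>)) UNIV \<le> (\<Sum>j\<in>UNIV. viol j t \<omega> + G2 * diam (\<lambda>i. x i t \<omega>))" .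
    qed
    also have "\<dots> = total_viol T \<omega> + real CARD('n) * G2 * total_diam T \<omega>"
      unfolding total_viol_def total_diam_def by (simp add: sum.distrib sum_distrib_left mult.assoc)
    finally show ?thesis .
  qed
  then have "(\<Sum>i\<in>UNIV. \<Sum>t=1..T. L2_set (\<lambda>j. violation j t (x i t \<omega>)) UNIV)
      \<le> (\<Sum>i\<in>(UNIV :: 'n set). total_viol T \<omega> + real CARD('n) * G2 * total_diam T \<omega>)"
    by (rule sum_mono)
  then have "net_ccv m g (\<lambda>i t. x i t \<omega>) T \<le> (\<Sum>i\<in>(UNIV :: 'n set). total_viol T \<omega> + real CARD('n) * G2 * total_diam T \<omega>) / real CARD('n)"
    unfolding net_ccv_eq by (rule divide_right_mono) simp
  then show ?thesis by simp
qed

lemma integrable_net_ccv: "integrable M (\<lambda>\<omega>. net_ccv m g (\<lambda>i t. x i t \<omega>) T)"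
  unfolding net_ccv_eq
proof (intro integrable_divide Bochner_Integration.integrable_sum)
  fix i t assume "t \<in> {1..T}"
  then have t: "1 \<le> t" by simp
  show "integrable M (\<lambda>\<omega>. L2_set (\<lambda>j. violation j t (x i t \<omega>)) UNIV)"
  proof (rule integrable_bounded)
    have "(\<lambda>\<omega>. \<Sum>j\<in>UNIV. (violation j t (x i t \<omega>))\<^sup>2) \<in> borel_measurable M"
      by (intro borel_measurable_sum borel_measurable_power measurable_violation_X measurable_x_M x_in_X t)
    then show "(\<lambda>\<omega>. L2_set (\<lambda>j. violation j t (x i t \<omega>)) UNIV) \<in> borel_measurable M"
      unfolding L2_set_def by (rule measurable_compose[OF _ borel_measurable_sqrt])
    fix \<omega> assume \<omega>: "\<omega> \<in> space M"
    have "L2_set (\<lambda>j. violation j t (x i t \<omega>)) UNIV \<le> (\<Sum>j\<in>UNIV. violation j t (x i t \<omega>))"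
      by (rule L2_set_le_sum) simp
    also have "\<dots> \<le> (\<Sum>j\<in>(UNIV :: 'n set). 2 * R * G2)"
      by (intro sum_mono violation_le x_in_X t \<omega>)
    finally show "norm (L2_set (\<lambda>j. violation j t (x i t \<omega>)) UNIV) \<le> (\<Sum>j\<in>(UNIV :: 'n set). 2 * R * G2)"
      by simp
  qed
qed

section \<open>Expected rates\<close>

lemma net_reg_bound:
  "\<exists>a>0. \<forall>T\<ge>1. integrable M (\<lambda>\<omega>. net_reg X m f g (\<lambda>i t. x i t \<omega>) T) \<and>
    expectation (\<lambda>\<omega>. net_reg X m f g (\<lambda>i t. x i t \<omega>) T) \<le> a * real T powr max (1 - \<theta>1) \<theta>1"
proof -
  define \<kappa> where "\<kappa> = 2 * R * L + G1"
  have \<kappa>: "0 \<le> \<kappa>" using X(4) L_nonneg G1_nonneg by (simp add: \<kappa>_def)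
  \<comment> \<open>Chosen so that the violation part of the consensus error cancels against the
    term \<open>k * total_viol T\<close> on the left of the envelope; \<open>real CARD('n)\<close>
    undoes the averaging of the local regret.\<close>
  define k where "k = real CARD('n) * (\<kappa> * (c7 * real CARD('p) * G2 * \<gamma>0))"
  have k: "0 \<le> k" using \<kappa> c7_nonneg G2_pos gamma0_pos by (simp add: k_def)
  obtain a where a: "0 \<le> a" and env: "\<And>T. 1 \<le> T \<Longrightarrow> \<exists>Z. integrable M Z \<and>
    (\<forall>\<omega>\<in>space M. \<forall>y\<in>feasible_set X m g T. local_reg y T \<omega> + k * total_viol T \<omega> + weighted_viol T \<omega> / 4 \<le> Z \<omega>) \<and>
    expectation Z \<le> a * real T powr max (1 - \<theta>1) \<theta>1"
    using regret_envelope[OF k] by blast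
  have bound: "expectation (\<lambda>\<omega>. net_reg X m f g (\<lambda>i t. x i t \<omega>) T) \<le> (a / real CARD('n) + \<kappa> * c8 + 1) * real T powr max (1 - \<theta>1) \<theta>1"
    if T: "1 \<le> T" for T
  proof -
    let ?P = "real T powr (1 - \<theta>1)" and ?P' = "real T powr max (1 - \<theta>1) \<theta>1"
    obtain Z where Z: "integrable M Z" "expectation Z \<le> a * ?P'"
      and Z_ge: "\<And>\<omega> y. \<omega> \<in> space M \<Longrightarrow> y \<in> feasible_set X m g T \<Longrightarrow>
        local_reg y T \<omega> + k * total_viol T \<omega> + weighted_viol T \<omega> / 4 \<le> Z \<omega>"
      using env[OF T] by blast
    have "net_reg X m f g (\<lambda>i t. x i t \<omega>) T \<le> Z \<omega> / real CARD('n) + \<kappa> * consensus_rest T \<omega>" if \<omega>: "\<omega> \<in> space M" for \<omega>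
    proof -
      have "net_reg X m f g (\<lambda>i t. x i t \<omega>) T \<le> (Z \<omega> - k * total_viol T \<omega>) / real CARD('n) + \<kappa> * total_diam T \<omega>"
        unfolding \<kappa>_def
      proof (rule net_reg_le[OF \<omega> T])
        fix y assume "y \<in> feasible_set X m g T"
        then show "local_reg y T \<omega> \<le> Z \<omega> - k * total_viol T \<omega>"
          using Z_ge[OF \<omega>] weighted_viol_nonneg[of T \<omega>] by fastforce
      qed
      also have "\<dots> \<le> (Z \<omega> - k * total_viol T \<omega>) / real CARD('n) + \<kappa> * (c7 * real CARD('p) * G2 * \<gamma>0 * total_viol T \<omega> + consensus_rest T \<omega>)"
        by (intro add_left_mono mult_left_mono total_diam_le \<omega> \<kappa>)
      also have "\<dots> = Z \<omega> / real CARD('n) + \<kappa> * consensus_rest T \<omega>"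
        by (simp add: k_def diff_divide_distrib distrib_left)
      finally show ?thesis .
    qed
    then have "expectation (\<lambda>\<omega>. net_reg X m f g (\<lambda>i t. x i t \<omega>) T) \<le> expectation (\<lambda>\<omega>. Z \<omega> / real CARD('n) + \<kappa> * consensus_rest T \<omega>)"
      using Z(1) by (intro integral_mono integrable_net_reg T Bochner_Integration.integrable_add integrable_divide
          integrable_mult_right integrable_consensus_rest)
    also have "\<dots> = expectation Z / real CARD('n) + \<kappa> * expectation (consensus_rest T)"
      using Z(1) integrable_consensus_rest[of T] by simp
    also have "\<dots> \<le> a * ?P' / real CARD('n) + \<kappa> * (c8 * ?P)"
      by (intro add_mono divide_right_mono Z(2) mult_left_mono consensus_rest_mean T \<kappa>) simp
    also have "\<dots> = a / real CARD('n) * ?P' + \<kappa> * c8 * ?P" by simp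
    also have "\<dots> \<le> a / real CARD('n) * ?P' + \<kappa> * c8 * ?P'"
      using \<kappa> c8_nonneg by (intro add_left_mono mult_left_mono exponents(1)[OF T]) auto
    also have "\<dots> \<le> (a / real CARD('n) + \<kappa> * c8 + 1) * ?P'"
      by (simp add: distrib_right)
    finally show ?thesis .
  qed
  \<comment> \<open>The summand 1 makes the constant positive even when the others vanish.\<close>
  have "0 < a / real CARD('n) + \<kappa> * c8 + 1"
    using a \<kappa> c8_nonneg by (intro add_nonneg_pos add_nonneg_nonneg mult_nonneg_nonneg divide_nonneg_nonneg) auto
  then show ?thesis
    using bound integrable_net_reg by blast
qed

text \<open>The consensus error is a multiple of the violation plus a rest of order
  \<open>T powr (1 - \<theta>1)\<close>. Hence both rates for the network follow from a rate
  \<open>q\<close> for the total violation that is no better than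
  \<open>1 - \<theta>1\<close>.\<close>

lemma net_ccv_bound_of_total_viol:
  assumes viol: "\<And>T. 1 \<le> T \<Longrightarrow> expectation (total_viol T) \<le> b * real T powr q" and b: "0 \<le> b" and q: "1 - \<theta>1 \<le> q"
  shows "\<exists>a>0. \<forall>T\<ge>1. integrable M (\<lambda>\<omega>. net_ccv m g (\<lambda>i t. x i t \<omega>) T) \<and>
    expectation (\<lambda>\<omega>. net_ccv m g (\<lambda>i t. x i t \<omega>) T) \<le> a * real T powr q"
proof -
  define \<kappa> where "\<kappa> = real CARD('n) * G2"
  have \<kappa>: "0 \<le> \<kappa>" using G2_pos by (simp add: \<kappa>_def)
  define k where "k = 1 + \<kappa> * (c7 * real CARD('p) * G2 * \<gamma>0)"
  have k: "0 \<le> k" using \<kappa> c7_nonneg G2_pos gamma0_pos by (simp add: k_def)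
  have bound: "expectation (\<lambda>\<omega>. net_ccv m g (\<lambda>i t. x i t \<omega>) T) \<le> (k * b + \<kappa> * c8 + 1) * real T powr q"
    if T: "1 \<le> T" for T
  proof -
    let ?P = "real T powr (1 - \<theta>1)" and ?P' = "real T powr q"
    have PP: "?P \<le> ?P'" using T q by (intro powr_mono) auto
    have "net_ccv m g (\<lambda>i t. x i t \<omega>) T \<le> k * total_viol T \<omega> + \<kappa> * consensus_rest T \<omega>" if \<omega>: "\<omega> \<in> space M" for \<omega>
    proof -
      have "net_ccv m g (\<lambda>i t. x i t \<omega>) T \<le> total_viol T \<omega> + \<kappa> * total_diam T \<omega>"
        unfolding \<kappa>_def by (rule net_ccv_le[OF \<omega>])
      also have "\<dots> \<le> total_viol T \<omega> + \<kappa> * (c7 * real CARD('p) * G2 * \<gamma>0 * total_viol T \<omega> + consensus_rest T \<omega>)"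
        by (intro add_left_mono mult_left_mono total_diam_le \<omega> \<kappa>)
      also have "\<dots> = k * total_viol T \<omega> + \<kappa> * consensus_rest T \<omega>"
        by (simp add: k_def distrib_left distrib_right)
      finally show ?thesis .
    qed
    then have "expectation (\<lambda>\<omega>. net_ccv m g (\<lambda>i t. x i t \<omega>) T) \<le> expectation (\<lambda>\<omega>. k * total_viol T \<omega> + \<kappa> * consensus_rest T \<omega>)"
      by (intro integral_mono integrable_net_ccv Bochner_Integration.integrable_add integrable_mult_right
          integrable_total_viol integrable_consensus_rest)
    also have "\<dots> = k * expectation (total_viol T) + \<kappa> * expectation (consensus_rest T)"
      using integrable_total_viol[of T] integrable_consensus_rest[of T] by simp
    also have "\<dots> \<le> k * (b * ?P') + \<kappa> * (c8 * ?P)"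
      by (intro add_mono mult_left_mono viol consensus_rest_mean T k \<kappa>)
    also have "\<dots> = k * b * ?P' + \<kappa> * c8 * ?P" by simp
    also have "\<dots> \<le> k * b * ?P' + \<kappa> * c8 * ?P'"
      using \<kappa> c8_nonneg by (intro add_left_mono mult_left_mono PP) auto
    also have "\<dots> \<le> (k * b + \<kappa> * c8 + 1) * ?P'"
      by (simp add: distrib_right)
    finally show ?thesis .
  qed
  have "0 < k * b + \<kappa> * c8 + 1"
    using b k \<kappa> c8_nonneg by (intro add_nonneg_pos add_nonneg_nonneg mult_nonneg_nonneg) auto
  then show ?thesis
    using bound integrable_net_ccv by blast
qed

text \<open>The linearised regret can be negative; a constant lower bound per agent and round is
  what lets regret inequalities be read as bounds on the violation.\<close>

lemma gradient_inner_ge: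
  assumes "\<omega> \<in> space M" "1 \<le> t" "y \<in> X"
  shows "- (G1 * (2 * R)) \<le> gradient X (f j t) (x j t \<omega>) \<bullet> (x j t \<omega> - y)"
proof -
  have "norm (gradient X (f j t) (x j t \<omega>)) * norm (x j t \<omega> - y) \<le> G1 * (2 * R)"
    using G1_nonneg by (intro mult_mono f_grad_bound dist_X x_in_X assms) auto
  then show ?thesis
    using Cauchy_Schwarz_ineq2[of "gradient X (f j t) (x j t \<omega>)" "x j t \<omega> - y"] by linarith
qed

text \<open>Since the local regret is bounded below only by a negative multiple of \<open>T\<close>,
  the envelope leaves \<open>weighted_viol T\<close> with a mean of order \<open>T\<close>. Young's
  inequality converts this quadratic quantity into the sum of the violations.\<close>

lemma total_viol_mean:
  "\<exists>b\<ge>0. \<forall>T\<ge>1. expectation (total_viol T) \<le> b * real T powr (1 - \<theta>1 / 2)"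
proof -
  obtain a where a: "0 \<le> a" and env: "\<And>T. 1 \<le> T \<Longrightarrow> \<exists>Z. integrable M Z \<and>
    (\<forall>\<omega>\<in>space M. \<forall>y\<in>feasible_set X m g T. local_reg y T \<omega> + 0 * total_viol T \<omega> + weighted_viol T \<omega> / 4 \<le> Z \<omega>) \<and>
    expectation Z \<le> a * real T powr max (1 - \<theta>1) \<theta>1"
    using regret_envelope[OF order_refl] by blast
  define a' where "a' = 4 * a + 4 * (real CARD('n) * (G1 * (2 * R)))"
  have a': "0 \<le> a'" using a G1_nonneg X(4) by (simp add: a'_def)
  define b where "b = a' + real CARD('n) / (4 * \<gamma>0) * (\<alpha>0 / (1 - \<theta>1))"
  have "expectation (total_viol T) \<le> b * real T powr (1 - \<theta>1 / 2)" if T: "1 \<le> T" for T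
  proof -
    obtain Z where Z: "integrable M Z" "expectation Z \<le> a * real T powr max (1 - \<theta>1) \<theta>1"
      and Z_ge: "\<And>\<omega> y. \<omega> \<in> space M \<Longrightarrow> y \<in> feasible_set X m g T \<Longrightarrow>
        local_reg y T \<omega> + 0 * total_viol T \<omega> + weighted_viol T \<omega> / 4 \<le> Z \<omega>"
      using env[OF T] by blast
    obtain y where y: "y \<in> feasible_set X m g T" "y \<in> X"
      using feasible[OF T] feasible_subset by blast
    have "weighted_viol T \<omega> \<le> 4 * Z \<omega> + 4 * (real CARD('n) * (G1 * (2 * R))) * real T" if \<omega>: "\<omega> \<in> space M" for \<omega>
    proof -
      have "(\<Sum>t=1..T. \<Sum>j\<in>(UNIV :: 'n set). - (G1 * (2 * R))) \<le> local_reg y T \<omega>"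
        unfolding local_reg_def by (intro sum_mono gradient_inner_ge \<omega> y(2)) simp
      then have "- (real CARD('n) * (G1 * (2 * R)) * real T) \<le> local_reg y T \<omega>" by (simp add: ac_simps)
      then show ?thesis using Z_ge[OF \<omega> y(1)] by simp
    qed
    then have "expectation (weighted_viol T) \<le> expectation (\<lambda>\<omega>. 4 * Z \<omega> + 4 * (real CARD('n) * (G1 * (2 * R))) * real T)"
      using Z(1) by (intro integral_mono integrable_weighted_viol Bochner_Integration.integrable_add integrable_const integrable_mult_right)
    also have "\<dots> = 4 * expectation Z + 4 * (real CARD('n) * (G1 * (2 * R))) * real T"
      using Z(1) by (simp add: prob_space)
    also have "\<dots> \<le> 4 * (a * real T) + 4 * (real CARD('n) * (G1 * (2 * R))) * real T"
      using Z(2) mult_left_mono[OF exponents(3)[OF T] a] by linarith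
    finally have wv: "expectation (weighted_viol T) \<le> a' * real T"
      by (simp add: a'_def distrib_right mult.assoc)
    \<comment> \<open>Balances the two sides of Young's inequality: both \<open>\<mu> * T\<close>
      and \<open>T powr (1 - \<theta>1) / \<mu>\<close> become
      \<open>T powr (1 - \<theta>1 / 2)\<close>.\<close>
    define \<mu> where "\<mu> = real T powr (- (\<theta>1 / 2))"
    have \<mu>: "0 < \<mu>" using T by (simp add: \<mu>_def)
    have "expectation (\<lambda>\<omega>. 1 * total_viol T \<omega>) \<le> expectation (\<lambda>\<omega>. \<mu> * weighted_viol T \<omega> + 1\<^sup>2 * real CARD('n) / (4 * \<mu> * \<gamma>0) * sum_alpha T)"
      by (intro integral_mono mult_viol_le_weighted \<mu> Bochner_Integration.integrable_add integrable_const integrable_mult_right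
          integrable_total_viol integrable_weighted_viol)
    then have "expectation (total_viol T) \<le> \<mu> * expectation (weighted_viol T) + real CARD('n) / (4 * \<mu> * \<gamma>0) * sum_alpha T"
      using integrable_weighted_viol[of T] by (simp add: prob_space)
    also have "\<dots> \<le> \<mu> * (a' * real T) + real CARD('n) / (4 * \<mu> * \<gamma>0) * (\<alpha>0 / (1 - \<theta>1) * real T powr (1 - \<theta>1))"
      using wv \<mu> gamma0_pos by (intro add_mono mult_left_mono sum_alpha_le) auto
    also have "\<dots> = a' * (\<mu> * real T) + real CARD('n) / (4 * \<gamma>0) * (\<alpha>0 / (1 - \<theta>1)) * (1 / \<mu> * real T powr (1 - \<theta>1))"
      using \<mu> gamma0_pos theta by (simp add: field_simps)
    also have "\<mu> * real T = real T powr (1 - \<theta>1 / 2)"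
    proof -
      have "\<mu> * real T = real T powr (- (\<theta>1 / 2)) * real T powr 1"
        using T by (simp add: \<mu>_def)
      also have "\<dots> = real T powr (- (\<theta>1 / 2) + 1)"
        by (rule powr_add[symmetric])
      also have "- (\<theta>1 / 2) + 1 = 1 - \<theta>1 / 2" by simp
      finally show ?thesis .
    qed
    also have "1 / \<mu> * real T powr (1 - \<theta>1) = real T powr (1 - \<theta>1 / 2)"
    proof -
      have "1 / \<mu> * real T powr (1 - \<theta>1) = real T powr (\<theta>1 / 2 + (1 - \<theta>1))"
        unfolding powr_add \<mu>_def powr_minus_divide by simp
      also have "\<theta>1 / 2 + (1 - \<theta>1) = 1 - \<theta>1 / 2" by simp
      finally show ?thesis .
    qed
    finally show ?thesis by (simp add: b_def distrib_right)
  qed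
  moreover have "0 \<le> b"
    using a' gamma0_pos constants(1) theta by (simp add: b_def)
  ultimately show ?thesis by blast
qed

text \<open>With the factor \<open>\<alpha> t\<close> kept, the linear term has the constant
  coefficient \<open>\<sigma> * \<gamma>0\<close>, the potential telescopes to a constant, and the
  loss costs only a multiple of \<open>sum_alpha T\<close>. The comparator does not depend on the
  path, so the noise is centred against it and disappears in the mean.\<close>

lemma total_viol_mean_slater:
  assumes xs: "xs \<in> X" and \<sigma>: "0 < \<sigma>" and slater: "\<And>t i k. 1 \<le> t \<Longrightarrow> k < m i \<Longrightarrow> g i t xs k \<le> - \<sigma>"
  shows "\<exists>b\<ge>0. \<forall>T\<ge>1. expectation (total_viol T) \<le> b * real T powr (1 - \<theta>1)"
proof -
  \<comment> \<open>\<open>A1\<close> collects the coefficients of \<open>\<alpha> t\<close>: the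
    lower bound on the loss, \<open>c1\<close>, and the \<open>c3\<close> term at the largest
    possible violation. \<open>A2\<close> bounds the two telescoping sums.\<close>
  define A1 where "A1 = real CARD('n) * (G1 * (2 * R)) + c1 + c3 * (real CARD('n) * (2 * R * G2))"
  have A1: "0 \<le> A1" using c_nonneg G1_nonneg X(4) G2_pos by (simp add: A1_def)
  define A2 where "A2 = real CARD('n) * (4 * R\<^sup>2) / 2 + c2 * \<alpha>0"
  have A2: "0 \<le> A2" using c_nonneg constants(1) by (simp add: A2_def)
  define b where "b = (A1 * (\<alpha>0 / (1 - \<theta>1)) + A2 + c6 * (s0 / (1 - \<theta>1))) / (\<sigma> * \<gamma>0)"
  let ?EC = "\<lambda>T \<omega>. \<Sum>t=1..T. err_cost (Suc t) \<omega>"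
  let ?N = "\<lambda>T \<omega>. \<Sum>t=1..T. \<alpha> t * (\<Sum>j\<in>UNIV. noise j t \<omega> \<bullet> (x j t \<omega> - (1 - \<xi> t) *\<^sub>R xs))"
  have pathwise: "\<sigma> * \<gamma>0 * total_viol T \<omega> \<le> A1 * sum_alpha T + A2 + ?EC T \<omega> - ?N T \<omega>" if \<omega>: "\<omega> \<in> space M" for T \<omega>
  proof -
    have "\<sigma> * \<gamma>0 * total_viol T \<omega> = (\<Sum>t=1..T. \<sigma> * \<gamma>0 * (\<Sum>j\<in>UNIV. viol j t \<omega>))"
      by (simp add: total_viol_def sum_distrib_left)
    also have "\<dots> \<le> (\<Sum>t=1..T. A1 * \<alpha> t + (potential xs t \<omega> - potential xs (Suc t) \<omega>) / 2 + c2 * (\<alpha> t - \<alpha> (Suc t))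
        + err_cost (Suc t) \<omega> - \<alpha> t * (\<Sum>j\<in>UNIV. noise j t \<omega> \<bullet> (x j t \<omega> - (1 - \<xi> t) *\<^sub>R xs)))"
    proof (rule sum_mono)
      fix t assume "t \<in> {1..T}"
      then have t: "1 \<le> t" by simp
      note \<alpha> = alpha_pos[OF t]
      have 1: "\<alpha> t * (\<Sum>j\<in>UNIV. - (G1 * (2 * R)) + \<sigma> * \<gamma> t * viol j t \<omega>)
          \<le> \<alpha> t * (\<Sum>j\<in>UNIV. gradient X (f j t) (x j t \<omega>) \<bullet> (x j t \<omega> - xs) + 3 / 4 * (\<gamma> t * (viol j t \<omega>)\<^sup>2) + \<sigma> * \<gamma> t * viol j t \<omega>)"
      proof (intro mult_left_mono sum_mono add_right_mono)
        fix j
        have "0 \<le> 3 / 4 * (\<gamma> t * (viol j t \<omega>)\<^sup>2)" using gamma_pos[OF t] by simp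
        then show "- (G1 * (2 * R)) \<le> gradient X (f j t) (x j t \<omega>) \<bullet> (x j t \<omega> - xs) + 3 / 4 * (\<gamma> t * (viol j t \<omega>)\<^sup>2)"
          using gradient_inner_ge[OF \<omega> t xs, of j] by linarith
      qed (use \<alpha> in simp)
      \<comment> \<open>Here \<open>\<alpha> t * \<gamma> t = \<gamma>0\<close> makes the Slater
        term independent of the step size.\<close>
      have 2: "\<alpha> t * (\<Sum>j\<in>UNIV. - (G1 * (2 * R)) + \<sigma> * \<gamma> t * viol j t \<omega>)
          = \<sigma> * \<gamma>0 * (\<Sum>j\<in>UNIV. viol j t \<omega>) - real CARD('n) * (G1 * (2 * R)) * \<alpha> t"
        unfolding gamma_alpha[OF t, symmetric]
        by (simp add: sum.distrib sum_subtractf sum_distrib_left right_diff_distrib ac_simps)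
      have 3: "c1 * (\<alpha> t)\<^sup>2 \<le> c1 * \<alpha> t"
        using \<alpha> alpha_less_1[OF t] c_nonneg(1) unfolding power2_eq_square
        by (intro mult_left_mono) (auto simp: mult_left_le)
      \<comment> \<open>The linear error term, unlike the Slater term, still carries the factor
        \<open>\<alpha> t\<close>, so the uniform bound on the violation is enough and nothing has
        to be absorbed.\<close>
      have 4: "\<alpha> t * (c3 * (\<Sum>j\<in>UNIV. viol j t \<omega>)) \<le> \<alpha> t * (c3 * (real CARD('n) * (2 * R * G2)))"
      proof (intro mult_left_mono)
        have "(\<Sum>j\<in>UNIV. viol j t \<omega>) \<le> (\<Sum>j\<in>(UNIV :: 'n set). 2 * R * G2)"
          by (intro sum_mono viol_le \<omega> t)
        then show "(\<Sum>j\<in>UNIV. viol j t \<omega>) \<le> real CARD('n) * (2 * R * G2)" by simp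
      qed (use \<alpha> c_nonneg in simp_all)
      have 5: "A1 * \<alpha> t = real CARD('n) * (G1 * (2 * R)) * \<alpha> t + c1 * \<alpha> t + \<alpha> t * (c3 * (real CARD('n) * (2 * R * G2)))"
        by (simp add: A1_def algebra_simps)
      have arith: "v \<le> A + dp + da + e - N"
        if "l \<le> L" "l = v - g1" "k1 \<le> k1'" "cv \<le> cv'" "A = g1 + k1' + cv'" "L \<le> dp + k1 + da + e + cv - N"
        for v A dp da e N l L g1 k1 k1' cv cv' :: real
        using that by linarith
      show "\<sigma> * \<gamma>0 * (\<Sum>j\<in>UNIV. viol j t \<omega>) \<le> A1 * \<alpha> t + (potential xs t \<omega> - potential xs (Suc t) \<omega>) / 2 + c2 * (\<alpha> t - \<alpha> (Suc t))
        + err_cost (Suc t) \<omega> - \<alpha> t * (\<Sum>j\<in>UNIV. noise j t \<omega> \<bullet> (x j t \<omega> - (1 - \<xi> t) *\<^sub>R xs))"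
        by (rule arith[OF 1 2 3 4 5 descent[OF \<omega> t xs less_imp_le[OF \<sigma>] slater[OF t]]])
    qed
    also have "\<dots> = A1 * sum_alpha T + (\<Sum>t=1..T. potential xs t \<omega> - potential xs (Suc t) \<omega>) / 2
        + c2 * (\<Sum>t=1..T. \<alpha> t - \<alpha> (Suc t)) + ?EC T \<omega> - ?N T \<omega>"
      unfolding sum_alpha_def by (simp only: sum.distrib sum_subtractf[of "\<lambda>t. _ t + _ t"] sum_distrib_left sum_divide_distrib)
    also have "(\<Sum>t=1..T. potential xs t \<omega> - potential xs (Suc t) \<omega>) = potential xs 1 \<omega> - potential xs (Suc T) \<omega>"
      by (induction T) auto
    also have "(\<Sum>t=1..T. \<alpha> t - \<alpha> (Suc t)) = \<alpha> 1 - \<alpha> (Suc T)"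
      by (induction T) auto
    also have "A1 * sum_alpha T + (potential xs 1 \<omega> - potential xs (Suc T) \<omega>) / 2 + c2 * (\<alpha> 1 - \<alpha> (Suc T)) + ?EC T \<omega> - ?N T \<omega>
        \<le> A1 * sum_alpha T + A2 + ?EC T \<omega> - ?N T \<omega>"
    proof -
      have "c2 * (\<alpha> 1 - \<alpha> (Suc T)) \<le> c2 * \<alpha>0"
        using alpha_le[of 1] alpha_pos[of "Suc T"] c_nonneg by (intro mult_left_mono) auto
      moreover have "A + (v - v') / 2 + d + e - N \<le> A + (V / 2 + D) + e - N" if "v \<le> V" "0 \<le> v'" "d \<le> D"
        for A v v' d e N V D :: real
        using that by argo
      ultimately show ?thesis
        unfolding A2_def using potential_le[OF \<omega> le_refl xs] potential_nonneg[of xs "Suc T" \<omega>] by blast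
    qed
    finally show ?thesis .
  qed
  have noise0: "integrable M (?N T)" "expectation (?N T) = 0" for T
  proof -
    have *: "integrable M (\<lambda>\<omega>. noise j t \<omega> \<bullet> (x j t \<omega> - (1 - \<xi> t) *\<^sub>R xs))"
      "expectation (\<lambda>\<omega>. noise j t \<omega> \<bullet> (x j t \<omega> - (1 - \<xi> t) *\<^sub>R xs)) = 0" if t: "1 \<le> t" for t j
    proof -
      have meas: "(\<lambda>\<omega>. x j t \<omega> - (1 - \<xi> t) *\<^sub>R xs) \<in> borel_measurable (inputs (now t))"
        by (intro borel_measurable_diff measurable_x t borel_measurable_const)
      have bd: "norm (x j t \<omega> - (1 - \<xi> t) *\<^sub>R xs) \<le> 2 * R" if "\<omega> \<in> space M" for \<omega>
        using scaled_in_Xs[OF xs] Xs_subset[OF t] by (intro dist_X x_in_X[OF t that]) auto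
      show "integrable M (\<lambda>\<omega>. noise j t \<omega> \<bullet> (x j t \<omega> - (1 - \<xi> t) *\<^sub>R xs))"
        "expectation (\<lambda>\<omega>. noise j t \<omega> \<bullet> (x j t \<omega> - (1 - \<xi> t) *\<^sub>R xs)) = 0"
        by (rule expectation_noise_inner[OF t meas bd], assumption)+
    qed
    show "integrable M (?N T)"
      by (intro Bochner_Integration.integrable_sum integrable_mult_right *(1)) simp
    have "expectation (?N T) = (\<Sum>t=1..T. \<alpha> t * (\<Sum>j\<in>UNIV. expectation (\<lambda>\<omega>. noise j t \<omega> \<bullet> (x j t \<omega> - (1 - \<xi> t) *\<^sub>R xs))))"
      by (subst Bochner_Integration.integral_sum, intro integrable_mult_right Bochner_Integration.integrable_sum *(1), simp,
          intro sum.cong refl, subst integral_mult_right_zero, subst Bochner_Integration.integral_sum, intro *(1), simp, rule refl)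
    then show "expectation (?N T) = 0" by (simp add: *(2))
  qed
  have "expectation (total_viol T) \<le> b * real T powr (1 - \<theta>1)" if T: "1 \<le> T" for T
  proof -
    let ?P = "real T powr (1 - \<theta>1)"
    have int_EC: "integrable M (?EC T)"
      by (intro Bochner_Integration.integrable_sum err_cost_mean(1)) simp
    have "expectation (\<lambda>\<omega>. \<sigma> * \<gamma>0 * total_viol T \<omega>) \<le> expectation (\<lambda>\<omega>. A1 * sum_alpha T + A2 + ?EC T \<omega> - ?N T \<omega>)"
      by (intro integral_mono pathwise integrable_mult_right integrable_total_viol Bochner_Integration.integrable_add
          Bochner_Integration.integrable_diff integrable_const int_EC noise0(1))
    also have "\<dots> = A1 * sum_alpha T + A2 + expectation (?EC T) - expectation (?N T)"
      using int_EC noise0(1)[of T] by (simp add: prob_space)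
    also have "\<dots> = A1 * sum_alpha T + A2 + expectation (?EC T)"
      by (simp only: noise0(2) diff_0_right)
    also have "expectation (?EC T) = (\<Sum>t=1..T. expectation (err_cost (Suc t)))"
      by (simp add: err_cost_mean(1))
    also have "\<dots> \<le> (\<Sum>t=1..T. c6 * s (Suc t))"
      by (intro sum_mono err_cost_mean(2)) simp
    also have "\<dots> = c6 * (\<Sum>t=1..T. s (Suc t))"
      by (simp add: sum_distrib_left)
    also have "A1 * sum_alpha T + A2 + c6 * (\<Sum>t=1..T. s (Suc t))
        \<le> A1 * (\<alpha>0 / (1 - \<theta>1) * ?P) + A2 * ?P + c6 * (s0 / (1 - \<theta>1) * ?P)"
    proof (intro add_mono mult_left_mono sum_alpha_le sum_s_le A1 c6_nonneg)
      show "A2 \<le> A2 * ?P" using mult_left_mono[OF exponents(4)[OF T] A2] by simp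
    qed
    also have "\<dots> = (A1 * (\<alpha>0 / (1 - \<theta>1)) + A2 + c6 * (s0 / (1 - \<theta>1))) * ?P"
      by (simp add: distrib_right)
    finally have "\<sigma> * \<gamma>0 * expectation (total_viol T) \<le> (A1 * (\<alpha>0 / (1 - \<theta>1)) + A2 + c6 * (s0 / (1 - \<theta>1))) * ?P"
      by simp
    then have "expectation (total_viol T) \<le> (A1 * (\<alpha>0 / (1 - \<theta>1)) + A2 + c6 * (s0 / (1 - \<theta>1))) * ?P / (\<sigma> * \<gamma>0)"
      using \<sigma> gamma0_pos by (simp add: pos_le_divide_eq mult.commute)
    then show ?thesis by (simp add: b_def)
  qed
  moreover have "0 \<le> b"
    using A1 A2 c6_nonneg constants(1,5) theta \<sigma> gamma0_pos by (simp add: b_def)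
  ultimately show ?thesis by blast
qed

lemma net_ccv_bound:
  "\<exists>a>0. \<forall>T\<ge>1. integrable M (\<lambda>\<omega>. net_ccv m g (\<lambda>i t. x i t \<omega>) T) \<and>
    expectation (\<lambda>\<omega>. net_ccv m g (\<lambda>i t. x i t \<omega>) T) \<le> a * real T powr (1 - \<theta>1 / 2)"
proof -
  obtain b where "0 \<le> b" "\<And>T. 1 \<le> T \<Longrightarrow> expectation (total_viol T) \<le> b * real T powr (1 - \<theta>1 / 2)"
    using total_viol_mean by blast
  then show ?thesis using theta by (intro net_ccv_bound_of_total_viol) auto
qed

lemma net_ccv_bound_slater:
  assumes "xs \<in> X" "0 < \<sigma>" "\<And>t i k. 1 \<le> t \<Longrightarrow> k < m i \<Longrightarrow> g i t xs k \<le> - \<sigma>"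
  shows "\<exists>a>0. \<forall>T\<ge>1. integrable M (\<lambda>\<omega>. net_ccv m g (\<lambda>i t. x i t \<omega>) T) \<and>
    expectation (\<lambda>\<omega>. net_ccv m g (\<lambda>i t. x i t \<omega>) T) \<le> a * real T powr (1 - \<theta>1)"
proof -
  obtain b where "0 \<le> b" "\<And>T. 1 \<le> T \<Longrightarrow> expectation (total_viol T) \<le> b * real T powr (1 - \<theta>1)"
    using total_viol_mean_slater[OF assms] by blast
  then show ?thesis by (intro net_ccv_bound_of_total_viol) auto
qed

lemma regret_and_violation_bounds:
  shows "(\<exists>a>0. \<forall>T\<ge>1.
            integrable M (\<lambda>\<omega>. net_reg X m f g (\<lambda>i t. x i t \<omega>) T) \<and>
            (\<integral>\<omega>. net_reg X m f g (\<lambda>i t. x i t \<omega>) T \<partial>M) \<le> a * real T powr max (1 - \<theta>1) \<theta>1)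
       \<and> (\<exists>a>0. \<forall>T\<ge>1.
            integrable M (\<lambda>\<omega>. net_ccv m g (\<lambda>i t. x i t \<omega>) T) \<and>
            (\<integral>\<omega>. net_ccv m g (\<lambda>i t. x i t \<omega>) T \<partial>M) \<le> a * real T powr (1 - \<theta>1 / 2))
       \<and> ((\<exists>xs\<in>X. \<exists>\<sigma>>0. \<forall>t\<ge>1. \<forall>i. \<forall>k<m i. g i t xs k \<le> - \<sigma>) \<longrightarrow>
          (\<exists>a>0. \<forall>T\<ge>1.
            integrable M (\<lambda>\<omega>. net_ccv m g (\<lambda>i t. x i t \<omega>) T) \<and>
            (\<integral>\<omega>. net_ccv m g (\<lambda>i t. x i t \<omega>) T \<partial>M) \<le> a * real T powr (1 - \<theta>1)))"
proof (intro conjI impI)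
  show "\<exists>a>0. \<forall>T\<ge>1. integrable M (\<lambda>\<omega>. net_ccv m g (\<lambda>i t. x i t \<omega>) T) \<and>
      expectation (\<lambda>\<omega>. net_ccv m g (\<lambda>i t. x i t \<omega>) T) \<le> a * real T powr (1 - \<theta>1)"
    if ex: "\<exists>xs\<in>X. \<exists>\<sigma>>0. \<forall>t\<ge>1. \<forall>i. \<forall>k<m i. g i t xs k \<le> - \<sigma>"
  proof -
    obtain xs \<sigma> where xs: "xs \<in> X" "0 < \<sigma>" and slater: "\<forall>t\<ge>1. \<forall>i. \<forall>k<m i. g i t xs k \<le> - \<sigma>"
      using ex by blast
    have "g i t xs k \<le> - \<sigma>" if "1 \<le> t" "k < m i" for t i k
      using slater that by blast
    with xs show ?thesis by (rule net_ccv_bound_slater)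
  qed
qed (rule net_reg_bound net_ccv_bound)+

end

theorem theorem2:
  fixes X Y :: "(real ^ 'p::finite) set"
    and r R G1 G2 L w C :: real
    and m :: "'n::finite \<Rightarrow> nat"
    and f :: "'n \<Rightarrow> nat \<Rightarrow> real ^ 'p \<Rightarrow> real"
    and g :: "'n \<Rightarrow> nat \<Rightarrow> real ^ 'p \<Rightarrow> nat \<Rightarrow> real"
    and E :: "nat \<Rightarrow> ('n \<times> 'n) set"
    and W :: "nat \<Rightarrow> real ^ 'n ^ 'n"
    and B :: nat
    and K :: "'c measure"
    and Q :: "real ^ 'p \<Rightarrow> 'c \<Rightarrow> real ^ 'p"
    and M :: "'w measure"
    and u :: "'n \<Rightarrow> nat \<Rightarrow> 'w \<Rightarrow> real ^ 'p"
    and c :: "'n \<Rightarrow> nat \<Rightarrow> 'w \<Rightarrow> 'c"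
    and \<alpha>0 \<gamma>0 s0 \<theta>1 \<theta>2 :: real
    and \<alpha> \<gamma> \<xi> \<delta> s :: "nat \<Rightarrow> real"
    and z1 :: "'n \<Rightarrow> real ^ 'p"
    and z zh x :: "'n \<Rightarrow> nat \<Rightarrow> 'w \<Rightarrow> real ^ 'p"
    and zs :: "'n \<Rightarrow> 'n \<Rightarrow> nat \<Rightarrow> 'w \<Rightarrow> real ^ 'p"
  assumes X: "closed X" "convex X" "0 < r" "0 < R" "cball 0 r \<subseteq> X" "X \<subseteq> cball 0 R"
    and f_diff: "\<And>i t. 1 \<le> t \<Longrightarrow> f i t differentiable_on X"
    and g_diff: "\<And>i t k. 1 \<le> t \<Longrightarrow> k < m i \<Longrightarrow> (\<lambda>y. g i t y k) differentiable_on X"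
    and g_convex: "\<And>i t k. 1 \<le> t \<Longrightarrow> k < m i \<Longrightarrow> convex_on X (\<lambda>y. g i t y k)"
    and f_grad_bound: "\<And>i t y. 1 \<le> t \<Longrightarrow> y \<in> X \<Longrightarrow> norm (gradient X (f i t) y) \<le> G1"
    and g_grad_bound: "\<And>i t y. 1 \<le> t \<Longrightarrow> y \<in> X \<Longrightarrow>
          spectral_norm (m i) (\<lambda>k. gradient X (\<lambda>y'. g i t y' k) y) \<le> G2"
    and f_grad_Lipschitz: "\<And>i t y y'. 1 \<le> t \<Longrightarrow> y \<in> X \<Longrightarrow> y' \<in> X \<Longrightarrow>
          norm (gradient X (f i t) y - gradient X (f i t) y') \<le> L * norm (y - y')"
    and feasible: "\<And>T. 1 \<le> T \<Longrightarrow> feasible_set X m g T \<noteq> {}"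
    and w: "w \<in> {0<..<1}"
    and weights: "\<And>t i j. 1 \<le> t \<Longrightarrow>
          (if (j, i) \<in> E t \<or> i = j then W t $ i $ j \<ge> w else W t $ i $ j = 0)"
    and doubly_stochastic: "\<And>t. 1 \<le> t \<Longrightarrow> doubly_stochastic (W t)"
    and connected: "0 < B" "\<And>t. 1 \<le> t \<Longrightarrow> strongly_connected (\<Union>l\<in>{0..B - 1}. E (t + l))"
    and neighbours_0: "\<And>i. in_neighbours E 0 i = in_neighbours E 1 i"
    and compressor: "0 \<le> C" "bounded_error_compressor Y K Q C"
    and randomness: "algorithm_randomness M K u c"
    and constants: "0 < \<alpha>0" "\<alpha>0 < 1" "\<theta>1 \<in> {0<..<1}"
          "\<gamma>0 \<in> {0<..1 / (4 * ((real CARD('p))\<^sup>2 + 1) * G2\<^sup>2)}" "0 < s0" "1 \<le> \<theta>2"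
    and parameters: "\<And>t. 1 \<le> t \<Longrightarrow> \<alpha> t = \<alpha>0 / real t powr \<theta>1"
          "\<And>t. 1 \<le> t \<Longrightarrow> \<gamma> t = \<gamma>0 / \<alpha> t"
          "\<And>t. 1 \<le> t \<Longrightarrow> \<xi> t = \<alpha> t"
          "\<And>t. 1 \<le> t \<Longrightarrow> \<delta> t = r * \<alpha> t"
          "\<And>t. 1 \<le> t \<Longrightarrow> s t = s0 / real t powr \<theta>2"
    and initial: "\<And>i. z1 i \<in> (*\<^sub>R) (1 - \<xi> 1) ` X"
    and path: "\<And>\<omega>. \<omega> \<in> space M \<Longrightarrow>
          compressed_bandit_path X Q E W m f g \<alpha> \<gamma> \<xi> \<delta> s z1
            (\<lambda>i t. u i t \<omega>) (\<lambda>i t. c i t \<omega>) (\<lambda>i t. z i t \<omega>) (\<lambda>i t. zh i t \<omega>)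
            (\<lambda>i j t. zs i j t \<omega>) (\<lambda>i t. x i t \<omega>)"
    and x_in: "\<And>i t \<omega>. 1 \<le> t \<Longrightarrow> \<omega> \<in> space M \<Longrightarrow> x i t \<omega> \<in> (*\<^sub>R) (1 - \<xi> t) ` X"
    and args_in: "\<And>i t \<omega>. 1 \<le> t \<Longrightarrow> \<omega> \<in> space M \<Longrightarrow>
          (z i t \<omega> - zh i (t - 1) \<omega>) /\<^sub>R s t \<in> Y"
  shows "(\<exists>a>0. \<forall>T\<ge>1.
            integrable M (\<lambda>\<omega>. net_reg X m f g (\<lambda>i t. x i t \<omega>) T) \<and>
            (\<integral>\<omega>. net_reg X m f g (\<lambda>i t. x i t \<omega>) T \<partial>M) \<le> a * real T powr max (1 - \<theta>1) \<theta>1)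
       \<and> (\<exists>a>0. \<forall>T\<ge>1.
            integrable M (\<lambda>\<omega>. net_ccv m g (\<lambda>i t. x i t \<omega>) T) \<and>
            (\<integral>\<omega>. net_ccv m g (\<lambda>i t. x i t \<omega>) T \<partial>M) \<le> a * real T powr (1 - \<theta>1 / 2))
       \<and> ((\<exists>xs\<in>X. \<exists>\<sigma>>0. \<forall>t\<ge>1. \<forall>i. \<forall>k<m i. g i t xs k \<le> - \<sigma>) \<longrightarrow>
          (\<exists>a>0. \<forall>T\<ge>1.
            integrable M (\<lambda>\<omega>. net_ccv m g (\<lambda>i t. x i t \<omega>) T) \<and>
            (\<integral>\<omega>. net_ccv m g (\<lambda>i t. x i t \<omega>) T \<partial>M) \<le> a * real T powr (1 - \<theta>1)))"
proof -
  have "compressed_bandit X Y r R G1 G2 L w C m f g E W B K Q M u c \<alpha>0 \<gamma>0 s0 \<theta>1 \<theta>2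
      \<alpha> \<gamma> \<xi> \<delta> s z1 z zh x zs"
    by (rule compressed_bandit.intro, fact X(1), fact X(2), fact X(3), fact X(4), fact X(5),
        fact X(6), fact f_diff, fact g_diff, fact g_convex, fact f_grad_bound, fact g_grad_bound,
        fact f_grad_Lipschitz, fact feasible, fact w, fact weights, fact doubly_stochastic,
        fact connected(1), fact connected(2), fact neighbours_0, fact compressor(1),
        fact compressor(2), fact randomness, fact constants(1), fact constants(2), fact constants(3),
        fact constants(4), fact constants(5), fact constants(6), fact parameters(1),
        fact parameters(2), fact parameters(3), fact parameters(4), fact parameters(5), fact initial,
        fact path, fact x_in, fact args_in)
  then show ?thesis
    by (rule compressed_bandit.regret_and_violation_bounds)
qed

end
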